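(* Let $(X_i)_{i\ge 1}$ be i.i.d. real-valued random variables with $\mathbb E(X_1)=0$, $\mathbb E(X_1^2)=\sigma^2>0$, and suppose there exists $\delta>0$ such that $\mathbb E(|X_1|^{2+\delta})<\infty$. Then there exists a constant $c>0$ such that for any integer $n\ge 1$, any $u\ge 0$ and any $x\in\mathbb R$, $$\left|\mathbb P\left(\frac{x+S_n}{\sigma\sqrt n}\le u,\ \tau_x>n\right)-\frac{V(x)\,L\left(\frac{x}{\sigma\sqrt n}\right)}{\sigma\sqrt n}\int_0^u \ell_H\left(\frac{x}{\sigma\sqrt n},y\right)dy\right|\le c\,\frac{R_n(\delta,x)}{\sqrt n},$$ where $$R_n(\delta,x)=\frac{1}{n^{\delta/4}}+\frac{V(x)\,L\left(\frac{x}{\sigma\sqrt n}\right)}{n^{\frac{\delta}{4(3+\delta)}}}\log n .$$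
   Context: Let $S_n=\sum_{i=1}^n X_i$ for $n\ge1$. For $x\in\mathbb R$, $\tau_x=\inf\{k\ge 1: x+S_k<0\}$ (with $\inf\emptyset=\infty$). Define $V(x)=-\mathbb E(S_{\tau_x})$ for $x\in\mathbb R$; under the stated moment assumptions it is known that $V$ is well defined, non-negative and non-decreasing, and that $V(x)=\lim_{n\to\infty}\mathbb E\big((x+S_n)\mathbf 1_{\{\tau_x>n\}}\big)$. Let $\Phi$ and $\phi$ be the standard normal distribution function and density, and $H(x)=2\Phi(x)-1$. Define $L(x)=H(x)/x$ for $x\neq 0$ and $L(0)=2/\sqrt{2\pi}$. Define $\psi(x,y)=\phi(x-y)-\phi(x+y)$ for $x,y\in\mathbb R$ (Dirichlet heat kernel), and $\ell_H(x,y)=\psi(x,y)/H(x)$ for $x\ne 0$, extended by continuity to $\ell_H(0,y)=y e^{-y^2/2}$. The constant $c$ may depend on $\delta$ and on the law of $X_1$, but not on $n,u,x$. *)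

theory Defs
  imports "HOL-Probability.Probability" "HOL-Library.Extended_Nat"
begin

definition walk :: "(nat \<Rightarrow> 'a \<Rightarrow> real) \<Rightarrow> nat \<Rightarrow> 'a \<Rightarrow> real" where
  "walk X n \<omega> = (\<Sum>i=1..n. X i \<omega>)"

text \<open>On \<^typ>\<open>enat\<close> the infimum of the empty set is \<open>\<infinity>\<close>.\<close>

definition exit_time :: "(nat \<Rightarrow> 'a \<Rightarrow> real) \<Rightarrow> real \<Rightarrow> 'a \<Rightarrow> enat" where
  "exit_time X x \<omega> = (INF k\<in>{k. 1 \<le> k \<and> x + walk X k \<omega> < 0}. enat k)"

text \<open>The walk at the exit time. The value on the event that the exit time is infinite is a
  convention only: that event is a null set for centred walks with positive variance.\<close>

definition exit_walk :: "(nat \<Rightarrow> 'a \<Rightarrow> real) \<Rightarrow> real \<Rightarrow> 'a \<Rightarrow> real" where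
  "exit_walk X x \<omega> = (case exit_time X x \<omega> of enat k \<Rightarrow> walk X k \<omega> | \<infinity> \<Rightarrow> 0)"

definition V :: "'a measure \<Rightarrow> (nat \<Rightarrow> 'a \<Rightarrow> real) \<Rightarrow> real \<Rightarrow> real" where
  "V M X x = - (\<integral>\<omega>. exit_walk X x \<omega> \<partial>M)"

definition H :: "real \<Rightarrow> real" where
  "H x = 2 * cdf std_normal_distribution x - 1"

definition L :: "real \<Rightarrow> real" where
  "L x = (if x = 0 then 2 / sqrt (2 * pi) else H x / x)"

definition psi :: "real \<Rightarrow> real \<Rightarrow> real" where
  "psi x y = std_normal_density (x - y) - std_normal_density (x + y)"

text \<open>The value at \<open>x = 0\<close> is the limit of \<open>psi x y / H x\<close> as \<open>x\<close> tends to \<open>0\<close>.\<close>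

definition ell_H :: "real \<Rightarrow> real \<Rightarrow> real" where
  "ell_H x y = (if x = 0 then y * exp (- (y\<^sup>2) / 2) else psi x y / H x)"

definition R :: "'a measure \<Rightarrow> (nat \<Rightarrow> 'a \<Rightarrow> real) \<Rightarrow> real \<Rightarrow> nat \<Rightarrow> real \<Rightarrow> real \<Rightarrow> real" where
  "R M X \<sigma> n \<delta> x =
     1 / real n powr (\<delta> / 4)
     + V M X x * L (x / (\<sigma> * sqrt (real n))) / real n powr (\<delta> / (4 * (3 + \<delta>))) * ln (real n)"

end

theory Submission
  imports Defs
begin

text \<open>No Brownian motion and no strong coupling is used. Let \<open>w U t y\<close> be the probability that a Brownian
  motion started at \<open>y\<close> and killed at \<open>0\<close> lies in \<open>[0,U]\<close> at time \<open>t\<close>; it is a combination of three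
  Gaussian distribution functions, odd in \<open>y\<close>, and solves the heat equation on the whole line. Lindeberg
  replacement of one step of the walk at a time, with \<open>w\<close> started from a mollification at scale
  \<open>n\<^sup>1\<^sup>/\<^sup>4\<close> of the indicator of \<open>[0,U]\<close>, turns the walk killed on leaving the half line into \<open>w\<close>; by oddness
  the only other contribution comes from the overshoot at the exit, where \<open>w(-z) = -z * (w(z)/z)\<close>. If the quotient
  \<open>w(z)/z\<close> is frozen at time \<open>n\<close> and at the starting point \<open>x\<close>, the starting value \<open>w(x) = x * (w(x)/x)\<close>
  and the expected overshoot add up to exactly \<open>V(x) * w(x)/x\<close>, which is the main term.

  All errors are controlled by Lyapunov functions on the half line: the concave power
  \<open>(A + y) powr (1 - \<beta>)\<close> bounds the overshoot, and a capped parabola bounds the survival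
  probability by a constant times \<open>(1 + x) / sqrt n\<close>. The exponent \<open>\<beta> = \<delta> / (3 + \<delta>)\<close> is four times the one of
  the theorem. Negative starting points are reduced to nonnegative ones by conditioning on the first step.\<close>

section \<open>Gaussian calculus\<close>

text \<open>The obstacle is uniformity in \<open>x\<close>: an error of order n^(-\<beta>/4) must
  also carry the order of the survival probability, min(1, (1+x)/sqrt n). So every error source is
  weighted by the event that the walk is still alive when it occurs; surviving only k < n steps
  costs a factor sqrt(n/(k+1)). Conversely \<open>V\<close> is comparable to 1 + x on the half line,
  so V L / sqrt n is at least a multiple of the same order, and this brings the errors into the form
  of \<open>R\<close>. The mollification scale serves two needs. A time offset of order sqrt n makes
  the Lindeberg errors t^(-1-\<beta>/2) sum to (sqrt n)^(-\<beta>/2), and a window of width n^(1/4)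
  has Gaussian mass of order n^(-1/4) at time n, which is no larger because \<beta> < 1. The
  overshoot limits \<beta>: trading 1 + \<beta> powers of the jump for decay in the position while
  keeping a moment of order 1 + \<beta>/2 spends 2 + 3\<beta>/2 of the available 2 + \<delta>.
  Starting points beyond sqrt n need their own estimates: there the growth of \<open>V\<close> has
  to be met by the decay 1/x of the quotient w(x)/x.\<close>

abbreviation "nd \<equiv> std_normal_density"

definition Ncdf :: "real \<Rightarrow> real" where "Ncdf x = cdf std_normal_distribution x"

lemma nd_pos: "0 < nd x"
  by (simp add: std_normal_density_def)

lemma nd_even: "nd (-x) = nd x" by (simp add: std_normal_density_def)

lemma DERIV_nd: "(nd has_real_derivative (- x * nd x)) (at x)"
  unfolding std_normal_density_def
  by (auto intro!: derivative_eq_intros simp: field_simps)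

lemma continuous_nd: "continuous_on S nd"
  unfolding std_normal_density_def by (auto intro!: continuous_intros)

lemma measure_nd:
  assumes "A \<in> sets borel"
  shows "measure std_normal_distribution A = (LINT x:A|lborel. nd x)"
proof -
  have "measure std_normal_distribution A = (\<integral>x. indicator A x \<partial>std_normal_distribution)"
    using assms by simp
  also have "\<dots> = (\<integral>x. nd x * indicator A x \<partial>lborel)"
    using assms by (subst integral_density) auto
  finally show ?thesis by (simp add: set_lebesgue_integral_def mult.commute)
qed

lemma Ncdf_diff: assumes "a \<le> b" shows "Ncdf b - Ncdf a = (LBINT x=ereal a..ereal b. nd x)"
proof (cases "a = b")
  case False
  interpret real_distribution std_normal_distribution by (rule real_dist_normal_dist)
  have "a < b" using False assms by simp
  then have "Ncdf b - Ncdf a = measure std_normal_distribution {a<..b}"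
    unfolding Ncdf_def using cdf_diff_eq by simp
  also have "\<dots> = (LBINT x=ereal a..ereal b. nd x)"
    using assms by (simp add: measure_nd interval_integral_Ioc)
  finally show ?thesis .
qed simp

lemma DERIV_Ncdf: "(Ncdf has_real_derivative nd x) (at x)"
proof -
  have "((\<lambda>u. LBINT y=ereal (x-1)..ereal u. nd y) has_vector_derivative nd x) (at x within {x-1..x+1})"
    by (rule interval_integral_FTC2) (auto intro: continuous_nd)
  then have "((\<lambda>u. LBINT y=ereal (x-1)..ereal u. nd y) has_vector_derivative nd x) (at x)"
    by (simp add: at_within_Icc_at)
  then have "((\<lambda>u. LBINT y=ereal (x-1)..ereal u. nd y) has_real_derivative nd x) (at x)"
    by (simp add: has_real_derivative_iff_has_vector_derivative)
  then have "((\<lambda>u. (LBINT y=ereal (x-1)..ereal u. nd y) + Ncdf (x-1)) has_real_derivative nd x) (at x)"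
    by (auto intro!: derivative_eq_intros)
  moreover have "\<forall>\<^sub>F u in nhds x. (LBINT y=ereal (x-1)..ereal u. nd y) + Ncdf (x-1) = Ncdf u"
  proof (rule eventually_mono[OF eventually_nhds_in_open[of "{x-1<..}" x]])
    fix u assume "u \<in> {x-1<..}"
    then show "(LBINT y=ereal (x-1)..ereal u. nd y) + Ncdf (x-1) = Ncdf u"
      using Ncdf_diff[of "x-1" u] by simp
  qed auto
  ultimately show ?thesis
    by (subst (asm) DERIV_cong_ev[OF refl _ refl]) assumption+
qed

lemma Ncdf_lim_top: "(Ncdf \<longlongrightarrow> 1) at_top"
proof -
  interpret real_distribution std_normal_distribution by (rule real_dist_normal_dist)
  show ?thesis unfolding Ncdf_def[abs_def] by (rule cdf_lim_at_top_prob)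
qed

lemma Ncdf_lim_bot: "(Ncdf \<longlongrightarrow> 0) at_bot"
proof -
  interpret real_distribution std_normal_distribution by (rule real_dist_normal_dist)
  show ?thesis unfolding Ncdf_def[abs_def] by (rule cdf_lim_at_bot)
qed

lemma Ncdf_bounds: "0 \<le> Ncdf x" "Ncdf x \<le> 1"
proof -
  interpret real_distribution std_normal_distribution by (rule real_dist_normal_dist)
  show "0 \<le> Ncdf x" "Ncdf x \<le> 1" unfolding Ncdf_def by (auto intro: cdf_nonneg cdf_bounded_prob)
qed

lemma Ncdf_mono: "x \<le> y \<Longrightarrow> Ncdf x \<le> Ncdf y"
  by (rule DERIV_nonneg_imp_nondecreasing) (use DERIV_Ncdf less_imp_le[OF nd_pos] in blast)+

text \<open>Evenness of the density makes \<open>Ncdf (-x) + Ncdf x\<close> constant, and the limit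
  at infinity identifies the constant.\<close>

lemma Ncdf_minus: "Ncdf (-x) = 1 - Ncdf x"
proof -
  have d: "((\<lambda>x. Ncdf (-x) + Ncdf x) has_real_derivative 0) (at x)" for x
    by (auto intro!: derivative_eq_intros DERIV_Ncdf DERIV_chain2[OF DERIV_Ncdf] simp: nd_even)
  have eq: "Ncdf (-x) + Ncdf x = Ncdf (-y) + Ncdf y" for x y
    using DERIV_isconst_all[of "\<lambda>x. Ncdf (-x) + Ncdf x"] d by blast
  have "((\<lambda>y. Ncdf (-y) + Ncdf y) \<longlongrightarrow> 0 + 1) at_top"
    by (intro tendsto_add Ncdf_lim_top filterlim_compose[OF Ncdf_lim_bot] filterlim_uminus_at_bot_at_top)
  moreover have "((\<lambda>y. Ncdf (-y) + Ncdf y) \<longlongrightarrow> Ncdf (-x) + Ncdf x) at_top"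
    by (subst eq[of _ x]) auto
  ultimately have "Ncdf (-x) + Ncdf x = 0 + 1"
    using tendsto_unique[OF trivial_limit_at_top_linorder] by blast
  then show ?thesis by simp
qed

lemma Ncdf_0: "Ncdf 0 = 1/2"
  using Ncdf_minus[of 0] by simp

text \<open>The quadratic Taylor polynomial of \<open>exp (x^2 / 2)\<close> in
  \<open>x^2 / 2\<close> already dominates the cubic. Degree three is what the space and time
  derivatives of \<open>Ncdf (y / sqrt t)\<close> used below produce.\<close>

lemma nd_poly_bound: "(1 + \<bar>x\<bar> + x^2 + \<bar>x\<bar>^3) * nd x \<le> 4"
proof -
  have e: "1 + x^2/2 + x^4/8 \<le> exp (x\<^sup>2/2)"
    using exp_lower_Taylor_quadratic[of "x\<^sup>2/2"] by (simp add: power_divide)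
  have "0 \<le> (\<bar>x\<bar> - 1)^2" "0 \<le> \<bar>x\<bar>^2 * (\<bar>x\<bar> - 1)^2" by auto
  then have p: "2 * \<bar>x\<bar> \<le> 1 + x^2" "2 * \<bar>x\<bar>^3 \<le> x^2 + x^4"
    by (auto simp: power2_eq_square power3_eq_cube power4_eq_xxxx algebra_simps abs_if)
  have "1 \<le> sqrt (2 * pi)" using pi_gt3 by (intro real_le_rsqrt) simp
  then have "1 / sqrt (2 * pi) * exp (- x\<^sup>2/2) \<le> 1 * exp (- x\<^sup>2/2)"
    by (intro mult_right_mono) (auto simp: divide_le_eq)
  then have "nd x \<le> exp (- (x\<^sup>2/2))"
    by (simp add: std_normal_density_def)
  then have "(1 + \<bar>x\<bar> + x^2 + \<bar>x\<bar>^3) * nd x \<le> (1 + \<bar>x\<bar> + x^2 + \<bar>x\<bar>^3) * exp (- (x\<^sup>2/2))"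
    by (intro mult_left_mono) auto
  also have "\<dots> \<le> (4 * exp (x\<^sup>2/2)) * exp (- (x\<^sup>2/2))"
  proof (intro mult_right_mono)
    have "0 \<le> x^2" "0 \<le> x^4" by auto
    then show "1 + \<bar>x\<bar> + x^2 + \<bar>x\<bar>^3 \<le> 4 * exp (x\<^sup>2/2)" using p e by linarith
  qed simp
  also have "\<dots> = 4" by (simp flip: exp_add)
  finally show ?thesis .
qed

lemma nd_bounds: "nd x \<le> 4" "\<bar>x\<bar> * nd x \<le> 4" "x^2 * nd x \<le> 4" "\<bar>x\<bar>^3 * nd x \<le> 4"
proof -
  have "0 \<le> nd x" "0 \<le> \<bar>x\<bar> * nd x" "0 \<le> x^2 * nd x" "0 \<le> \<bar>x\<bar>^3 * nd x"
    using nd_pos[of x] by auto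
  moreover have "nd x + \<bar>x\<bar> * nd x + x^2 * nd x + \<bar>x\<bar>^3 * nd x \<le> 4"
    using nd_poly_bound[of x] by (simp add: algebra_simps)
  ultimately show "nd x \<le> 4" "\<bar>x\<bar> * nd x \<le> 4" "x^2 * nd x \<le> 4" "\<bar>x\<bar>^3 * nd x \<le> 4"
    by linarith+
qed

lemma nd_le_1: "nd x \<le> 1"
proof -
  have "1 \<le> sqrt (2 * pi)" using pi_gt3 by (intro real_le_rsqrt) simp
  then have "1 / sqrt (2 * pi) * exp (- x\<^sup>2/2) \<le> 1 * 1"
    by (intro mult_mono) (auto simp: divide_le_eq)
  then show ?thesis by (simp add: std_normal_density_def)
qed

lemma DERIV_nd2: "((\<lambda>x. - x * nd x) has_real_derivative ((x^2 - 1) * nd x)) (at x)"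
  by (auto intro!: derivative_eq_intros DERIV_nd simp: algebra_simps power2_eq_square)

section \<open>Taylor bounds with explicit remainders\<close>

lemma lipschitz_from_deriv:
  fixes f :: "real \<Rightarrow> real"
  assumes "\<And>x. (f has_real_derivative f' x) (at x)" "\<And>x. \<bar>f' x\<bar> \<le> B"
  shows "\<bar>f x - f y\<bar> \<le> B * \<bar>x - y\<bar>"
  using field_differentiable_bound[of UNIV f f' B x y] assms by (auto simp: real_norm_def)

text \<open>The hypotheses are confined to the segment between the two points because the lemma is
  also applied in the time variable, where derivatives exist only at positive times.\<close>

lemma taylor2_bound:
  fixes f :: "real \<Rightarrow> real"
  assumes "\<And>t. \<lbrakk>min a b \<le> t; t \<le> max a b\<rbrakk> \<Longrightarrow> (f has_real_derivative f' t) (at t)"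
    "\<And>t. \<lbrakk>min a b \<le> t; t \<le> max a b\<rbrakk> \<Longrightarrow> (f' has_real_derivative f2 t) (at t)"
    "\<And>t. \<lbrakk>min a b \<le> t; t \<le> max a b\<rbrakk> \<Longrightarrow> \<bar>f2 t\<bar> \<le> B"
  shows "\<bar>f b - f a - f' a * (b - a)\<bar> \<le> B/2 * (b - a)^2"
proof (cases "a = b")
  case False
  define d where "d m = (if m = 0 then f else if m = Suc 0 then f' else f2)" for m :: nat
  have "\<exists>t. (if b < a then b < t \<and> t < a else a < t \<and> t < b) \<and>
      f b = (\<Sum>m<2. d m a / fact m * (b - a)^m) + d 2 t / fact 2 * (b - a)^2"
    using False
  proof (intro Taylor[of 2 d f "min a b" "max a b" a b] allI impI)
    fix m :: nat and t assume "m < 2 \<and> min a b \<le> t \<and> t \<le> max a b"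
    then have "m = 0 \<or> m = 1" and t: "min a b \<le> t" "t \<le> max a b" by auto
    then show "(d m has_real_derivative d (Suc m) t) (at t)"
      using assms(1,2)[OF t] by (auto simp: d_def)
  qed (auto simp: d_def)
  then obtain t where t': "if b < a then b < t \<and> t < a else a < t \<and> t < b"
    and e: "f b = (\<Sum>m<2. d m a / fact m * (b - a)^m) + d 2 t / fact 2 * (b - a)^2"
    by blast
  from t' have t: "min a b \<le> t" "t \<le> max a b" by (simp_all split: if_splits)
  have "f b - f a - f' a * (b - a) = f2 t / 2 * (b - a)^2"
    using e by (simp add: d_def numeral_2_eq_2)
  then have "\<bar>f b - f a - f' a * (b - a)\<bar> = \<bar>f2 t\<bar> / 2 * (b - a)^2"
    by (simp only:) (simp add: abs_mult)
  also have "\<dots> \<le> B/2 * (b - a)^2"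
    using assms(3)[OF t] by (intro mult_right_mono divide_right_mono) auto
  finally show ?thesis .
qed simp

lemma taylor3_bound:
  fixes f :: "real \<Rightarrow> real"
  assumes "\<And>t. (f has_real_derivative f' t) (at t)" "\<And>t. (f' has_real_derivative f2 t) (at t)"
    "\<And>t. (f2 has_real_derivative f3 t) (at t)" "\<And>t. \<bar>f3 t\<bar> \<le> B"
  shows "\<bar>f b - f a - f' a * (b - a) - f2 a * (b - a)^2 / 2\<bar> \<le> B/6 * \<bar>b - a\<bar>^3"
proof (cases "a = b")
  case False
  define d where "d m = (if m = 0 then f else if m = Suc 0 then f' else if m = 2 then f2 else f3)" for m :: nat
  have "\<exists>t. (if b < a then b < t \<and> t < a else a < t \<and> t < b) \<and>
      f b = (\<Sum>m<3. d m a / fact m * (b - a)^m) + d 3 t / fact 3 * (b - a)^3"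
    using False
  proof (intro Taylor[of 3 d f "min a b" "max a b" a b] allI impI)
    fix m :: nat and t assume "m < 3 \<and> min a b \<le> t \<and> t \<le> max a b"
    then have "m = 0 \<or> m = 1 \<or> m = 2" by auto
    then show "(d m has_real_derivative d (Suc m) t) (at t)"
      using assms(1,2,3)[of t] by (auto simp: d_def)
  qed (auto simp: d_def)
  then obtain t where
    e: "f b = (\<Sum>m<3. d m a / fact m * (b - a)^m) + d 3 t / fact 3 * (b - a)^3"
    by blast
  have f3: "fact 3 = (6::real)" by (simp add: numeral_3_eq_3)
  have "f b - f a - f' a * (b - a) - f2 a * (b - a)^2 / 2 = f3 t / 6 * (b - a)^3"
    using e f3 by (simp add: d_def eval_nat_numeral)
  then have "\<bar>f b - f a - f' a * (b - a) - f2 a * (b - a)^2 / 2\<bar> = \<bar>f3 t\<bar> / 6 * \<bar>b - a\<bar>^3"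
    by (simp only:) (simp add: abs_mult power_abs)
  also have "\<dots> \<le> B/6 * \<bar>b - a\<bar>^3"
    using assms(4)[of t] by (intro mult_right_mono divide_right_mono) auto
  finally show ?thesis .
qed simp

text \<open>Interpolates between two remainders: the cubic one for |h| \<le> 1 and the quadratic one
  for |h| > 1. This is why a step with a moment of order \<open>2 + \<beta>\<close> suffices for the
  replacement.\<close>

lemma Ncdf_taylor:
  assumes "0 \<le> \<beta>" "\<beta> \<le> 1"
  shows "\<bar>Ncdf (z + h) - Ncdf z - nd z * h - (- z * nd z) * h^2 / 2\<bar> \<le> 8 * \<bar>h\<bar> powr (2 + \<beta>)"
proof (cases "\<bar>h\<bar> \<le> 1")
  case True
  have "\<bar>(x^2 - 1) * nd x\<bar> \<le> 8" for x
  proof -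
    have "\<bar>(x^2 - 1) * nd x\<bar> = \<bar>x^2 - 1\<bar> * nd x" using nd_pos[of x] by (simp add: abs_mult)
    also have "\<dots> \<le> (x^2 + 1) * nd x" using nd_pos[of x] zero_le_power2[of x]
      by (intro mult_right_mono) (linarith, simp)
    also have "\<dots> \<le> 8" using nd_bounds[of x] by (simp add: algebra_simps)
    finally show ?thesis .
  qed
  then have "\<bar>Ncdf (z + h) - Ncdf z - nd z * h - (- z * nd z) * h^2 / 2\<bar> \<le> 8/6 * \<bar>h\<bar>^3"
    using taylor3_bound[OF DERIV_Ncdf DERIV_nd DERIV_nd2, where B = 8 and a = z and b = "z + h"] by simp
  also have "\<dots> \<le> 8 * \<bar>h\<bar>^3" by simp
  also have "\<bar>h\<bar>^3 \<le> \<bar>h\<bar> powr (2 + \<beta>)"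
  proof (cases "h = 0")
    case False
    then have "\<bar>h\<bar>^3 = \<bar>h\<bar> powr 3" by simp
    also have "\<dots> \<le> \<bar>h\<bar> powr (2 + \<beta>)" using assms True False by (intro powr_mono') auto
    finally show ?thesis .
  qed simp
  finally show ?thesis by simp
next
  case False
  have b: "\<bar>- x * nd x\<bar> \<le> 4" for x using nd_bounds(2)[of x] nd_pos[of x] by (simp add: abs_mult)
  have "\<bar>Ncdf (z + h) - Ncdf z - nd z * h\<bar> \<le> 4/2 * h^2"
    using taylor2_bound[OF DERIV_Ncdf DERIV_nd b, where a = z and b = "z + h"] by simp
  moreover have "\<bar>(- z * nd z) * h^2 / 2\<bar> \<le> 2 * h^2"
  proof -
    have "\<bar>(- z * nd z) * h^2 / 2\<bar> = \<bar>- z * nd z\<bar> * h^2 / 2" by (simp add: abs_mult)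
    also have "\<dots> \<le> 4 * h^2 / 2" using b[of z] by (intro divide_right_mono mult_right_mono) auto
    finally show ?thesis by simp
  qed
  ultimately have "\<bar>Ncdf (z + h) - Ncdf z - nd z * h - (- z * nd z) * h^2 / 2\<bar> \<le> 8 * h^2"
    using zero_le_power2[of h] by linarith
  also have "h^2 = \<bar>h\<bar> powr 2" using False by (auto simp: powr_numeral)
  also have "\<dots> \<le> \<bar>h\<bar> powr (2 + \<beta>)" using False assms by (intro powr_mono) auto
  finally show ?thesis by simp
qed

section \<open>Heat flow on the half line and its quotient by the starting point\<close>

definition Ph :: "real \<Rightarrow> real \<Rightarrow> real" where "Ph t y = Ncdf (y / sqrt t)"
definition dens :: "real \<Rightarrow> real \<Rightarrow> real" where "dens t y = nd (y / sqrt t) / sqrt t"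
definition w :: "real \<Rightarrow> real \<Rightarrow> real \<Rightarrow> real" where
  "w U t y = 2 * Ph t y - Ph t (y - U) - Ph t (y + U)"
definition dw :: "real \<Rightarrow> real \<Rightarrow> real \<Rightarrow> real" where
  "dw U t y = 2 * dens t y - dens t (y - U) - dens t (y + U)"
definition kq :: "real \<Rightarrow> real \<Rightarrow> real \<Rightarrow> real" where
  "kq U t y = (if y = 0 then dw U t 0 else w U t y / y)"
definition bw :: "real \<Rightarrow> real \<Rightarrow> real \<Rightarrow> real" where
  "bw s t y = Ph t (y + s) - Ph t (y - s)"

text \<open>\<^const>\<open>w\<close> is the Dirichlet heat flow of the indicator of \<open>[0,U]\<close>, written through the reflection
  principle; \<^const>\<open>kq\<close> is \<open>w(y) / y\<close>, continued to \<open>y = 0\<close> by the derivative. The window \<^const>\<open>bw\<close> stands in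
  for a Gaussian density when errors at the two jumps of the indicator are estimated.\<close>

lemma Ph_bounds: "0 \<le> Ph t y" "Ph t y \<le> 1" by (auto simp: Ph_def Ncdf_bounds)

lemma Ncdf_borel[measurable]: "Ncdf \<in> borel_measurable borel"
  by (intro borel_measurable_continuous_onI continuous_at_imp_continuous_on ballI DERIV_isCont[OF DERIV_Ncdf])

lemma Ph_borel[measurable]: "Ph t \<in> borel_measurable borel"
  unfolding Ph_def[abs_def] by measurable

lemma w_borel[measurable]: "w U t \<in> borel_measurable borel"
  unfolding w_def[abs_def] by measurable

lemma bw_borel[measurable]: "bw s t \<in> borel_measurable borel"
  unfolding bw_def[abs_def] by measurable

lemma kq_borel[measurable]: "kq U t \<in> borel_measurable borel"
  unfolding kq_def[abs_def] by measurable

lemma nd_z_bound: "\<bar>- z * nd z\<bar> \<le> 4"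
  using nd_bounds(2)[of z] nd_pos[of z] by (simp add: abs_mult)

lemma nd_z2_bound: "\<bar>(z^2 - 1) * nd z\<bar> \<le> 8"
proof -
  have "\<bar>(z^2 - 1) * nd z\<bar> = \<bar>z^2 - 1\<bar> * nd z" using nd_pos[of z] by (simp add: abs_mult)
  also have "\<dots> \<le> (z^2 + 1) * nd z" using nd_pos[of z] zero_le_power2[of z]
    by (intro mult_right_mono) (linarith, simp)
  also have "\<dots> \<le> 8" using nd_bounds[of z] by (simp add: algebra_simps)
  finally show ?thesis .
qed

lemma nd_z3_bound: "\<bar>(3 * z - z^3) * nd z\<bar> \<le> 16"
proof -
  have "\<bar>(3 * z - z^3) * nd z\<bar> = \<bar>3 * z - z^3\<bar> * nd z" using nd_pos[of z] by (simp add: abs_mult)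
  also have "\<dots> \<le> (3 * \<bar>z\<bar> + \<bar>z\<bar>^3) * nd z" using nd_pos[of z]
    by (intro mult_right_mono order.trans[OF abs_triangle_ineq4]) (auto simp: power_abs abs_mult)
  also have "\<dots> \<le> 16" using nd_bounds[of z] by (simp add: algebra_simps)
  finally show ?thesis .
qed

lemma abs_div_le: "\<bar>a\<bar> \<le> c \<Longrightarrow> 0 < b \<Longrightarrow> \<bar>a / b\<bar> \<le> c / b" for a b c :: real
  by (simp add: abs_divide divide_right_mono)

lemma abs_second_diff_le: "\<lbrakk>\<bar>a\<bar> \<le> d; \<bar>b\<bar> \<le> d; \<bar>c\<bar> \<le> d\<rbrakk> \<Longrightarrow> \<bar>2 * a - b - c\<bar> \<le> 4 * d" for a b c d :: real
  by linarith

lemma DERIV_scale: "((\<lambda>y. (y + c) / sqrt t) has_real_derivative 1 / sqrt t) (at y)"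
  by (rule DERIV_cdivide, rule derivative_eq_intros, rule derivative_intros, rule derivative_intros) simp

lemma DERIV_time_scale:
  assumes "r > 0"
  shows "((\<lambda>r. y / sqrt r) has_real_derivative (- (y / sqrt r) / (2 * r))) (at r)"
proof -
  have "((\<lambda>r. y / sqrt r) has_real_derivative ((0 * sqrt r - y * (inverse (sqrt r) / 2)) / (sqrt r * sqrt r))) (at r)"
    using assms by (intro DERIV_divide DERIV_const DERIV_real_sqrt) auto
  also have "((0 * sqrt r - y * (inverse (sqrt r) / 2)) / (sqrt r * sqrt r)) = (- (y / sqrt r) / (2 * r))"
    using assms by (simp add: divide_simps)
  finally show ?thesis .
qed

lemma DERIV_Ph: "((\<lambda>y. Ph t (y + c)) has_real_derivative dens t (y + c)) (at y)"
  unfolding Ph_def dens_def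
  using DERIV_chain2[where f = Ncdf and g = "\<lambda>y. (y + c) / sqrt t", OF DERIV_Ncdf DERIV_scale] by simp

lemma DERIV_w: "(w U t has_real_derivative dw U t y) (at y)"
  using DERIV_diff[OF DERIV_diff[OF DERIV_cmult[OF DERIV_Ph[of t 0 y], of 2] DERIV_Ph[of t "-U" y]] DERIV_Ph[of t U y]]
  by (simp add: w_def[abs_def] dw_def)

lemma DERIV_dens:
  assumes "t > 0"
  shows "((\<lambda>y. dens t (y + c)) has_real_derivative (- ((y + c) / sqrt t) * nd ((y + c) / sqrt t) / t)) (at y)"
proof -
  have "((\<lambda>y. nd ((y + c) / sqrt t) / sqrt t) has_real_derivative
      - ((y + c) / sqrt t) * nd ((y + c) / sqrt t) * (1 / sqrt t) / sqrt t) (at y)"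
    by (rule DERIV_cdivide[OF DERIV_chain2[where f = nd and g = "\<lambda>y. (y + c) / sqrt t", OF DERIV_nd DERIV_scale]])
  also have "- ((y + c) / sqrt t) * nd ((y + c) / sqrt t) * (1 / sqrt t) / sqrt t
      = - ((y + c) / sqrt t) * nd ((y + c) / sqrt t) / (sqrt t * sqrt t)" by simp
  also have "sqrt t * sqrt t = t" using assms by simp
  finally show ?thesis unfolding dens_def .
qed

lemma dens_bound: "t > 0 \<Longrightarrow> 0 \<le> dens t y \<and> dens t y \<le> 1 / sqrt t"
  using nd_pos[of "y / sqrt t"] nd_le_1[of "y / sqrt t"] by (auto simp: dens_def divide_right_mono)

lemma dw_bound: assumes "t > 0" shows "\<bar>dw U t y\<bar> \<le> 4 / sqrt t"
  using dens_bound[OF assms, of y] dens_bound[OF assms, of "y-U"] dens_bound[OF assms, of "y+U"]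
  unfolding dw_def by (auto simp: abs_le_iff field_simps)

lemma w_bound: "\<bar>w U t y\<bar> \<le> 2"
  unfolding w_def using Ph_bounds[of t y] Ph_bounds[of t "y-U"] Ph_bounds[of t "y+U"] by linarith

lemma Ph_minus: "Ph t (-y) = 1 - Ph t y"
  by (simp add: Ph_def Ncdf_minus)

lemma w_odd: "w U t (-y) = - w U t y"
proof -
  have "Ph t (- y - U) = 1 - Ph t (y + U)" "Ph t (- y + U) = 1 - Ph t (y - U)"
    using Ph_minus[of t "y + U"] Ph_minus[of t "y - U"] by simp_all
  then show ?thesis using Ph_minus[of t y] unfolding w_def by simp
qed

lemma w_0: "w U t 0 = 0" using w_odd[of U t 0] by simp

lemma w_eq_kq: "w U t y = y * kq U t y" by (simp add: kq_def w_0)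

lemma w_lipschitz: "t > 0 \<Longrightarrow> \<bar>w U t x - w U t y\<bar> \<le> 4 / sqrt t * \<bar>x - y\<bar>"
  by (rule lipschitz_from_deriv[OF DERIV_w]) (rule dw_bound)

lemma kq_bound: assumes "t > 0" shows "\<bar>kq U t y\<bar> \<le> 4 / sqrt t"
proof (cases "y = 0")
  case False
  then show ?thesis using w_lipschitz[OF assms, of U y 0]
    by (simp add: kq_def w_0 abs_divide divide_le_eq)
qed (use dw_bound[OF assms] in \<open>simp add: kq_def\<close>)

text \<open>Complements \<open>kq_bound\<close> for starting points beyond the square root of the
  time, where the factor |y| absorbs the linear growth of \<open>V\<close>.\<close>

lemma kq_bound2: "\<bar>y\<bar> * \<bar>kq U t y\<bar> \<le> 2"
  using w_bound[of U t y] w_eq_kq[of U t y] by (simp add: abs_mult)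

lemma dw_lipschitz: assumes "t > 0" shows "\<bar>dw U t x - dw U t y\<bar> \<le> 16 / t * \<bar>x - y\<bar>"
proof (rule lipschitz_from_deriv)
  let ?d = "\<lambda>z. (- (z / sqrt t) * nd (z / sqrt t) / t)"
  fix x
  show "(dw U t has_real_derivative (2 * ?d (x + 0) - ?d (x + (-U)) - ?d (x + U))) (at x)"
    using DERIV_diff[OF DERIV_diff[OF DERIV_cmult[OF DERIV_dens[OF assms, of 0 x], of 2]
        DERIV_dens[OF assms, of "-U" x]] DERIV_dens[OF assms, of U x]]
    by (simp add: dw_def[abs_def])
  have "\<bar>?d z\<bar> \<le> 4 / t" for z
    by (rule abs_div_le[OF nd_z_bound assms])
  then have "\<bar>2 * ?d (x + 0) - ?d (x + (-U)) - ?d (x + U)\<bar> \<le> 4 * (4 / t)"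
    by (intro abs_second_diff_le)
  then show "\<bar>2 * ?d (x + 0) - ?d (x + (-U)) - ?d (x + U)\<bar> \<le> 16 / t" by simp
qed

text \<open>Subtracting the tangent at 0 leaves a function whose derivative is at most 16|y|/t on
  [-|y|, |y|]; dividing its increment by y gives the claim. Later the quotient at two points is
  always compared through its value at 0.\<close>

lemma kq_lipschitz_0: assumes "t > 0" shows "\<bar>kq U t y - kq U t 0\<bar> \<le> 16 * \<bar>y\<bar> / t"
proof (cases "y = 0")
  case False
  have "\<bar>w U t y - w U t 0 - dw U t 0 * (y - 0)\<bar> \<le> 16 * \<bar>y\<bar> / t * \<bar>y - 0\<bar>"
  proof -
    have d: "((\<lambda>z. w U t z - dw U t 0 * z) has_real_derivative (dw U t z - dw U t 0)) (at z within {-\<bar>y\<bar>..\<bar>y\<bar>})" for z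
    proof -
      have "((\<lambda>z. w U t z - dw U t 0 * z) has_real_derivative (dw U t z - dw U t 0 * 1)) (at z)"
        by (intro DERIV_diff DERIV_w DERIV_cmult DERIV_ident)
      then show ?thesis by (simp add: has_field_derivative_at_within)
    qed
    have "norm ((w U t y - dw U t 0 * y) - (w U t 0 - dw U t 0 * 0)) \<le> 16 * \<bar>y\<bar> / t * norm (y - 0)"
    proof (rule field_differentiable_bound[OF _ d])
      fix z assume "z \<in> {-\<bar>y\<bar>..\<bar>y\<bar>}"
      then have "\<bar>z\<bar> \<le> \<bar>y\<bar>" by auto
      then have "16 / t * \<bar>z - 0\<bar> \<le> 16 / t * \<bar>y\<bar>" using assms by (intro mult_left_mono) auto
      then show "norm (dw U t z - dw U t 0) \<le> 16 * \<bar>y\<bar> / t" using dw_lipschitz[OF assms, of U z 0] by simp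
    qed auto
    then show ?thesis by (simp add: algebra_simps)
  qed
  then have "\<bar>y * (kq U t y - kq U t 0)\<bar> \<le> 16 * \<bar>y\<bar> / t * \<bar>y\<bar>"
    using w_0 False by (simp add: kq_def algebra_simps)
  then have "\<bar>y\<bar> * \<bar>kq U t y - kq U t 0\<bar> \<le> \<bar>y\<bar> * (16 * \<bar>y\<bar> / t)"
    by (simp add: abs_mult mult.commute)
  then show ?thesis by (rule mult_left_le_imp_le) (use False in simp)
qed simp

lemma dens_time:
  assumes "0 < s" "s \<le> t"
  shows "\<bar>dens t y - dens s y\<bar> \<le> 4 * (t - s) / (s * sqrt s)"
proof -
  let ?d = "\<lambda>r. ((y / sqrt r)^2 - 1) * nd (y / sqrt r) / (2 * r * sqrt r)"
  have d: "((\<lambda>r. dens r y) has_real_derivative ?d r) (at r within {s..t})" if "r \<in> {s..t}" for r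
  proof -
    have r: "r > 0" using that assms by auto
    define q where "q = sqrt r"
    have q: "q > 0" "r = q * q" using r by (auto simp: q_def)
    have alg: "((- z * n) * (- z / (2 * (q * q))) * q - n * (inverse q / 2)) / (q * q) = (z^2 - 1) * n / (2 * (q * q) * q)"
      for z n :: real using q by (simp add: field_simps power2_eq_square)
    have "((\<lambda>r. nd (y / sqrt r) / sqrt r) has_real_derivative
        ((- (y / sqrt r) * nd (y / sqrt r)) * (- (y / sqrt r) / (2 * r)) * sqrt r
          - nd (y / sqrt r) * (inverse (sqrt r) / 2)) / (sqrt r * sqrt r)) (at r)"
      using r by (intro DERIV_divide DERIV_chain2[where f = nd and g = "\<lambda>r. y / sqrt r", OF DERIV_nd DERIV_time_scale]
        DERIV_real_sqrt) auto
    then have "((\<lambda>r. dens r y) has_real_derivative ?d r) (at r)"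
      unfolding dens_def using alg[of "y / sqrt r" "nd (y / sqrt r)", folded q(2), unfolded q_def] r by simp
    then show ?thesis by (rule DERIV_subset) auto
  qed
  have "norm (dens t y - dens s y) \<le> 4 / (s * sqrt s) * norm (t - s)"
  proof (rule field_differentiable_bound[OF _ d])
    fix r assume r: "r \<in> {s..t}"
    let ?z = "y / sqrt r"
    have "\<bar>?d r\<bar> \<le> 8 / (2 * r * sqrt r)"
      by (rule abs_div_le[OF nd_z2_bound]) (use r assms in auto)
    also have "\<dots> \<le> 8 / (2 * s * sqrt s)"
      using r assms by (intro divide_left_mono mult_mono) auto
    finally show "norm (?d r) \<le> 4 / (s * sqrt s)" by simp
  qed (use assms in auto)
  then show ?thesis using assms by simp
qed

lemma Ph_time_deriv:
  assumes "r > 0"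
  shows "((\<lambda>r. Ph r y) has_real_derivative (- (y / sqrt r) * nd (y / sqrt r) / (2 * r))) (at r)"
  unfolding Ph_def using assms
  by (intro DERIV_cong[OF DERIV_chain2[where f = Ncdf and g = "\<lambda>r. y / sqrt r", OF DERIV_Ncdf DERIV_time_scale]]) auto

lemma Ph_time:
  assumes "0 < s" "s \<le> t"
  shows "\<bar>Ph t y - Ph s y\<bar> \<le> 2 * (t - s) / s"
proof -
  let ?d = "\<lambda>r. (- (y / sqrt r) * nd (y / sqrt r) / (2 * r))"
  have "norm (Ph t y - Ph s y) \<le> 2 / s * norm (t - s)"
  proof (rule field_differentiable_bound[of "{s..t}" _ ?d])
    fix r assume r: "r \<in> {s..t}"
    let ?z = "y / sqrt r"
    have "\<bar>?d r\<bar> \<le> 4 / (2 * r)"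
      by (rule abs_div_le[OF nd_z_bound]) (use r assms in auto)
    also have "\<dots> \<le> 4 / (2 * s)"
      using r assms by (intro divide_left_mono mult_mono) auto
    finally show "norm (?d r) \<le> 2 / s" by simp
    show "((\<lambda>r. Ph r y) has_real_derivative ?d r) (at r within {s..t})"
      using r assms by (intro DERIV_subset[OF Ph_time_deriv]) auto
  qed (use assms in auto)
  then show ?thesis using assms by simp
qed

text \<open>The coefficient of \<open>s\<close> is half the second space derivative of
  \<open>Ph\<close>, by the heat equation. In \<open>lindeberg_step\<close> it matches the variance
  term of the spatial expansion.\<close>

lemma Ph_time2:
  assumes "0 < t" "0 \<le> s"
  shows "\<bar>Ph (t + s) y - Ph t y - s * (- (y / sqrt t) * nd (y / sqrt t) / (2 * t))\<bar> \<le> 2 * s^2 / t^2"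
proof -
  let ?d = "\<lambda>r. (- (y / sqrt r) * nd (y / sqrt r) / (2 * r))"
  let ?e = "\<lambda>r. ((3 * (y / sqrt r) - (y / sqrt r)^3) * nd (y / sqrt r) / (4 * r^2))"
  have "\<bar>Ph (t + s) y - Ph t y - ?d t * ((t + s) - t)\<bar> \<le> (4/t^2)/2 * ((t + s) - t)^2"
  proof (rule taylor2_bound[where ?f2.0 = ?e])
    fix r assume "min t (t + s) \<le> r" "r \<le> max t (t + s)"
    then have r: "t \<le> r" "0 < r" using assms by auto
    show "((\<lambda>r. Ph r y) has_real_derivative ?d r) (at r)" using r by (intro Ph_time_deriv)
    have alg: "((z^2 - 1) * n * (- z / (2 * r)) * (2 * r) - (- z * n) * (2 * 1)) / ((2 * r) * (2 * r))
        = (3 * z - z^3) * n / (4 * r^2)" for z n :: real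
      using r by (simp add: field_simps power2_eq_square power3_eq_cube)
    have "(?d has_real_derivative
       ((((y / sqrt r)^2 - 1) * nd (y / sqrt r)) * (- (y / sqrt r) / (2 * r)) * (2 * r)
         - (- (y / sqrt r) * nd (y / sqrt r)) * (2 * 1)) / ((2 * r) * (2 * r))) (at r)"
      using r
      by (intro DERIV_divide DERIV_chain2[where f = "\<lambda>x. - x * nd x" and g = "\<lambda>r. y / sqrt r", OF DERIV_nd2 DERIV_time_scale]
         DERIV_cmult DERIV_ident) auto
    then show "(?d has_real_derivative ?e r) (at r)" unfolding alg .
    let ?z = "y / sqrt r"
    have "\<bar>?e r\<bar> \<le> 16 / (4 * r^2)"
      by (rule abs_div_le[OF nd_z3_bound]) (use r in auto)
    also have "\<dots> \<le> 16 / (4 * t^2)"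
      using r assms by (intro divide_left_mono mult_mono power_mono) auto
    finally show "\<bar>?e r\<bar> \<le> 4 / t^2" by simp
  qed
  then show ?thesis by (simp add: algebra_simps)
qed

lemma w_time: assumes "0 < s" "s \<le> t" shows "\<bar>w U t y - w U s y\<bar> \<le> 8 * (t - s) / s"
  using Ph_time[OF assms, of y] Ph_time[OF assms, of "y - U"] Ph_time[OF assms, of "y + U"]
  unfolding w_def by linarith

lemma dw_time: assumes "0 < s" "s \<le> t" shows "\<bar>dw U t y - dw U s y\<bar> \<le> 16 * (t - s) / (s * sqrt s)"
  using dens_time[OF assms, of y] dens_time[OF assms, of "y - U"] dens_time[OF assms, of "y + U"]
  unfolding dw_def by linarith

text \<open>The difference of the two flows vanishes at 0 and has space derivative bounded by
  \<open>dw_time\<close>, so dividing by y costs nothing.\<close>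

lemma kq_time: assumes "0 < s" "s \<le> t" shows "\<bar>kq U t y - kq U s y\<bar> \<le> 16 * (t - s) / (s * sqrt s)"
proof (cases "y = 0")
  case False
  have "\<bar>(w U t y - w U s y) - (w U t 0 - w U s 0)\<bar> \<le> 16 * (t - s) / (s * sqrt s) * \<bar>y - 0\<bar>"
  proof (rule lipschitz_from_deriv)
    show "((\<lambda>y. w U t y - w U s y) has_real_derivative (dw U t x - dw U s x)) (at x)" for x
      by (intro DERIV_diff DERIV_w)
    show "\<bar>dw U t x - dw U s x\<bar> \<le> 16 * (t - s) / (s * sqrt s)" for x by (rule dw_time[OF assms])
  qed
  then have "\<bar>y * (kq U t y - kq U s y)\<bar> \<le> 16 * (t - s) / (s * sqrt s) * \<bar>y\<bar>"
    using False by (simp add: kq_def w_0 algebra_simps)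
  then have "\<bar>y\<bar> * \<bar>kq U t y - kq U s y\<bar> \<le> \<bar>y\<bar> * (16 * (t - s) / (s * sqrt s))"
    by (simp add: abs_mult mult.commute)
  then show ?thesis by (rule mult_left_le_imp_le) (use False in simp)
qed (use dw_time[OF assms] in \<open>simp add: kq_def\<close>)

text \<open>The variant of \<open>kq_time\<close> for large y: only the time increment of the
  bounded function \<open>w\<close> is used.\<close>

lemma kq_time2: assumes "0 < s" "s \<le> t" shows "\<bar>y\<bar> * \<bar>kq U t y - kq U s y\<bar> \<le> 8 * (t - s) / s"
proof -
  have "y * (kq U t y - kq U s y) = w U t y - w U s y"
    unfolding w_eq_kq by (rule right_diff_distrib)
  then show ?thesis using w_time[OF assms, of U y] by (metis abs_mult)
qed

text \<open>Since \<open>nd (z + 1) \<le> 2/3 * nd z\<close> for \<open>z \<ge> 0\<close>, the tail beyond \<open>z + 1\<close> is at most two thirds of the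
  tail beyond \<open>z\<close>.\<close>

lemma Ncdf_tail: assumes "0 \<le> z" shows "1 - Ncdf z \<le> 3 * (Ncdf (z + 1) - Ncdf z)"
proof -
  define h where "h z = 2/3 * (1 - Ncdf z) - (1 - Ncdf (z + 1))" for z
  have shift: "((\<lambda>z. Ncdf (z + 1)) has_real_derivative nd (z + 1)) (at z)" for z
    using DERIV_shift[of Ncdf "nd (z+1)" z 1] DERIV_Ncdf by simp
  have dh: "(h has_real_derivative (2/3 * (0 - nd z) - (0 - nd (z + 1)))) (at z)" for z
    unfolding h_def[abs_def]
    by (intro DERIV_diff DERIV_cmult DERIV_const DERIV_Ncdf shift)
  have neg: "2/3 * (0 - nd x) - (0 - nd (x + 1)) \<le> 0" if "0 \<le> x" for x
  proof -
    have "3/2 \<le> exp (1/2::real)" using exp_ge_add_one_self[of "1/2"] by simp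
    also have "\<dots> \<le> exp (x + 1/2)" using that by simp
    finally have "3/2 * nd (x + 1) \<le> exp (x + 1/2) * nd (x + 1)"
      using nd_pos[of "x+1"] by (intro mult_right_mono) auto
    also have "\<dots> = nd x"
    proof -
      have "exp (x + 1/2) * exp (- (x + 1)\<^sup>2 / 2) = exp (- x\<^sup>2/2)"
        by (subst exp_add[symmetric]) (simp add: power2_eq_square field_simps)
      then show ?thesis unfolding std_normal_density_def by simp
    qed
    finally show ?thesis by simp
  qed
  have dec: "h y \<le> h z" if "z \<le> y" for y
    using that assms dh neg by (intro DERIV_nonpos_imp_nonincreasing[of z y h]) (meson order_trans)+
  have "((\<lambda>z. Ncdf (z + 1)) \<longlongrightarrow> 1) at_top"
    by (rule filterlim_compose[OF Ncdf_lim_top])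
      (rule filterlim_tendsto_add_at_top[OF tendsto_const filterlim_ident, of 1, simplified add.commute])
  then have "(h \<longlongrightarrow> 2/3 * (1 - 1) - (1 - 1)) at_top"
    unfolding h_def[abs_def] by (intro tendsto_intros Ncdf_lim_top)
  then have "0 \<le> h z"
    using dec tendsto_le[of at_top "\<lambda>_. h z" "h z" h 0]
    by (auto simp: eventually_at_top_linorder)
  moreover have "0 \<le> 2/3 * (1 - a) - (1 - b) \<Longrightarrow> 1 - a \<le> 3 * (b - a)" for a b :: real
    by (simp add: field_simps)
  ultimately show ?thesis unfolding h_def by blast
qed

definition bell :: "real \<Rightarrow> real" where "bell z = Ncdf (z + 1) - Ncdf (z - 1)"

lemma bell_tail: "1 - Ncdf \<bar>z\<bar> \<le> 3 * bell z"
proof -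
  have "Ncdf (z + 1) = 1 - Ncdf (-z-1)" "Ncdf (z - 1) = 1 - Ncdf (-z+1)"
    using Ncdf_minus[of "-z-1"] Ncdf_minus[of "-z+1"] by (simp_all add: add.commute)
  then have "bell \<bar>z\<bar> = bell z" by (auto simp: bell_def abs_if)
  moreover have "1 - Ncdf \<bar>z\<bar> \<le> 3 * bell \<bar>z\<bar>"
    using Ncdf_tail[of "\<bar>z\<bar>"] Ncdf_mono[of "\<bar>z\<bar>-1" "\<bar>z\<bar>"] by (simp add: bell_def)
  ultimately show ?thesis by simp
qed

lemma bw_eq_bell: "t > 0 \<Longrightarrow> bw (sqrt t) t y = bell (y / sqrt t)"
  by (simp add: bw_def bell_def Ph_def add_divide_distrib diff_divide_distrib)

lemma bw_nonneg: "0 \<le> s \<Longrightarrow> 0 \<le> t \<Longrightarrow> 0 \<le> bw s t y"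
  by (simp add: bw_def Ph_def Ncdf_mono divide_right_mono)

lemma bw_bound: assumes "t > 0" "s \<ge> 0" shows "bw s t y \<le> 2 * s / sqrt t"
proof -
  have "\<bar>Ph t (y + s) - Ph t (y - s)\<bar> \<le> 1 / sqrt t * \<bar>(y + s) - (y - s)\<bar>"
  proof (rule lipschitz_from_deriv)
    show "(Ph t has_real_derivative dens t y) (at y)" for y using DERIV_Ph[of t 0 y] by simp
    show "\<bar>dens t y\<bar> \<le> 1 / sqrt t" for y using dens_bound[OF assms(1), of y] by simp
  qed
  then show ?thesis using assms(2) by (simp add: bw_def)
qed

text \<open>The error is a Gaussian tail at each jump of the odd extension of the indicator. The
  jump at 0 counts twice, and the jump at -U is farther from y than 0, so the window at 0 bounds it
  too. Each tail costs three windows by \<open>bell_tail\<close>, whence 9 and 3.\<close>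

lemma smoothing:
  assumes t: "t > 0" and "0 \<le> U" "0 \<le> y"
  shows "\<bar>indicator {..U} y - w U t y\<bar> \<le> 9 * bw (sqrt t) t y + 3 * bw (sqrt t) t (y - U)"
proof -
  define z v where "z = y / sqrt t" "v = (y - U) / sqrt t"
  have z: "0 \<le> z" and zv: "z \<le> (y + U) / sqrt t" using assms by (auto simp: z_v_def divide_right_mono)
  have a: "1 - Ncdf z \<le> 3 * bell z" using bell_tail[of z] z by simp
  have b: "1 - Ncdf ((y + U) / sqrt t) \<le> 3 * bell z" using Ncdf_mono[OF zv] a by simp
  have c: "Ncdf z \<le> 1" "Ncdf ((y + U) / sqrt t) \<le> 1" "0 \<le> Ncdf v" "Ncdf v \<le> 1" by (auto simp: Ncdf_bounds)
  have w: "w U t y = 2 * Ncdf z - Ncdf v - Ncdf ((y + U) / sqrt t)" by (simp add: w_def Ph_def z_v_def)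
  have bb: "bw (sqrt t) t y = bell z" "bw (sqrt t) t (y - U) = bell v" using t by (auto simp: bw_eq_bell z_v_def)
  show ?thesis
  proof (cases "y \<le> U")
    case True
    then have "v \<le> 0" using t by (simp add: z_v_def divide_le_0_iff)
    then have "Ncdf v \<le> 3 * bell v" using bell_tail[of v] Ncdf_minus[of v] by simp
    then show ?thesis using True a b c unfolding w bb by simp
  next
    case False
    then have "v \<ge> 0" using t by (simp add: z_v_def)
    then have "1 - Ncdf v \<le> 3 * bell v" using bell_tail[of v] by simp
    then show ?thesis using False a b c unfolding w bb by simp
  qed
qed

section \<open>The functions H and L and the limiting term\<close>

lemma H_eq: "H z = 2 * Ncdf z - 1" by (simp add: H_def Ncdf_def)

lemma H_lower: assumes "z \<ge> 0" shows "2 * nd 1 * min 1 z \<le> H z"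
proof -
  have 1: "2 * nd 1 * z \<le> H z" if "0 \<le> z" "z \<le> 1" for z
  proof -
    have "(\<lambda>x. Ncdf x - nd 1 * x) 0 \<le> (\<lambda>x. Ncdf x - nd 1 * x) z"
    proof (rule DERIV_nonneg_imp_nondecreasing[OF that(1)])
      fix x assume "0 \<le> x" "x \<le> z"
      then have "x\<^sup>2 \<le> 1" using that by (simp add: power_le_one)
      then have "nd 1 \<le> nd x" by (auto simp: std_normal_density_def divide_right_mono)
      moreover have "((\<lambda>x. Ncdf x - nd 1 * x) has_real_derivative (nd x - nd 1 * 1)) (at x)"
        by (intro DERIV_diff DERIV_Ncdf DERIV_cmult DERIV_ident)
      ultimately show "\<exists>y. ((\<lambda>x. Ncdf x - nd 1 * x) has_real_derivative y) (at x) \<and> 0 \<le> y"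
        by (intro exI[of _ "nd x - nd 1 * 1"]) auto
    qed
    then show ?thesis by (simp add: H_eq Ncdf_0)
  qed
  show ?thesis
  proof (cases "z \<le> 1")
    case False
    then show ?thesis using 1[of 1] Ncdf_mono[of 1 z] by (simp add: H_eq)
  qed (use 1[of z] assms in simp)
qed

lemma H_minus: "H (-z) = - H z" by (simp add: H_eq Ncdf_minus)

lemma H_nonzero: assumes "z \<noteq> 0" shows "H z \<noteq> 0"
proof -
  have pos: "H z > 0" if "z > 0" for z
  proof -
    have "0 < 2 * nd 1 * min 1 z" using that nd_pos[of 1] by simp
    then show ?thesis using H_lower[of z] that by linarith
  qed
  show ?thesis
    using pos[of z] pos[of "-z"] assms H_minus[of z] by (cases "z > 0") auto
qed

text \<open>The error of the theorem is measured by V times L, so L must not be too small: it stays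
  above a constant near the origin and above a multiple of 1/|z| far out.\<close>

lemma L_lower: "2 * nd 1 * min 1 (1 / \<bar>z\<bar>) \<le> L z"
proof -
  have pos: "2 * nd 1 * min 1 (1 / z) \<le> L z" if "z > 0" for z
  proof -
    have "2 * nd 1 * min 1 z / z \<le> H z / z"
      using H_lower[of z] that by (intro divide_right_mono) auto
    moreover have "min 1 z / z = min 1 (1 / z)" using that by (auto simp: min_def field_simps)
    ultimately show ?thesis using that by (simp add: L_def flip: times_divide_eq_right)
  qed
  consider "z = 0" | "z > 0" | "z < 0" by linarith
  then show ?thesis
  proof cases
    case 1
    have "nd 1 \<le> nd 0" by (auto simp: std_normal_density_def divide_right_mono)
    then show ?thesis using 1 nd_pos[of 1] by (simp add: L_def std_normal_density_def)
  next
    case 2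
    then show ?thesis using pos[of z] by simp
  next
    case 3
    then have "L z = L (-z)" by (simp add: L_def H_minus)
    then show ?thesis using 3 pos[of "-z"] by simp
  qed
qed

text \<open>The factor \<open>H\<close> of \<open>L\<close> cancels the one in \<open>ell_H\<close>.
  What remains is the integral of \<open>psi\<close>, whose primitive consists of two values of
  \<open>Ncdf\<close>, and it equals \<open>w\<close> at variance \<open>s^2\<close>. At
  \<open>x = 0\<close> the quotient is a derivative and the integrand has the primitive
  \<open>- exp (- (y^2) / 2)\<close>.\<close>

lemma main_term:
  assumes "0 \<le> u" "0 < s"
  shows "L (x / s) / s * (LBINT y=ereal 0..ereal u. ell_H (x / s) y) = kq (u * s) (s^2) x"
proof (cases "x = 0")
  case True
  have d: "((\<lambda>y. - exp (- (y\<^sup>2) / 2)) has_real_derivative (y * exp (- (y\<^sup>2) / 2))) (at y)" for y :: real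
    by (auto intro!: derivative_eq_intros)
  have "((\<lambda>y. - exp (- (y\<^sup>2) / 2)) has_vector_derivative (y * exp (- (y\<^sup>2) / 2))) (at y within S)" for y S
    using d[of y, THEN has_field_derivative_at_within] by (simp only: has_real_derivative_iff_has_vector_derivative)
  moreover have "continuous_on S (\<lambda>y::real. y * exp (- (y\<^sup>2) / 2))" for S
    by (intro continuous_intros) auto
  ultimately have "(LBINT y=ereal 0..ereal u. y * exp (- (y\<^sup>2) / 2)) = - exp (- (u\<^sup>2) / 2) - - exp (- (0\<^sup>2) / 2)"
    by (intro interval_integral_FTC_finite)
  then have "L (x / s) / s * (LBINT y=ereal 0..ereal u. ell_H (x / s) y) = (2 / sqrt (2 * pi)) / s * (1 - exp (- (u\<^sup>2) / 2))"
    using True by (simp add: L_def ell_H_def)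
  also have "\<dots> = (2 * nd 0 - nd (-u) - nd u) / s"
  proof -
    define c where "c = 1 / sqrt (2 * pi)"
    have e: "2 * nd 0 - nd (-u) - nd u = 2 * c * (1 - exp (- (u\<^sup>2) / 2))"
      by (simp add: std_normal_density_def c_def diff_divide_distrib)
    moreover have "2 / sqrt (2 * pi) = 2 * c" by (simp add: c_def)
    ultimately show ?thesis unfolding e by simp
  qed
  also have "\<dots> = kq (u * s) (s^2) x"
    using True assms by (simp add: kq_def dw_def dens_def diff_divide_distrib)
  finally show ?thesis .
next
  case False
  define z where "z = x / s"
  have z: "z \<noteq> 0" using False assms by (simp add: z_def)
  have d: "((\<lambda>y. - Ncdf (z - y) - Ncdf (z + y)) has_real_derivative psi z y) (at y)" for y
  proof -
    have "((\<lambda>y. z - y) has_real_derivative (0 - 1)) (at y)" by (intro DERIV_diff DERIV_const DERIV_ident)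
    moreover have "((\<lambda>y. z + y) has_real_derivative (0 + 1)) (at y)" by (intro DERIV_add DERIV_const DERIV_ident)
    ultimately have "((\<lambda>y. - Ncdf (z - y) - Ncdf (z + y)) has_real_derivative
        (- (nd (z - y) * (0 - 1)) - nd (z + y) * (0 + 1))) (at y)"
      by (intro DERIV_diff DERIV_minus DERIV_chain2[where f = Ncdf and g = "\<lambda>y. z - y", OF DERIV_Ncdf]
        DERIV_chain2[where f = Ncdf and g = "\<lambda>y. z + y", OF DERIV_Ncdf]
        DERIV_const DERIV_ident DERIV_add)
    then show ?thesis by (simp add: psi_def)
  qed
  have "continuous_on S (psi z)" for S
    unfolding psi_def[abs_def] std_normal_density_def by (auto intro!: continuous_intros)
  moreover have "((\<lambda>y. - Ncdf (z - y) - Ncdf (z + y)) has_vector_derivative psi z y) (at y within S)" for y S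
    using d[of y, THEN has_field_derivative_at_within] by (simp only: has_real_derivative_iff_has_vector_derivative)
  ultimately have "(LBINT y=ereal 0..ereal u. psi z y) = (- Ncdf (z - u) - Ncdf (z + u)) - (- Ncdf (z - 0) - Ncdf (z + 0))"
    by (intro interval_integral_FTC_finite)
  also have "\<dots> = w (u * s) (s^2) x"
    using assms by (simp add: w_def Ph_def z_def diff_divide_distrib add_divide_distrib)
  finally have "(LBINT y=ereal 0..ereal u. ell_H z y) = w (u * s) (s^2) x / H z"
    using z by (simp add: ell_H_def)
  moreover have "L z / s = H z / x" using False assms by (simp add: L_def z_def)
  ultimately show ?thesis using False H_nonzero[OF z] unfolding z_def[symmetric]
    by (simp add: kq_def)
qed

section \<open>Sums of powers\<close>

lemma powr_diff_bounds:
  fixes a y :: real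
  assumes "0 < a" "0 < y"
  shows "a * (y + 1) powr (-1 - a) \<le> y powr (-a) - (y + 1) powr (-a)"
    "y powr (-a) - (y + 1) powr (-a) \<le> a * y powr (-1 - a)"
proof -
  have e: "-a - 1 = -1 - a" by simp
  have "\<exists>z>y. z < y + 1 \<and> (y + 1) powr (-a) - y powr (-a) = (y + 1 - y) * (-a * z powr (-a - 1))"
  proof (rule MVT2)
    fix x assume "y \<le> x"
    then have "((\<lambda>x. x powr (-a)) has_real_derivative -a * x powr (-a - 1)) (at x)"
      using assms by (intro has_real_derivative_powr) auto
    then show "((\<lambda>x. x powr (-a)) has_real_derivative -a * x powr (-a - 1)) (at x)" .
  qed simp
  then obtain z where z: "y < z" "z < y + 1"
    and "(y + 1) powr (-a) - y powr (-a) = (y + 1 - y) * (-a * z powr (-1 - a))"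
    unfolding e by blast
  then have z3: "y powr (-a) - (y + 1) powr (-a) = a * z powr (-1 - a)" by simp
  have "(y + 1) powr (-1 - a) \<le> z powr (-1 - a)" "z powr (-1 - a) \<le> y powr (-1 - a)"
    using z assms by (auto intro!: powr_mono2')
  then show "a * (y + 1) powr (-1 - a) \<le> y powr (-a) - (y + 1) powr (-a)"
    "y powr (-a) - (y + 1) powr (-a) \<le> a * y powr (-1 - a)"
    using assms unfolding z3 by auto
qed

text \<open>Comparison with the telescoping sum of y^(-s). The mean value theorem gives the
  increment at y + 1 instead of y, and y + 1 \<le> 2y turns this into a factor of at most 4.\<close>

lemma sum_powr_tail:
  fixes s m :: real
  assumes "0 < s" "s \<le> 1" "1 \<le> m"
  shows "(\<Sum>j<k. (real j + m) powr (-1 - s)) \<le> 4 / s * m powr (-s)"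
proof -
  have "(real j + m) powr (-1 - s) \<le> 4 / s * ((real j + m) powr (-s) - (real (Suc j) + m) powr (-s))" for j
  proof -
    let ?y = "real j + m"
    have y: "1 \<le> ?y" using assms by simp
    have "s * ?y powr (-1 - s) = s * (4 * ((1/4) * ?y powr (-1 - s)))" by simp
    also have "(1/4) * ?y powr (-1 - s) \<le> (2::real) powr (-1 - s) * ?y powr (-1 - s)"
    proof (rule mult_right_mono)
      have "(2::real) powr (-2) \<le> 2 powr (-1 - s)" using assms by (intro powr_mono) auto
      then show "1/4 \<le> (2::real) powr (-1 - s)" by (simp add: powr_minus)
    qed simp
    also have "\<dots> = (2 * ?y) powr (-1 - s)" using y by (subst powr_mult) auto
    also have "\<dots> \<le> (?y + 1) powr (-1 - s)" using y assms by (intro powr_mono2') auto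
    also have "s * (4 * (?y + 1) powr (-1 - s)) = 4 * (s * (?y + 1) powr (-1 - s))" by simp
    also have "\<dots> \<le> 4 * (?y powr (-s) - (?y + 1) powr (-s))"
      using powr_diff_bounds(1)[of s ?y] assms y by (intro mult_left_mono) auto
    finally show ?thesis using assms by (simp add: field_simps)
  qed
  then have "(\<Sum>j<k. (real j + m) powr (-1 - s)) \<le> (\<Sum>j<k. 4 / s * ((real j + m) powr (-s) - (real (Suc j) + m) powr (-s)))"
    by (intro sum_mono)
  also have "\<dots> = 4 / s * (m powr (-s) - (real k + m) powr (-s))"
    unfolding sum_distrib_left[symmetric]
    using sum_lessThan_telescope'[of "\<lambda>j. (real j + m) powr (-s)" k] by simp
  also have "\<dots> \<le> 4 / s * m powr (-s)" using assms by (intro mult_left_mono) auto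
  finally show ?thesis .
qed

lemma sum_inv_sqrt: "(\<Sum>k<n. 1 / sqrt (real k + 1)) \<le> 2 * sqrt n"
proof (induction n)
  case (Suc n)
  define a b where "a = sqrt (real n)" and "b = sqrt (real n + 1)"
  have ab: "a * a = real n" "b * b = real n + 1" "0 \<le> a" "0 < b" by (auto simp: a_def b_def)
  \<comment> \<open>Together with b^2 - a^2 = 1, this square bounds 1 by 2b(b - a), so 1/b is at
    most twice the increment of the square root.\<close>
  have "0 \<le> (b - a) * (b - a)" by simp
  then have "1 \<le> 2 * b * (b - a)" using ab by (simp add: algebra_simps)
  then have "1 / b \<le> 2 * (b - a)" using ab by (simp add: divide_le_eq mult_ac)
  then show ?case using Suc by (simp add: a_def b_def add.commute)
qed simp

text \<open>The quantity \<open>\<bar>kq\<bar>\<close> is only bounded by the inverse square root of the remaining time, so the exits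
  in the last half of the time interval have to be summed by parts.\<close>

lemma sum_by_parts_bound:
  fixes d :: "nat \<Rightarrow> real" and \<beta> m K :: real
  assumes "0 < \<beta>" "\<beta> < 1" "1 \<le> m" "0 \<le> K"
    and B: "\<And>i. i \<le> N \<Longrightarrow> (\<Sum>l<i. d l) \<le> K * (real i + m) powr ((1 - \<beta>) / 2)"
  shows "(\<Sum>i<N. d i * (real i + m) powr (-1/2)) \<le> (1 + 8 / \<beta>) * K * m powr (- (\<beta> / 2))"
proof -
  let ?c = "\<lambda>i. (real i + m) powr (-1/2)"
  let ?B = "\<lambda>i. \<Sum>l<i. d l"
  \<comment> \<open>Summation by parts: only the partial sums \<open>?B\<close> are under control,
    while the weights \<open>?c\<close> decrease by at most half the power -3/2 of the
    argument.\<close>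
  have abel: "(\<Sum>i<N. d i * ?c i) = ?B N * ?c N + (\<Sum>i<N. ?B (Suc i) * (?c i - ?c (Suc i)))" for N
    by (induction N) (simp_all add: algebra_simps)
  have "?B (Suc i) * (?c i - ?c (Suc i)) \<le> K * (real i + m) powr (-1 - \<beta>/2)" if "i < N" for i
  proof -
    let ?y = "real i + m"
    have y: "1 \<le> ?y" using assms by simp
    have c: "0 \<le> ?c i - ?c (Suc i)" using y by (auto intro!: powr_mono2')
    have c2: "?c i - ?c (Suc i) \<le> 1/2 * ?y powr (-3/2)"
      using powr_diff_bounds(2)[of "1/2" ?y] y by (simp add: add_ac)
    have "?B (Suc i) \<le> K * (real (Suc i) + m) powr ((1 - \<beta>) / 2)" using that by (intro B) auto
    also have "\<dots> \<le> K * (2 * ?y powr ((1 - \<beta>) / 2))"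
    proof (rule mult_left_mono)
      have "(real (Suc i) + m) powr ((1 - \<beta>) / 2) \<le> (2 * ?y) powr ((1 - \<beta>) / 2)"
        using assms y by (intro powr_mono2) auto
      also have "\<dots> = 2 powr ((1 - \<beta>) / 2) * ?y powr ((1 - \<beta>) / 2)" using y by (subst powr_mult) auto
      also have "\<dots> \<le> 2 powr 1 * ?y powr ((1 - \<beta>) / 2)"
        using assms by (intro mult_right_mono powr_mono) auto
      finally show "(real (Suc i) + m) powr ((1 - \<beta>) / 2) \<le> 2 * ?y powr ((1 - \<beta>) / 2)" by simp
    qed (use assms in auto)
    finally have "?B (Suc i) * (?c i - ?c (Suc i)) \<le> K * (2 * ?y powr ((1 - \<beta>) / 2)) * (1/2 * ?y powr (-3/2))"
      using c c2 assms by (intro mult_mono) auto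
    also have "\<dots> = K * (?y powr ((1 - \<beta>) / 2) * ?y powr (-3/2))" by simp
    also have "?y powr ((1 - \<beta>) / 2) * ?y powr (-3/2) = ?y powr (-1 - \<beta>/2)"
      by (subst powr_add[symmetric]) (rule arg_cong[where f = "\<lambda>p. _ powr p"], simp add: field_simps)
    finally show ?thesis .
  qed
  then have "(\<Sum>i<N. ?B (Suc i) * (?c i - ?c (Suc i))) \<le> (\<Sum>i<N. K * (real i + m) powr (-1 - \<beta>/2))"
    by (intro sum_mono) auto
  also have "\<dots> \<le> K * (4 / (\<beta>/2) * m powr (- (\<beta>/2)))"
    unfolding sum_distrib_left[symmetric] using assms by (intro mult_left_mono sum_powr_tail) auto
  finally have 1: "(\<Sum>i<N. ?B (Suc i) * (?c i - ?c (Suc i))) \<le> K * (4 / (\<beta>/2) * m powr (- (\<beta>/2)))" .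
  have "?B N * ?c N \<le> K * (real N + m) powr ((1 - \<beta>) / 2) * ?c N"
    by (intro mult_right_mono B) auto
  also have "\<dots> = K * ((real N + m) powr ((1 - \<beta>) / 2) * (real N + m) powr (-1/2))" by simp
  also have "(real N + m) powr ((1 - \<beta>) / 2) * (real N + m) powr (-1/2) = (real N + m) powr (- (\<beta>/2))"
    by (subst powr_add[symmetric]) (rule arg_cong[where f = "\<lambda>p. _ powr p"], simp add: field_simps)
  also have "K * (real N + m) powr (- (\<beta>/2)) \<le> K * m powr (- (\<beta>/2))"
    using assms by (intro mult_left_mono powr_mono2') auto
  finally show ?thesis using 1 unfolding abel[of N] by (simp add: algebra_simps)
qed

text \<open>The power is a replacement error, the square root the price of surviving only k steps.
  Where 4(k+1) \<ge> n, the root is at most 2. For smaller k at least half of n remains in the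
  power, which is then at most 4 n^(-1-s), and the roots sum to at most 2n.\<close>

lemma sum_conv_bound:
  fixes s m :: real
  assumes "0 < s" "s \<le> 1" "1 \<le> m" "m \<le> real n"
  shows "(\<Sum>k<n. (real (n - Suc k) + m) powr (-1 - s) * sqrt (real n / (real k + 1))) \<le> (8 / s + 8) * m powr (-s)"
proof -
  have n: "1 \<le> real n" "0 < n" using assms by auto
  have "(real (n - Suc k) + m) powr (-1 - s) * sqrt (real n / (real k + 1))
      \<le> 2 * (real (n - Suc k) + m) powr (-1 - s) + 4 * real n powr (-1 - s) * sqrt n * (1 / sqrt (real k + 1))"
    if "k < n" for k
  proof (cases "real n \<le> 4 * (real k + 1)")
    case True
    then have "sqrt (real n / (real k + 1)) \<le> sqrt 4" by (intro real_sqrt_le_mono) (simp add: divide_le_eq)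
    then have "sqrt (real n / (real k + 1)) \<le> 2" by simp
    then have "(real (n - Suc k) + m) powr (-1 - s) * sqrt (real n / (real k + 1)) \<le> (real (n - Suc k) + m) powr (-1 - s) * 2"
      by (intro mult_left_mono) auto
    moreover have "0 \<le> 4 * real n powr (-1 - s) * sqrt n * (1 / sqrt (real k + 1))" by simp
    ultimately show ?thesis by linarith
  next
    case False
    have e: "real (n - Suc k) = real n - (real k + 1)" using that by (simp add: of_nat_diff)
    have "1/2 * real n \<le> real (n - Suc k) + m" unfolding e using False assms by simp
    then have "(real (n - Suc k) + m) powr (-1 - s) \<le> (1/2 * real n) powr (-1 - s)"
      using n assms by (intro powr_mono2') auto
    also have "\<dots> = (1/2) powr (-1 - s) * real n powr (-1 - s)" by (simp add: powr_mult powr_divide)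
    also have "(1/2::real) powr (-1 - s) \<le> (1/2) powr (-2)" using assms by (intro powr_mono') auto
    also have "(1/2::real) powr (-2) = 4" by (simp add: powr_minus powr_divide)
    finally have "(real (n - Suc k) + m) powr (-1 - s) \<le> 4 * real n powr (-1 - s)" by (simp add: mult_right_mono)
    then have "(real (n - Suc k) + m) powr (-1 - s) * sqrt (real n / (real k + 1))
      \<le> 4 * real n powr (-1 - s) * sqrt (real n / (real k + 1))"
      by (intro mult_right_mono) auto
    moreover have "sqrt (real n / (real k + 1)) = sqrt n * (1 / sqrt (real k + 1))" by (simp add: real_sqrt_divide)
    moreover have "0 \<le> 2 * (real (n - Suc k) + m) powr (-1 - s)" by simp
    ultimately show ?thesis by (simp only: mult.assoc)
  qed
  then have "(\<Sum>k<n. (real (n - Suc k) + m) powr (-1 - s) * sqrt (real n / (real k + 1)))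
     \<le> (\<Sum>k<n. 2 * (real (n - Suc k) + m) powr (-1 - s) + 4 * real n powr (-1 - s) * sqrt n * (1 / sqrt (real k + 1)))"
    by (intro sum_mono) auto
  also have "\<dots> = 2 * (\<Sum>k<n. (real (n - Suc k) + m) powr (-1 - s)) + 4 * real n powr (-1 - s) * sqrt n * (\<Sum>k<n. 1 / sqrt (real k + 1))"
    by (simp add: sum.distrib sum_distrib_left)
  also have "(\<Sum>k<n. (real (n - Suc k) + m) powr (-1 - s)) = (\<Sum>k<n. (real k + m) powr (-1 - s))"
    by (rule sum.nat_diff_reindex)
  also have "2 * (\<Sum>k<n. (real k + m) powr (-1 - s)) + 4 * real n powr (-1 - s) * sqrt n * (\<Sum>k<n. 1 / sqrt (real k + 1))
     \<le> 2 * (4 / s * m powr (-s)) + 4 * real n powr (-1 - s) * sqrt n * (2 * sqrt n)"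
    using assms by (intro add_mono mult_left_mono sum_powr_tail sum_inv_sqrt) auto
  also have "4 * real n powr (-1 - s) * sqrt n * (2 * sqrt n) = 8 * (real n powr (-1 - s) * real n powr 1)"
    using n by simp
  also have "real n powr (-1 - s) * real n powr 1 = real n powr (-s)"
    by (subst powr_add[symmetric]) simp
  also have "\<dots> \<le> m powr (-s)" using assms by (intro powr_mono2') auto
  finally show ?thesis by (simp add: algebra_simps)
qed

section \<open>The killed transition operator\<close>

text \<open>The class of test functions for the whole proof: a first moment of the step makes its
  members integrable along the walk, and the killed operator preserves it.\<close>

definition lin_growth :: "(real \<Rightarrow> real) \<Rightarrow> bool" where
  "lin_growth \<phi> \<longleftrightarrow> \<phi> \<in> borel_measurable borel \<and> (\<exists>C. \<forall>y. \<bar>\<phi> y\<bar> \<le> C * (1 + \<bar>y\<bar>))"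

lemma lin_growthI:
  "\<phi> \<in> borel_measurable borel \<Longrightarrow> (\<And>y. \<bar>\<phi> y\<bar> \<le> C * (1 + \<bar>y\<bar>)) \<Longrightarrow> lin_growth \<phi>"
  by (auto simp: lin_growth_def)

lemma lin_growth_measurable: "lin_growth \<phi> \<Longrightarrow> \<phi> \<in> borel_measurable borel"
  by (auto simp: lin_growth_def)

lemma lin_growthE:
  assumes "lin_growth \<phi>"
  obtains C where "0 \<le> C" "\<And>y. \<bar>\<phi> y\<bar> \<le> C * (1 + \<bar>y\<bar>)"
proof -
  obtain C where C: "\<And>y. \<bar>\<phi> y\<bar> \<le> C * (1 + \<bar>y\<bar>)" using assms by (auto simp: lin_growth_def)
  have "0 \<le> \<bar>\<phi> 0\<bar>" by simp
  also have "\<dots> \<le> C" using C[of 0] by simp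
  finally show thesis using that C by blast
qed

lemma lin_growth_bounded:
  assumes "\<phi> \<in> borel_measurable borel" "\<And>y. \<bar>\<phi> y\<bar> \<le> C"
  shows "lin_growth \<phi>"
proof (rule lin_growthI[of _ C])
  fix y
  have "0 \<le> C" using assms(2)[of 0] by linarith
  then have "C * 1 \<le> C * (1 + \<bar>y\<bar>)" by (intro mult_left_mono) auto
  then show "\<bar>\<phi> y\<bar> \<le> C * (1 + \<bar>y\<bar>)" using assms(2)[of y] by simp
qed fact

lemma lin_growth_const: "lin_growth (\<lambda>_. c)"
  by (rule lin_growth_bounded[of _ "\<bar>c\<bar>"]) auto

lemma lin_growth_add: assumes "lin_growth \<phi>" "lin_growth \<psi>" shows "lin_growth (\<lambda>y. \<phi> y + \<psi> y)"
proof -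
  obtain C D where "\<And>y. \<bar>\<phi> y\<bar> \<le> C * (1 + \<bar>y\<bar>)" "\<And>y. \<bar>\<psi> y\<bar> \<le> D * (1 + \<bar>y\<bar>)"
    using assms by (metis lin_growthE)
  then have "\<bar>\<phi> y + \<psi> y\<bar> \<le> (C + D) * (1 + \<bar>y\<bar>)" for y
    by (simp only: distrib_right) (metis abs_triangle_ineq add_mono order_trans)
  then show ?thesis using assms[THEN lin_growth_measurable] by (intro lin_growthI) measurable
qed

lemma lin_growth_cmult: assumes "lin_growth \<phi>" shows "lin_growth (\<lambda>y. c * \<phi> y)"
proof -
  obtain C where "\<And>y. \<bar>\<phi> y\<bar> \<le> C * (1 + \<bar>y\<bar>)" using assms by (metis lin_growthE)
  then have "\<bar>c * \<phi> y\<bar> \<le> (\<bar>c\<bar> * C) * (1 + \<bar>y\<bar>)" for y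
    by (simp add: abs_mult mult.assoc mult_left_mono)
  then show ?thesis using assms[THEN lin_growth_measurable] by (intro lin_growthI) measurable
qed

lemma lin_growth_diff: "lin_growth \<phi> \<Longrightarrow> lin_growth \<psi> \<Longrightarrow> lin_growth (\<lambda>y. \<phi> y - \<psi> y)"
  using lin_growth_add[OF _ lin_growth_cmult, of \<phi> \<psi> "-1"] by simp

lemma lin_growth_sum: "(\<And>i. i \<in> I \<Longrightarrow> lin_growth (f i)) \<Longrightarrow> lin_growth (\<lambda>y. \<Sum>i\<in>I. f i y)"
  by (induction I rule: infinite_finite_induct) (auto intro: lin_growth_add lin_growth_const)

lemma lin_growth_dominated:
  assumes "lin_growth \<psi>" "\<phi> \<in> borel_measurable borel" "\<And>y. \<bar>\<phi> y\<bar> \<le> \<bar>\<psi> y\<bar>"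
  shows "lin_growth \<phi>"
  using assms by (meson lin_growthE lin_growthI order_trans)

lemma lin_growth_max0: "lin_growth (\<lambda>y. max (a + y) 0)"
proof (rule lin_growthI[of _ "\<bar>a\<bar> + 1"])
  fix y :: real
  have "0 \<le> \<bar>a\<bar> * \<bar>y\<bar>" by simp
  moreover have "\<bar>max (a + y) 0\<bar> \<le> \<bar>a\<bar> + \<bar>y\<bar>" by simp
  ultimately show "\<bar>max (a + y) 0\<bar> \<le> (\<bar>a\<bar> + 1) * (1 + \<bar>y\<bar>)" by (simp only: distrib_left distrib_right)
qed measurable

lemma powr_le_1_plus:
  assumes "0 \<le> q" "q \<le> p" "0 \<le> (z::real)" shows "z powr q \<le> 1 + z powr p"
proof (cases "z \<le> 1")
  case True
  then have "z powr q \<le> 1" using assms powr_mono2[of q z 1] by simp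
  then show ?thesis by (smt (verit) powr_ge_zero)
next
  case False
  then have "z powr q \<le> z powr p" using assms by (intro powr_mono) auto
  then show ?thesis by simp
qed

text \<open>Isolates the law of a single step. All estimates concern an operator on functions of one
  real variable; the walk itself enters only through \<open>killed_expectation\<close>.\<close>

locale centred_law = prob_space \<mu> for \<mu> :: "real measure" +
  fixes \<sigma> \<delta> :: real
  assumes sets_mu [measurable_cong]: "sets \<mu> = sets borel"
    and mean0: "(\<integral>\<xi>. \<xi> \<partial>\<mu>) = 0"
    and var: "(\<integral>\<xi>. \<xi>\<^sup>2 \<partial>\<mu>) = \<sigma>\<^sup>2"
    and sigma: "\<sigma> > 0"
    and delta: "\<delta> > 0"
    and mom: "integrable \<mu> (\<lambda>\<xi>. \<bar>\<xi>\<bar> powr (2 + \<delta>))"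
begin

lemma space_mu [simp]: "space \<mu> = UNIV"
  using sets_eq_imp_space_eq[OF sets_mu] by simp

lemma int_powr: assumes "0 \<le> q" "q \<le> 2 + \<delta>" shows "integrable \<mu> (\<lambda>\<xi>. \<bar>\<xi>\<bar> powr q)"
  by (rule Bochner_Integration.integrable_bound[of _ "\<lambda>\<xi>. 1 + \<bar>\<xi>\<bar> powr (2 + \<delta>)"])
    (use mom powr_le_1_plus[OF assms] in auto)

lemma int_abs: "integrable \<mu> (\<lambda>\<xi>. \<bar>\<xi>\<bar>)"
  using int_powr[of 1] delta by simp

lemma int_id: "integrable \<mu> (\<lambda>\<xi>. \<xi>)"
  by (rule Bochner_Integration.integrable_bound[OF int_abs]) auto

lemma int_sq: "integrable \<mu> (\<lambda>\<xi>. \<xi>\<^sup>2)"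
  using int_powr[of 2] delta by simp

lemma int_lin_growth: assumes lg: "lin_growth \<phi>" shows "integrable \<mu> (\<lambda>\<xi>. \<phi> (x + \<xi>))"
proof -
  obtain C where C: "0 \<le> C" "\<And>y. \<bar>\<phi> y\<bar> \<le> C * (1 + \<bar>y\<bar>)" using lin_growthE[OF lg] by blast
  note [measurable] = lin_growth_measurable[OF lg]
  show ?thesis
  proof (rule Bochner_Integration.integrable_bound[of _ "\<lambda>\<xi>. C * (1 + \<bar>x\<bar> + \<bar>\<xi>\<bar>)"])
    show "integrable \<mu> (\<lambda>\<xi>. C * (1 + \<bar>x\<bar> + \<bar>\<xi>\<bar>))" using int_abs by auto
    have "\<bar>\<phi> (x + \<xi>)\<bar> \<le> C * (1 + \<bar>x\<bar> + \<bar>\<xi>\<bar>)" for \<xi>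
    proof -
      have "C * (1 + \<bar>x + \<xi>\<bar>) \<le> C * (1 + \<bar>x\<bar> + \<bar>\<xi>\<bar>)" using C(1) by (intro mult_left_mono) auto
      then show ?thesis using C(2)[of "x + \<xi>"] by linarith
    qed
    then show "AE \<xi> in \<mu>. norm (\<phi> (x + \<xi>)) \<le> norm (C * (1 + \<bar>x\<bar> + \<bar>\<xi>\<bar>))"
      using C(1) by (intro AE_I2) (auto intro: order_trans[OF _ abs_ge_self])
  qed measurable
qed

text \<open>\<open>(Q ^^ n) \<phi> x\<close> is the expectation of \<open>\<phi> (x + S\<^sub>n)\<close> on \<open>\<tau>\<^sub>x > n\<close>. One step from a negative point is
  allowed, as in the definition of \<open>\<tau>\<^sub>x\<close>, which ignores time \<open>0\<close>.\<close>

definition Q :: "(real \<Rightarrow> real) \<Rightarrow> real \<Rightarrow> real" where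
  "Q \<phi> x = (\<integral>\<xi>. indicator {0..} (x + \<xi>) * \<phi> (x + \<xi>) \<partial>\<mu>)"

lemma lin_growth_ind: assumes lg: "lin_growth \<phi>" shows "lin_growth (\<lambda>y. indicator {0..} y * \<phi> y)"
  using lin_growth_measurable[OF lg] by (intro lin_growth_dominated[OF lg]) (auto simp: indicator_def)

lemma int_Q: "lin_growth \<phi> \<Longrightarrow> integrable \<mu> (\<lambda>\<xi>. indicator {0..} (x + \<xi>) * \<phi> (x + \<xi>))"
  by (rule int_lin_growth[OF lin_growth_ind])

lemma lin_growth_Q: assumes lg: "lin_growth \<phi>" shows "lin_growth (Q \<phi>)"
proof -
  obtain C where C: "0 \<le> C" "\<And>y. \<bar>\<phi> y\<bar> \<le> C * (1 + \<bar>y\<bar>)" using lin_growthE[OF lg] by blast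
  note [measurable] = lin_growth_measurable[OF lg]
  define K where "K = 1 + (\<integral>\<xi>. \<bar>\<xi>\<bar> \<partial>\<mu>)"
  have K: "1 \<le> K" by (simp add: K_def)
  show ?thesis
  proof (rule lin_growthI[of _ "C * K"])
    show "Q \<phi> \<in> borel_measurable borel" unfolding Q_def[abs_def] by measurable
    fix x
    have "\<bar>Q \<phi> x\<bar> \<le> (\<integral>\<xi>. \<bar>indicator {0..} (x + \<xi>) * \<phi> (x + \<xi>)\<bar> \<partial>\<mu>)"
      unfolding Q_def by (rule integral_abs_bound)
    also have "\<dots> \<le> (\<integral>\<xi>. C * (1 + \<bar>x\<bar> + \<bar>\<xi>\<bar>) \<partial>\<mu>)"
    proof (rule integral_mono)
      fix \<xi>
      have "C * (1 + \<bar>x + \<xi>\<bar>) \<le> C * (1 + \<bar>x\<bar> + \<bar>\<xi>\<bar>)" using C(1) by (intro mult_left_mono) auto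
      moreover have "\<bar>indicator {0..} (x + \<xi>) * \<phi> (x + \<xi>)\<bar> \<le> \<bar>\<phi> (x + \<xi>)\<bar>" by (simp add: indicator_def)
      ultimately show "\<bar>indicator {0..} (x + \<xi>) * \<phi> (x + \<xi>)\<bar> \<le> C * (1 + \<bar>x\<bar> + \<bar>\<xi>\<bar>)"
        using C(2)[of "x + \<xi>"] by linarith
    qed (use int_Q[OF lg] int_abs in auto)
    also have "\<dots> = C * (K + \<bar>x\<bar>)" using int_abs prob_space by (simp add: K_def)
    also have "\<dots> \<le> C * (K * (1 + \<bar>x\<bar>))"
    proof (rule mult_left_mono)
      have "1 * \<bar>x\<bar> \<le> K * \<bar>x\<bar>" using K by (intro mult_right_mono) auto
      then show "K + \<bar>x\<bar> \<le> K * (1 + \<bar>x\<bar>)" by (simp add: distrib_left)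
    qed fact
    finally show "\<bar>Q \<phi> x\<bar> \<le> C * K * (1 + \<bar>x\<bar>)" by (simp add: mult.assoc)
  qed
qed

lemma lin_growth_Qn: "lin_growth \<phi> \<Longrightarrow> lin_growth ((Q ^^ n) \<phi>)"
  by (induction n) (auto intro: lin_growth_Q)

lemma Q_add: assumes "lin_growth \<phi>" "lin_growth \<psi>" shows "Q (\<lambda>y. \<phi> y + \<psi> y) = (\<lambda>x. Q \<phi> x + Q \<psi> x)"
  unfolding Q_def using int_Q[OF assms(1)] int_Q[OF assms(2)]
  by (simp add: distrib_left)

lemma Q_cmult: "Q (\<lambda>y. c * \<phi> y) = (\<lambda>x. c * Q \<phi> x)"
  unfolding Q_def by (simp add: mult.left_commute)

lemma Q_mono:
  assumes "lin_growth \<phi>" "lin_growth \<psi>" "\<And>y. 0 \<le> y \<Longrightarrow> \<phi> y \<le> \<psi> y"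
  shows "Q \<phi> x \<le> Q \<psi> x"
  unfolding Q_def
  by (rule integral_mono[OF int_Q int_Q]) (use assms in \<open>auto simp: indicator_def\<close>)

lemma Qn_Suc: "(Q ^^ Suc n) \<phi> x = Q ((Q ^^ n) \<phi>) x" by simp

lemma Qn_Suc2: "(Q ^^ Suc n) \<phi> = (Q ^^ n) (Q \<phi>)" by (simp add: funpow_swap1)

lemma Qn_add_comp: "(Q ^^ (i + j)) \<phi> = (Q ^^ i) ((Q ^^ j) \<phi>)" by (simp add: funpow_add)

lemma Qn_add: assumes "lin_growth \<phi>" "lin_growth \<psi>"
  shows "(Q ^^ n) (\<lambda>y. \<phi> y + \<psi> y) = (\<lambda>x. (Q ^^ n) \<phi> x + (Q ^^ n) \<psi> x)"
  by (induction n) (simp_all add: Q_add lin_growth_Qn assms)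

lemma Qn_cmult: "(Q ^^ n) (\<lambda>y. c * \<phi> y) = (\<lambda>x. c * (Q ^^ n) \<phi> x)"
  by (induction n) (simp_all add: Q_cmult)

lemma Qn_diff: assumes "lin_growth \<phi>" "lin_growth \<psi>"
  shows "(Q ^^ n) (\<lambda>y. \<phi> y - \<psi> y) = (\<lambda>x. (Q ^^ n) \<phi> x - (Q ^^ n) \<psi> x)"
  using Qn_add[OF assms(1) lin_growth_cmult[OF assms(2)], of n "-1"] Qn_cmult[of n "-1" \<psi>] by simp

lemma Qn_sum: assumes "finite I" "\<And>i. i \<in> I \<Longrightarrow> lin_growth (f i)"
  shows "(Q ^^ n) (\<lambda>y. \<Sum>i\<in>I. f i y) = (\<lambda>x. \<Sum>i\<in>I. (Q ^^ n) (f i) x)"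
  using assms
proof (induction I)
  case empty
  then show ?case using Qn_cmult[of n 0 "\<lambda>_. 0"] by simp
next
  case (insert i I)
  then show ?case by (simp add: Qn_add lin_growth_sum)
qed

lemma Qn_mono:
  assumes "lin_growth \<phi>" "lin_growth \<psi>" "\<And>y. 0 \<le> y \<Longrightarrow> \<phi> y \<le> \<psi> y" "0 \<le> x"
  shows "(Q ^^ n) \<phi> x \<le> (Q ^^ n) \<psi> x"
  using assms(4) by (induction n arbitrary: x) (auto intro: Q_mono lin_growth_Qn assms)

lemma Qn_nonneg:
  assumes "lin_growth \<phi>" "\<And>y. 0 \<le> y \<Longrightarrow> 0 \<le> \<phi> y" "0 \<le> x"
  shows "0 \<le> (Q ^^ n) \<phi> x"
  using Qn_mono[of "\<lambda>_. 0" \<phi> x n] assms Qn_cmult[of n 0 "\<lambda>_. 0"] by (simp add: lin_growth_const)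

definition surv :: "nat \<Rightarrow> real \<Rightarrow> real" where "surv n = (Q ^^ n) (\<lambda>_. 1)"

lemma lin_growth_surv: "lin_growth (surv n)"
  unfolding surv_def by (intro lin_growth_Qn lin_growth_const)

lemma surv_0[simp]: "surv 0 x = 1" by (simp add: surv_def)

lemma Q_const_le: "Q (\<lambda>_. 1) x \<le> 1" "0 \<le> Q (\<lambda>_. 1) x"
proof -
  have "Q (\<lambda>_. 1) x \<le> (\<integral>\<xi>. 1 \<partial>\<mu>)" unfolding Q_def
    by (rule integral_mono[OF int_Q[OF lin_growth_const]]) (auto simp: indicator_def)
  then show "Q (\<lambda>_. 1) x \<le> 1" using prob_space by simp
  show "0 \<le> Q (\<lambda>_. 1) x" unfolding Q_def by (rule Bochner_Integration.integral_nonneg) auto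
qed

lemma surv_bounds: "0 \<le> x \<Longrightarrow> 0 \<le> surv n x" "0 \<le> x \<Longrightarrow> surv n x \<le> 1"
proof -
  show "0 \<le> x \<Longrightarrow> 0 \<le> surv n x" unfolding surv_def by (rule Qn_nonneg) (auto intro: lin_growth_const)
  show "0 \<le> x \<Longrightarrow> surv n x \<le> 1"
  proof (induction n arbitrary: x)
    case (Suc n)
    have "surv (Suc n) x \<le> Q (\<lambda>_. 1) x"
      unfolding surv_def Qn_Suc unfolding surv_def[symmetric]
      by (rule Q_mono[OF lin_growth_surv lin_growth_const Suc.IH])
    then show ?case using Q_const_le(1)[of x] by linarith
  qed simp
qed

lemma Qn_le_surv:
  assumes "lin_growth \<phi>" "\<And>y. 0 \<le> y \<Longrightarrow> \<phi> y \<le> B" "0 \<le> x"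
  shows "(Q ^^ n) \<phi> x \<le> B * surv n x"
  using Qn_mono[of \<phi> "\<lambda>_. B * 1" x n] assms lin_growth_const unfolding Qn_cmult surv_def by simp

lemma Qn_abs_le:
  assumes "lin_growth \<phi>" "lin_growth \<psi>" "\<And>y. 0 \<le> y \<Longrightarrow> \<bar>\<phi> y\<bar> \<le> \<psi> y" "0 \<le> x"
  shows "\<bar>(Q ^^ n) \<phi> x\<bar> \<le> (Q ^^ n) \<psi> x"
proof -
  have "(Q ^^ n) \<phi> x \<le> (Q ^^ n) \<psi> x"
    by (rule Qn_mono[OF assms(1,2) _ assms(4)]) (use assms(3) in \<open>meson abs_le_D1\<close>)
  moreover have "(Q ^^ n) (\<lambda>y. -1 * \<phi> y) x \<le> (Q ^^ n) \<psi> x"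
  proof (rule Qn_mono[OF lin_growth_cmult[OF assms(1)] assms(2) _ assms(4)])
    show "-1 * \<phi> y \<le> \<psi> y" if "0 \<le> y" for y using assms(3)[OF that] by linarith
  qed
  ultimately show ?thesis unfolding Qn_cmult by linarith
qed

lemma Q_le_int:
  assumes "lin_growth \<phi>" "\<And>y. 0 \<le> \<phi> y"
  shows "Q \<phi> x \<le> (\<integral>\<xi>. \<phi> (x + \<xi>) \<partial>\<mu>)"
  unfolding Q_def
  by (rule integral_mono[OF int_Q int_lin_growth]) (use assms in \<open>auto simp: indicator_def\<close>)

lemma Qn_supermartingale:
  assumes "lin_growth F" "\<And>y. 0 \<le> y \<Longrightarrow> Q F y \<le> F y" "0 \<le> x"
  shows "(Q ^^ n) F x \<le> F x"
proof (induction n)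
  case (Suc n)
  have "(Q ^^ n) (Q F) x \<le> (Q ^^ n) F x" by (rule Qn_mono[OF lin_growth_Q]) (use assms in auto)
  then show ?case using Suc unfolding Qn_Suc2 by linarith
qed simp

text \<open>Telescoping the drift inequality: whatever amount of \<open>h\<close> is collected
  before the exit is paid from the initial value of \<open>F\<close>. It turns each Lyapunov
  function below into an occupation bound.\<close>

lemma supermartingale_occupation_le:
  assumes "lin_growth F" "lin_growth h" "\<And>y. 0 \<le> y \<Longrightarrow> Q F y \<le> F y - h y" "\<And>y. 0 \<le> y \<Longrightarrow> 0 \<le> F y" "0 \<le> x"
  shows "(\<Sum>k<n. (Q ^^ k) h x) \<le> F x"
proof -
  have "(\<Sum>k<n. (Q ^^ k) h x) \<le> F x - (Q ^^ n) F x"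
  proof (induction n)
    case (Suc n)
    have "(Q ^^ n) (Q F) x \<le> (Q ^^ n) (\<lambda>y. F y - h y) x"
      by (rule Qn_mono[OF lin_growth_Q lin_growth_diff]) (use assms in auto)
    then have "(Q ^^ Suc n) F x \<le> (Q ^^ n) F x - (Q ^^ n) h x"
      unfolding Qn_Suc2 by (simp add: Qn_diff assms)
    then show ?case using Suc by simp
  qed simp
  moreover have "0 \<le> (Q ^^ n) F x" by (rule Qn_nonneg) (use assms in auto)
  ultimately show ?thesis by linarith
qed

end

section \<open>Lyapunov functions\<close>

lemma bernoulli_powr:
  fixes p r :: real
  assumes "0 < p" "p < 1" "-1 \<le> r"
  shows "(1 + r) powr p \<le> 1 + p * r"
proof (cases "r = -1")
  case False
  then show ?thesis
    using Youngs_inequality_0[of p "1-p" "1 + r" 1] assms by (simp add: algebra_simps)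
qed (use assms in simp)

text \<open>Quantitative concavity: the gap \<open>h\<close> between the two sides is convex with a
  horizontal tangent at 0, where it vanishes.\<close>

lemma bernoulli_powr_quadratic:
  fixes p r :: real
  assumes p: "0 < p" "p < 1" and r: "\<bar>r\<bar> \<le> 1/2"
  shows "(1 + r) powr p \<le> 1 + p * r - 2 * p * (1 - p) / 9 * r^2"
proof -
  \<comment> \<open>For |r| \<le> 1/2 the second derivative of the power is at most - p (1 - p)
    (3/2)^(-2), that is -4/9 p (1 - p); \<open>c\<close> is half the absolute value of this.\<close>
  define c where "c = 2 * p * (1 - p) / 9"
  define h where "h r = 1 + p * r - c * r^2 - (1 + r) powr p" for r
  let ?A = "{-1/2..1/2::real}"
  have d1: "(h has_real_derivative (0 + p * 1 - c * (2 * r) - p * (1 + r) powr (p - 1))) (at r)" if "r \<in> ?A" for r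
  proof -
    have "((\<lambda>r. r^2) has_real_derivative 2 * r) (at r)" by (auto intro!: derivative_eq_intros)
    moreover have "((\<lambda>r. (1 + r) powr p) has_real_derivative p * (1 + r) powr (p - 1)) (at r)"
      using that by (auto intro!: derivative_eq_intros)
    ultimately show ?thesis unfolding h_def[abs_def] by (intro DERIV_diff DERIV_add DERIV_cmult DERIV_const DERIV_ident)
  qed
  have d2: "((\<lambda>r. 0 + p * 1 - c * (2 * r) - p * (1 + r) powr (p - 1)) has_real_derivative
      (- 2 * c - p * ((p - 1) * (1 + r) powr (p - 2)))) (at r)" if "r \<in> ?A" for r
  proof -
    have "((\<lambda>r. (1 + r) powr (p - 1)) has_real_derivative (p - 1) * (1 + r) powr (p - 2)) (at r)"
      using that by (auto intro!: derivative_eq_intros)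
    then have "((\<lambda>r. 0 + p * 1 - c * (2 * r) - p * (1 + r) powr (p - 1)) has_real_derivative
      (0 + 0 - c * (2 * 1) - p * ((p - 1) * (1 + r) powr (p - 2)))) (at r)"
      by (intro DERIV_diff DERIV_add DERIV_cmult DERIV_const DERIV_ident)
    then show ?thesis by (simp add: mult.commute)
  qed
  have d3: "0 \<le> - 2 * c - p * ((p - 1) * (1 + r) powr (p - 2))" if "r \<in> ?A" for r
  proof -
    have "4/9 = (3/2::real) powr (-2)" by (simp add: powr_minus power2_eq_square powr_numeral)
    also have "\<dots> \<le> (3/2) powr (p - 2)" using p by (intro powr_mono) auto
    also have "\<dots> \<le> (1 + r) powr (p - 2)" using that p by (intro powr_mono2') auto
    finally have "p * (1 - p) * (4/9) \<le> p * (1 - p) * (1 + r) powr (p - 2)" using p by (intro mult_left_mono) auto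
    moreover have "p * ((p - 1) * (1 + r) powr (p - 2)) = - (p * (1 - p) * (1 + r) powr (p - 2))"
      by (simp add: algebra_simps)
    moreover have "2 * c = p * (1 - p) * (4/9)" by (simp add: c_def)
    ultimately show ?thesis by linarith
  qed
  have conv: "convex_on ?A h"
  proof (rule f''_ge0_imp_convex)
    show "convex ?A" by simp
    show "(h has_real_derivative (0 + p * 1 - c * (2 * r) - p * (1 + r) powr (p - 1))) (at r)" if "r \<in> ?A" for r
      by (rule d1[OF that])
    show "((\<lambda>r. 0 + p * 1 - c * (2 * r) - p * (1 + r) powr (p - 1)) has_real_derivative
      (- 2 * c - p * ((p - 1) * (1 + r) powr (p - 2)))) (at r)" if "r \<in> ?A" for r
      by (rule d2[OF that])
    show "0 \<le> - 2 * c - p * ((p - 1) * (1 + r) powr (p - 2))" if "r \<in> ?A" for r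
      by (rule d3[OF that])
  qed
  have dh: "(h has_real_derivative 0) (at 0 within ?A)"
    using d1[of 0] by (simp add: has_field_derivative_at_within)
  have "connected ?A" "0 \<in> interior ?A" by simp_all
  moreover have "r \<in> ?A" using r by auto
  ultimately have "0 * (r - 0) \<le> h r - h 0"
    by (intro convex_on_imp_above_tangent[OF conv _ _ _ dh])
  then show ?thesis by (simp add: h_def c_def)
qed

context centred_law
begin

definition \<beta> :: real where "\<beta> = \<delta> / (3 + \<delta>)"

text \<open>With \<open>\<beta> < 1\<close> the power \<open>1 - \<beta>\<close> is increasing;
  \<open>3 * \<beta> / 2 \<le> \<delta>\<close> is the moment budget of
  \<open>overshoot_pointwise\<close>; \<open>\<beta> \<le> \<delta>\<close> provides the moment of
  order \<open>2 + \<beta>\<close> for the Taylor remainders.\<close>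

lemma beta: "0 < \<beta>" "\<beta> < 1" "3 * \<beta> / 2 \<le> \<delta>" "\<beta> \<le> \<delta>"
proof -
  show "0 < \<beta>" "\<beta> < 1" using delta by (auto simp: \<beta>_def)
  have "\<beta> \<le> \<delta> / 3" unfolding \<beta>_def using delta by (intro divide_left_mono) auto
  then show "3 * \<beta> / 2 \<le> \<delta>" "\<beta> \<le> \<delta>" using delta by linarith+
qed

definition Mom :: real where "Mom = (\<integral>\<xi>. \<bar>\<xi>\<bar> powr (2 + \<delta>) \<partial>\<mu>)"

lemma Mom_nonneg: "0 \<le> Mom" unfolding Mom_def by (rule Bochner_Integration.integral_nonneg) auto

text \<open>The coefficient of \<open>bernoulli_powr_quadratic\<close> at
  \<open>p = 1 - \<beta>\<close>.\<close>

definition c0 :: real where "c0 = 2 * (1 - \<beta>) * \<beta> / 9"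

lemma c0_pos: "0 < c0" using beta by (simp add: c0_def)

text \<open>With this shift the tails of the step beyond \<open>A / 2\<close> are dominated by the quadratic gain in concavity.\<close>

definition A :: real where "A = 2 * (max 1 (2 * (c0 + 1) * Mom / (c0 * \<sigma>\<^sup>2))) powr (1 / \<delta>)"

lemma A_ge: "2 \<le> A"
proof -
  have "1 powr (1/\<delta>) \<le> (max 1 (2 * (c0 + 1) * Mom / (c0 * \<sigma>\<^sup>2))) powr (1 / \<delta>)"
    using delta by (intro powr_mono2) auto
  then show ?thesis unfolding A_def by simp
qed

lemma A_small: "(c0 + 1) * Mom * (A / 2) powr (-\<delta>) \<le> c0 * \<sigma>\<^sup>2 / 2"
proof -
  define K where "K = max 1 (2 * (c0 + 1) * Mom / (c0 * \<sigma>\<^sup>2))"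
  have "(A / 2) powr (-\<delta>) = (K powr (1/\<delta>)) powr (-\<delta>)" by (simp add: A_def K_def)
  also have "\<dots> = 1 / K" using delta by (simp add: powr_powr powr_minus_divide K_def)
  finally have e: "(A / 2) powr (-\<delta>) = 1 / K" .
  have K: "2 * (c0 + 1) * Mom / (c0 * \<sigma>\<^sup>2) \<le> K" "0 < K" by (auto simp: K_def)
  have "0 < c0 * \<sigma>\<^sup>2" using c0_pos sigma by simp
  then have "2 * (c0 + 1) * Mom \<le> K * (c0 * \<sigma>\<^sup>2)" using K by (simp add: divide_le_eq)
  then show ?thesis unfolding e using K(2) by (simp add: field_simps)
qed

definition fl :: "real \<Rightarrow> real" where "fl y = max (A + y) 0 powr (1 - \<beta>)"
text \<open>On the half line a multiple of minus the second derivative of \<open>fl\<close>, hence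
  the order of the concavity gain in one step. Every one-step exit effect is measured against
  it.\<close>

definition rr :: "real \<Rightarrow> real" where "rr y = (A + max y 0) powr (-1 - \<beta>)"

lemma fl_nonneg: "0 \<le> fl y" by (simp add: fl_def)
lemma rr_nonneg: "0 \<le> rr y" by (simp add: rr_def)

lemma fl_le: "fl y \<le> 1 + max (A + y) 0"
  using powr_le_1_plus[of "1 - \<beta>" 1 "max (A + y) 0"] beta by (simp add: fl_def)

lemma fl_borel[measurable]: "fl \<in> borel_measurable borel" unfolding fl_def[abs_def] by measurable
lemma rr_borel[measurable]: "rr \<in> borel_measurable borel" unfolding rr_def[abs_def] by measurable

lemma lin_growth_fl: "lin_growth fl"
  by (rule lin_growth_dominated[OF lin_growth_add[OF lin_growth_const[of 1] lin_growth_max0[of A]]])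
    (use fl_le fl_nonneg in \<open>auto intro: order_trans[OF _ abs_ge_self]\<close>)

lemma rr_le_1: "rr y \<le> 1"
proof -
  have "rr y \<le> 1 powr (-1 - \<beta>)" unfolding rr_def using A_ge beta by (intro powr_mono2') auto
  then show ?thesis by simp
qed

lemma lin_growth_rr: "lin_growth rr"
  by (rule lin_growth_bounded[of _ 1]) (use rr_le_1 rr_nonneg in auto)

text \<open>For jumps up to z/2 the concave expansion yields the quadratic gain. For longer jumps
  only the linear bound plus a full square is available; the missing gain and that square,
  \<open>c0 + 1\<close> in total, are charged to the moment of order \<open>2 + \<delta>\<close>,
  since such jumps exceed \<open>A / 2\<close>.\<close>

lemma fl_pointwise:
  assumes "A \<le> z"
  shows "max (z + \<xi>) 0 powr (1 - \<beta>) \<le> z powr (1 - \<beta>) + (1 - \<beta>) * z powr (-\<beta>) * \<xi>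
    - c0 * z powr (-1 - \<beta>) * \<xi>\<^sup>2 + (c0 + 1) * z powr (-1 - \<beta>) * (\<bar>\<xi>\<bar> powr (2 + \<delta>) * (A/2) powr (-\<delta>))"
proof -
  define p where "p = 1 - \<beta>"
  define r where "r = \<xi> / z"
  have p: "0 < p" "p < 1" using beta by (auto simp: p_def)
  have z: "0 < z" using assms A_ge by linarith
  have xi: "\<xi> = z * r" using z by (simp add: r_def)
  have pw: "z powr (-\<beta>) * z = z powr p" "z powr (-1 - \<beta>) * z^2 = z powr p"
  proof -
    show "z powr (-\<beta>) * z = z powr p"
      using z powr_add[of z "-\<beta>" 1] by (simp add: p_def)
    show "z powr (-1 - \<beta>) * z^2 = z powr p"
      using z powr_add[of z "-1-\<beta>" 2] by (simp add: p_def)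
  qed
  have lhs: "max (z + \<xi>) 0 powr (1 - \<beta>) = z powr p * max (1 + r) 0 powr p"
  proof -
    have "max (z + \<xi>) 0 = z * max (1 + r) 0"
      using z unfolding xi by (simp add: max_mult_distrib_left distrib_left)
    then show ?thesis using z by (simp add: p_def powr_mult)
  qed
  have t: "(1 - \<beta>) * z powr (-\<beta>) * \<xi> = z powr p * (p * r)"
    unfolding xi pw(1)[symmetric] by (simp add: p_def)
  have q: "z powr (-1 - \<beta>) * \<xi>\<^sup>2 = z powr p * r^2"
    unfolding xi pw(2)[symmetric] by (simp add: power_mult_distrib)
  have c0: "c0 = 2 * p * (1 - p) / 9" by (simp add: c0_def p_def)
  show ?thesis
  proof (cases "\<bar>r\<bar> \<le> 1/2")
    case True
    have "z powr p * max (1 + r) 0 powr p \<le> z powr p * (1 + p * r - c0 * r^2)"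
      using bernoulli_powr_quadratic[OF p True] True unfolding c0 by (intro mult_left_mono) (auto simp: max_def abs_le_iff)
    also have "\<dots> = z powr (1 - \<beta>) + (1 - \<beta>) * z powr (-\<beta>) * \<xi> - c0 * (z powr (-1 - \<beta>) * \<xi>\<^sup>2)"
      unfolding t q by (simp add: p_def algebra_simps)
    moreover have "0 \<le> (c0 + 1) * z powr (-1 - \<beta>) * (\<bar>\<xi>\<bar> powr (2 + \<delta>) * (A/2) powr (-\<delta>))" using c0_pos by simp
    ultimately show ?thesis unfolding lhs by (simp add: mult.assoc)
  next
    case False
    have "max (1 + r) 0 powr p \<le> 1 + p * r + r^2"
    proof (cases "-1 \<le> r")
      case True
      then have m: "max (1 + r) 0 = 1 + r" by simp
      have "(1 + r) powr p \<le> 1 + p * r" by (rule bernoulli_powr[OF p True])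
      also have "\<dots> \<le> 1 + p * r + r^2" by simp
      finally show ?thesis unfolding m .
    next
      case F: False
      have "0 \<le> (r + 1/2)^2" by simp
      have "p * (-r) \<le> 1 * (-r)" using F p by (intro mult_right_mono) auto
      moreover have "(-r) * 1 \<le> (-r) * (-r)" using F by (intro mult_left_mono) auto
      ultimately have "0 \<le> 1 + p * r + r^2" by (simp add: power2_eq_square)
      then show ?thesis using F p by (simp add: max_def)
    qed
    then have "z powr p * max (1 + r) 0 powr p \<le> z powr p * (1 + p * r + r^2)" by (intro mult_left_mono) auto
    also have "\<dots> = z powr (1 - \<beta>) + (1 - \<beta>) * z powr (-\<beta>) * \<xi> - c0 * (z powr (-1 - \<beta>) * \<xi>\<^sup>2)
        + (c0 + 1) * (z powr (-1 - \<beta>) * \<xi>\<^sup>2)"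
      unfolding t q by (simp add: p_def algebra_simps)
    also have "(c0 + 1) * (z powr (-1 - \<beta>) * \<xi>\<^sup>2) \<le> (c0 + 1) * (z powr (-1 - \<beta>) * (\<bar>\<xi>\<bar> powr (2 + \<delta>) * (A/2) powr (-\<delta>)))"
    proof (intro mult_left_mono)
      have "A/2 \<le> z/2" using assms by simp
      also have "z/2 \<le> \<bar>\<xi>\<bar>" using False z by (simp add: r_def abs_divide divide_le_eq field_simps)
      finally have a: "A/2 \<le> \<bar>\<xi>\<bar>" .
      then have "(A/2) powr \<delta> \<le> \<bar>\<xi>\<bar> powr \<delta>" using A_ge delta by (intro powr_mono2) auto
      then have "1 \<le> \<bar>\<xi>\<bar> powr \<delta> * (A/2) powr (-\<delta>)" using A_ge by (simp add: powr_minus_divide)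
      then have "\<xi>\<^sup>2 * 1 \<le> \<xi>\<^sup>2 * (\<bar>\<xi>\<bar> powr \<delta> * (A/2) powr (-\<delta>))" by (intro mult_left_mono) auto
      moreover have "\<bar>\<xi>\<bar> powr (2 + \<delta>) = \<xi>\<^sup>2 * \<bar>\<xi>\<bar> powr \<delta>" using a A_ge by (simp add: powr_add)
      ultimately show "\<xi>\<^sup>2 \<le> \<bar>\<xi>\<bar> powr (2 + \<delta>) * (A/2) powr (-\<delta>)" by (simp add: mult.assoc)
    qed (use c0_pos in auto)
    finally show ?thesis unfolding lhs by (simp add: mult.assoc)
  qed
qed

definition c1 :: real where "c1 = c0 * \<sigma>\<^sup>2 / 2"
lemma c1_pos: "0 < c1" using c0_pos sigma by (simp add: c1_def)

text \<open>The linear term integrates to zero, and by \<open>A_small\<close> the tail term consumes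
  at most half of the quadratic gain; the other half is \<open>c1\<close>.\<close>

lemma lyapunov:
  assumes "0 \<le> y"
  shows "(\<integral>\<xi>. fl (y + \<xi>) \<partial>\<mu>) \<le> fl y - c1 * rr y"
proof -
  define z where "z = A + y"
  have z: "A \<le> z" "0 < z" using assms A_ge by (auto simp: z_def)
  let ?a = "z powr (1 - \<beta>)" and ?b = "(1 - \<beta>) * z powr (-\<beta>)" and ?c = "z powr (-1 - \<beta>)" and ?e = "(A/2) powr (-\<delta>)"
  have i: "integrable \<mu> (\<lambda>\<xi>. \<bar>\<xi>\<bar> powr (2 + \<delta>))" by (rule mom)
  have "(\<integral>\<xi>. fl (y + \<xi>) \<partial>\<mu>) \<le> (\<integral>\<xi>. ?a + ?b * \<xi> - c0 * ?c * \<xi>\<^sup>2 + (c0 + 1) * ?c * (\<bar>\<xi>\<bar> powr (2 + \<delta>) * ?e) \<partial>\<mu>)"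
  proof (rule integral_mono[OF int_lin_growth[OF lin_growth_fl]])
    show "integrable \<mu> (\<lambda>\<xi>. ?a + ?b * \<xi> - c0 * ?c * \<xi>\<^sup>2 + (c0 + 1) * ?c * (\<bar>\<xi>\<bar> powr (2 + \<delta>) * ?e))"
      using int_id int_sq i by (intro Bochner_Integration.integrable_add Bochner_Integration.integrable_diff integrable_mult_right integrable_mult_left) auto
    show "fl (y + \<xi>) \<le> ?a + ?b * \<xi> - c0 * ?c * \<xi>\<^sup>2 + (c0 + 1) * ?c * (\<bar>\<xi>\<bar> powr (2 + \<delta>) * ?e)" for \<xi>
      using fl_pointwise[OF z(1), of \<xi>] by (simp add: fl_def z_def add.assoc)
  qed
  also have "\<dots> = ?a + ?b * 0 - c0 * ?c * \<sigma>\<^sup>2 + (c0 + 1) * ?c * (Mom * ?e)"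
    using int_id int_sq i prob_space by (simp add: mean0 var Mom_def)
  also have "\<dots> = ?a - ?c * (c0 * \<sigma>\<^sup>2 - (c0 + 1) * Mom * ?e)" by (simp add: algebra_simps)
  also have "\<dots> \<le> ?a - ?c * c1"
    using A_small by (intro diff_left_mono mult_left_mono) (auto simp: c1_def)
  finally show ?thesis using assms z by (simp add: fl_def rr_def z_def mult.commute)
qed

lemma Q_fl: "0 \<le> y \<Longrightarrow> Q fl y \<le> fl y - c1 * rr y"
  using Q_le_int[OF lin_growth_fl fl_nonneg, of y] lyapunov[of y] by linarith

section \<open>Overshoot and the occupation measure that controls it\<close>

definition overshoot :: "real \<Rightarrow> real \<Rightarrow> real" where "overshoot y \<xi> = max (- (y + \<xi>)) 0"

lemma overshoot_nonneg: "0 \<le> overshoot y \<xi>" by (simp add: overshoot_def)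

lemma overshoot_borel[measurable]: "overshoot y \<in> borel_measurable borel"
  unfolding overshoot_def[abs_def] by measurable

definition Co :: real where "Co = 2 * (2 * A) powr (1 + \<beta>) * (1 + Mom)"

lemma Co_pos: "0 < Co" using A_ge Mom_nonneg by (simp add: Co_def)

text \<open>An exit from y forces the jump to exceed y, so \<open>1 + \<beta>\<close> powers of the
  jump can be exchanged for the decay \<open>rr y\<close>. The extra power
  \<open>1 + \<beta>/2\<close> of the overshoot is what the interpolation in \<open>Gt_fine\<close>
  consumes.\<close>

lemma overshoot_pointwise:
  assumes "0 \<le> y"
  shows "overshoot y \<xi> + overshoot y \<xi> powr (1 + \<beta>/2) \<le> 2 * (2 * A) powr (1 + \<beta>) * rr y * (1 + \<bar>\<xi>\<bar> powr (2 + \<delta>))"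
proof (cases "y + \<xi> \<ge> 0")
  case True
  then have "overshoot y \<xi> = 0" by (simp add: overshoot_def)
  then show ?thesis using rr_nonneg[of y] by simp
next
  case False
  define X where "X = max 1 \<bar>\<xi>\<bar>"
  have X: "1 \<le> X" "\<bar>\<xi>\<bar> \<le> X" by (auto simp: X_def)
  have o: "0 \<le> overshoot y \<xi>" "overshoot y \<xi> \<le> X" "y \<le> X" using False assms X by (auto simp: overshoot_def)
  have "overshoot y \<xi> + overshoot y \<xi> powr (1 + \<beta>/2) \<le> X powr (1 + \<beta>/2) + X powr (1 + \<beta>/2)"
  proof (rule add_mono)
    have "X powr 1 \<le> X powr (1 + \<beta>/2)" using X beta by (intro powr_mono) auto
    then show "overshoot y \<xi> \<le> X powr (1 + \<beta>/2)" using o X by simp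
    show "overshoot y \<xi> powr (1 + \<beta>/2) \<le> X powr (1 + \<beta>/2)" using o beta by (intro powr_mono2) auto
  qed
  also have "\<dots> = 2 * (X powr (2 + 3*\<beta>/2) * X powr (-1 - \<beta>))"
    by (subst powr_add[symmetric]) (simp add: field_simps)
  also have "X powr (2 + 3*\<beta>/2) * X powr (-1 - \<beta>) \<le> (1 + \<bar>\<xi>\<bar> powr (2 + \<delta>)) * ((2 * A) powr (1 + \<beta>) * rr y)"
  proof (rule mult_mono)
    have "X powr (2 + 3*\<beta>/2) \<le> X powr (2 + \<delta>)" using X beta by (intro powr_mono) auto
    also have "\<dots> \<le> 1 + \<bar>\<xi>\<bar> powr (2 + \<delta>)" by (auto simp: X_def max_def)
    finally show "X powr (2 + 3*\<beta>/2) \<le> 1 + \<bar>\<xi>\<bar> powr (2 + \<delta>)" .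
    have "A * 1 \<le> A * X" "1 * X \<le> A * X" using X A_ge by (intro mult_left_mono mult_right_mono; simp)+
    then have "A + y \<le> 2 * A * X" using o by linarith
    then have "(2 * A * X) powr (-1 - \<beta>) \<le> (A + y) powr (-1 - \<beta>)"
      using A_ge assms beta by (intro powr_mono2') auto
    then have "(2 * A) powr (-1 - \<beta>) * X powr (-1 - \<beta>) \<le> rr y"
      using A_ge X assms by (simp add: powr_mult rr_def)
    then have "(2 * A) powr (1 + \<beta>) * ((2 * A) powr (-1 - \<beta>) * X powr (-1 - \<beta>)) \<le> (2 * A) powr (1 + \<beta>) * rr y"
      by (intro mult_left_mono) auto
    moreover have "(2 * A) powr (1 + \<beta>) * (2 * A) powr (-1 - \<beta>) = 1"
      using A_ge by (subst powr_add[symmetric]) simp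
    ultimately show "X powr (-1 - \<beta>) \<le> (2 * A) powr (1 + \<beta>) * rr y" by (simp flip: mult.assoc)
  qed (auto simp: rr_nonneg)
  finally show ?thesis by (simp add: mult_ac)
qed

lemma overshoot_bound:
  assumes "0 \<le> y"
  shows "integrable \<mu> (\<lambda>\<xi>. overshoot y \<xi> + overshoot y \<xi> powr (1 + \<beta>/2))"
    "(\<integral>\<xi>. overshoot y \<xi> + overshoot y \<xi> powr (1 + \<beta>/2) \<partial>\<mu>) \<le> Co * rr y"
proof -
  let ?h = "\<lambda>\<xi>. 2 * (2 * A) powr (1 + \<beta>) * rr y * (1 + \<bar>\<xi>\<bar> powr (2 + \<delta>))"
  have i: "integrable \<mu> ?h" using mom by (intro integrable_mult_right) auto
  show ig: "integrable \<mu> (\<lambda>\<xi>. overshoot y \<xi> + overshoot y \<xi> powr (1 + \<beta>/2))"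
  proof (rule Bochner_Integration.integrable_bound[OF i])
    show "AE \<xi> in \<mu>. norm (overshoot y \<xi> + overshoot y \<xi> powr (1 + \<beta>/2)) \<le> norm (?h \<xi>)"
    proof (rule AE_I2)
      fix \<xi>
      have "0 \<le> overshoot y \<xi> + overshoot y \<xi> powr (1 + \<beta>/2)"
        using overshoot_nonneg by (intro add_nonneg_nonneg) auto
      then have "norm (overshoot y \<xi> + overshoot y \<xi> powr (1 + \<beta>/2)) = overshoot y \<xi> + overshoot y \<xi> powr (1 + \<beta>/2)"
        by (simp only: real_norm_def abs_of_nonneg)
      also note overshoot_pointwise[OF assms, of \<xi>]
      also have "?h \<xi> \<le> norm (?h \<xi>)" unfolding real_norm_def by (rule abs_ge_self)
      finally show "norm (overshoot y \<xi> + overshoot y \<xi> powr (1 + \<beta>/2)) \<le> norm (?h \<xi>)" .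
    qed
  qed measurable
  have "(\<integral>\<xi>. overshoot y \<xi> + overshoot y \<xi> powr (1 + \<beta>/2) \<partial>\<mu>) \<le> (\<integral>\<xi>. ?h \<xi> \<partial>\<mu>)"
    by (rule integral_mono[OF ig i]) (rule overshoot_pointwise[OF assms])
  also have "\<dots> = 2 * (2 * A) powr (1 + \<beta>) * rr y * (1 + Mom)"
    using mom prob_space by (simp add: Mom_def)
  finally show "(\<integral>\<xi>. overshoot y \<xi> + overshoot y \<xi> powr (1 + \<beta>/2) \<partial>\<mu>) \<le> Co * rr y" by (simp add: Co_def mult_ac)
qed

definition g :: "real \<Rightarrow> real" where "g y = (\<integral>\<xi>. overshoot y \<xi> \<partial>\<mu>)"

lemma lin_growth_neg: "lin_growth (\<lambda>y. max (-y) 0)"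
  by (rule lin_growthI[of _ 1]) auto

lemma int_over: "integrable \<mu> (overshoot y)"
  using int_lin_growth[OF lin_growth_neg, of y] by (simp add: overshoot_def[abs_def])

lemma g_nonneg: "0 \<le> g y" unfolding g_def by (rule Bochner_Integration.integral_nonneg) (rule overshoot_nonneg)

lemma g_le: assumes "0 \<le> y" shows "g y \<le> Co * rr y"
proof -
  have "g y \<le> (\<integral>\<xi>. overshoot y \<xi> + overshoot y \<xi> powr (1 + \<beta>/2) \<partial>\<mu>)"
    unfolding g_def by (rule integral_mono[OF int_over overshoot_bound(1)[OF assms]]) auto
  then show ?thesis using overshoot_bound(2)[OF assms] by linarith
qed

lemma lin_growth_g: "lin_growth g"
proof (rule lin_growthI[of _ "1 + (\<integral>\<xi>. \<bar>\<xi>\<bar> \<partial>\<mu>)"])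
  show "g \<in> borel_measurable borel" unfolding g_def[abs_def] overshoot_def by measurable
  fix y
  have "g y \<le> (\<integral>\<xi>. \<bar>y\<bar> + \<bar>\<xi>\<bar> \<partial>\<mu>)"
    unfolding g_def using int_abs by (intro integral_mono[OF int_over]) (auto simp: overshoot_def)
  also have "\<dots> = \<bar>y\<bar> + (\<integral>\<xi>. \<bar>\<xi>\<bar> \<partial>\<mu>)" using int_abs prob_space by simp
  also have "\<dots> \<le> (1 + (\<integral>\<xi>. \<bar>\<xi>\<bar> \<partial>\<mu>)) * (1 + \<bar>y\<bar>)"
  proof -
    have "0 \<le> (\<integral>\<xi>. \<bar>\<xi>\<bar> \<partial>\<mu>) * \<bar>y\<bar>" by simp
    then show ?thesis by (simp only: distrib_left distrib_right)
  qed
  finally show "\<bar>g y\<bar> \<le> (1 + (\<integral>\<xi>. \<bar>\<xi>\<bar> \<partial>\<mu>)) * (1 + \<bar>y\<bar>)" using g_nonneg[of y] by simp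
qed

lemma Q_sum: assumes "finite I" "\<And>i. i \<in> I \<Longrightarrow> lin_growth (f i)"
  shows "Q (\<lambda>y. \<Sum>i\<in>I. f i y) x = (\<Sum>i\<in>I. Q (f i) x)"
  using Qn_sum[OF assms, where n = 1] by (simp add: fun_eq_iff)

definition occ :: "nat \<Rightarrow> real \<Rightarrow> real" where "occ n x = (\<Sum>k<n. (Q ^^ k) rr x)"

lemma lin_growth_occ: "lin_growth (occ n)"
  unfolding occ_def[abs_def] by (intro lin_growth_sum lin_growth_Qn lin_growth_rr)

lemma Qn_rr_nonneg: "0 \<le> x \<Longrightarrow> 0 \<le> (Q ^^ k) rr x"
  by (rule Qn_nonneg[OF lin_growth_rr rr_nonneg])

lemma occ_nonneg: "0 \<le> x \<Longrightarrow> 0 \<le> occ n x"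
  unfolding occ_def by (intro sum_nonneg Qn_rr_nonneg)

lemma occ_Suc: "occ (Suc n) x = rr x + Q (occ n) x"
proof -
  have "Q (occ n) x = (\<Sum>k<n. Q ((Q ^^ k) rr) x)"
    unfolding occ_def[abs_def] by (rule Q_sum) (auto intro: lin_growth_Qn lin_growth_rr)
  then show ?thesis unfolding occ_def sum.lessThan_Suc_shift by simp
qed

lemma occ_le_fl: assumes "0 \<le> x" shows "occ n x \<le> fl x / c1"
proof -
  have "(\<Sum>k<n. (Q ^^ k) (\<lambda>y. c1 * rr y) x) \<le> fl x"
    by (rule supermartingale_occupation_le[OF lin_growth_fl lin_growth_cmult[OF lin_growth_rr] Q_fl fl_nonneg assms])
  then show ?thesis unfolding Qn_cmult occ_def using c1_pos
    by (simp add: le_divide_eq mult.commute flip: sum_distrib_left)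
qed

lemma fl_le_powr: assumes "0 \<le> x" shows "fl x \<le> A * (1 + x) powr (1 - \<beta>)"
proof -
  have "1 * x \<le> A * x" using A_ge assms by (intro mult_right_mono) auto
  then have "fl x \<le> (A * (1 + x)) powr (1 - \<beta>)"
    unfolding fl_def using A_ge assms beta by (intro powr_mono2) (auto simp: algebra_simps)
  also have "\<dots> = A powr (1 - \<beta>) * (1 + x) powr (1 - \<beta>)" using A_ge assms by (simp add: powr_mult)
  also have "\<dots> \<le> A powr 1 * (1 + x) powr (1 - \<beta>)"
    using A_ge beta by (intro mult_right_mono powr_mono) auto
  finally show ?thesis using A_ge by simp
qed

lemma fl_mono: "x \<le> y \<Longrightarrow> fl x \<le> fl y"
  unfolding fl_def using beta by (intro powr_mono2) auto

text \<open>A bound uniform in the starting point: above level h each step collects at most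
  \<open>(A + h) powr (-1 - \<beta>)\<close>, and from a position below h everything collected
  afterwards is at most \<open>fl h / c1\<close>.\<close>

lemma occ_le_level:
  assumes "0 \<le> h" "0 \<le> x"
  shows "occ n x \<le> fl h / c1 + real n * (A + h) powr (-1 - \<beta>)"
  using assms(2)
proof (induction n arbitrary: x)
  case 0
  then show ?case using fl_nonneg[of h] c1_pos by (simp add: occ_def)
next
  case (Suc n)
  let ?B = "fl h / c1 + real n * (A + h) powr (-1 - \<beta>)"
  have B: "0 \<le> ?B" using fl_nonneg[of h] c1_pos by simp
  show ?case
  proof (cases "x \<le> h")
    case True
    have "occ (Suc n) x \<le> fl x / c1" by (rule occ_le_fl[OF Suc.prems])
    also have "\<dots> \<le> fl h / c1" using fl_mono[OF True] c1_pos by (intro divide_right_mono) auto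
    finally show ?thesis by (simp add: add_increasing2)
  next
    case False
    have "rr x \<le> (A + h) powr (-1 - \<beta>)"
      unfolding rr_def using False assms(1) A_ge beta by (intro powr_mono2') auto
    moreover have "Q (occ n) x \<le> Q (\<lambda>_. ?B * 1) x"
      by (rule Q_mono[OF lin_growth_occ lin_growth_const]) (use Suc.IH in simp)
    moreover have "Q (\<lambda>_. ?B * 1) x \<le> ?B * 1"
      unfolding Q_cmult using Q_const_le(1)[of x] B by (intro mult_left_mono)
    ultimately show ?thesis unfolding occ_Suc by (simp add: algebra_simps)
  qed
qed

lemma occ_bound: "\<exists>C>0. \<forall>n x. 0 \<le> x \<longrightarrow> occ n x \<le> C * (1 + x) powr (1 - \<beta>) \<and> occ n x \<le> C * sqrt n powr (1 - \<beta>)"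
proof (intro exI conjI allI impI)
  let ?C = "2 * A / c1 + 1"
  show "0 < ?C" using A_ge c1_pos by (simp add: add_pos_pos)
  fix n :: nat and x :: real assume x: "0 \<le> x"
  have "occ n x \<le> A * (1 + x) powr (1 - \<beta>) / c1"
    using occ_le_fl[OF x, of n] fl_le_powr[OF x] c1_pos by (meson divide_right_mono less_imp_le order_trans)
  also have "\<dots> = (A / c1) * (1 + x) powr (1 - \<beta>)" by simp
  also have "\<dots> \<le> ?C * (1 + x) powr (1 - \<beta>)"
    using A_ge c1_pos by (intro mult_right_mono) (auto simp: add_increasing2 divide_right_mono)
  finally show "occ n x \<le> ?C * (1 + x) powr (1 - \<beta>)" .
  show "occ n x \<le> ?C * sqrt n powr (1 - \<beta>)"
  proof (cases "n = 0")
    case False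
    \<comment> \<open>The level at which both terms of \<open>occ_le_level\<close> have order
      \<open>sqrt n powr (1 - \<beta>)\<close>.\<close>
    define s where "s = sqrt (real n)"
    have s: "1 \<le> s" "real n = s * s" using False by (auto simp: s_def)
    have "fl s \<le> A * (1 + s) powr (1 - \<beta>)" using s by (intro fl_le_powr) auto
    also have "\<dots> \<le> A * (2 * s powr (1 - \<beta>))"
    proof (intro mult_left_mono)
      have "(1 + s) powr (1 - \<beta>) \<le> (2 * s) powr (1 - \<beta>)" using s beta by (intro powr_mono2) auto
      also have "\<dots> = 2 powr (1 - \<beta>) * s powr (1 - \<beta>)" using s by (simp add: powr_mult)
      also have "\<dots> \<le> 2 powr 1 * s powr (1 - \<beta>)" using beta by (intro mult_right_mono powr_mono) auto
      finally show "(1 + s) powr (1 - \<beta>) \<le> 2 * s powr (1 - \<beta>)" by simp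
    qed (use A_ge in auto)
    finally have 1: "fl s / c1 \<le> 2 * A / c1 * s powr (1 - \<beta>)" using c1_pos by (simp add: divide_right_mono mult.assoc mult.left_commute)
    have "(A + s) powr (-1 - \<beta>) \<le> s powr (-1 - \<beta>)" using s A_ge beta by (intro powr_mono2') auto
    then have "real n * (A + s) powr (-1 - \<beta>) \<le> real n * s powr (-1 - \<beta>)" by (intro mult_left_mono) auto
    also have "\<dots> = s powr 2 * s powr (-1 - \<beta>)" using s by (simp add: power2_eq_square)
    also have "\<dots> = s powr (1 - \<beta>)" by (subst powr_add[symmetric]) simp
    finally have 2: "real n * (A + s) powr (-1 - \<beta>) \<le> s powr (1 - \<beta>)" .
    show ?thesis using occ_le_level[of s x n] s x 1 2 by (simp add: distrib_right flip: s_def)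
  qed (use A_ge c1_pos in \<open>simp add: occ_def\<close>)
qed

section \<open>The survival probability\<close>

abbreviation idp :: "real \<Rightarrow> real" where "idp \<equiv> \<lambda>y. max y 0"

lemma lin_growth_idp: "lin_growth idp"
  using lin_growth_max0[of 0] by simp

lemma Q_idp: "Q idp x = x + g x"
proof -
  have "Q idp x = (\<integral>\<xi>. (x + \<xi>) + overshoot x \<xi> \<partial>\<mu>)"
    unfolding Q_def by (intro Bochner_Integration.integral_cong) (auto simp: overshoot_def indicator_def)
  also have "\<dots> = (\<integral>\<xi>. x + \<xi> \<partial>\<mu>) + g x"
    unfolding g_def using int_id int_over by (intro Bochner_Integration.integral_add) auto
  also have "(\<integral>\<xi>. x + \<xi> \<partial>\<mu>) = x" using int_id prob_space by (simp add: mean0)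
  finally show ?thesis .
qed

text \<open>Each killed step adds the expected overshoot to \<open>idp\<close>. Adding
  \<open>Co / c1\<close> times \<open>fl\<close>, whose drift is at most \<open>- c1 * rr\<close>,
  absorbs this by \<open>g_le\<close>, so the sum is a supermartingale.\<close>

lemma Qn_idp_bound: "\<exists>C>0. \<forall>n x. 0 \<le> x \<longrightarrow> (Q ^^ n) idp x \<le> C * (1 + x)"
proof (intro exI conjI allI impI)
  let ?K = "Co / c1"
  let ?C = "1 + ?K * A"
  have K: "0 < ?K" using Co_pos c1_pos by simp
  show "0 < ?C" using A_ge K by (intro add_pos_pos mult_pos_pos) auto
  fix n :: nat and x :: real assume x: "0 \<le> x"
  define m where "m y = idp y + ?K * fl y" for y
  have lg: "lin_growth m" unfolding m_def[abs_def] by (intro lin_growth_add lin_growth_cmult lin_growth_fl lin_growth_idp)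
  have "Q m y \<le> m y" if "0 \<le> y" for y
  proof -
    have "Q m y = (y + g y) + ?K * Q fl y"
      unfolding m_def[abs_def] Q_add[OF lin_growth_idp lin_growth_cmult[OF lin_growth_fl]] Q_cmult Q_idp by simp
    also have "\<dots> \<le> (y + Co * rr y) + ?K * (fl y - c1 * rr y)"
      using K by (intro add_mono mult_left_mono g_le Q_fl that order_refl) auto
    also have "\<dots> = m y" using that c1_pos by (simp add: m_def field_simps)
    finally show ?thesis .
  qed
  then have "(Q ^^ n) m x \<le> m x" by (intro Qn_supermartingale lg x)
  moreover have "(Q ^^ n) idp x \<le> (Q ^^ n) m x"
  proof (rule Qn_mono[OF lin_growth_idp lg _ x])
    show "idp y \<le> m y" for y
      using mult_nonneg_nonneg[OF less_imp_le[OF K] fl_nonneg[of y]] unfolding m_def by linarith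
  qed
  moreover have "m x \<le> ?C * (1 + x)"
  proof -
    have "(1 + x) powr (1 - \<beta>) \<le> (1 + x) powr 1" using beta x by (intro powr_mono) auto
    then have "A * (1 + x) powr (1 - \<beta>) \<le> A * (1 + x)" using A_ge x by (intro mult_left_mono) auto
    then have "fl x \<le> A * (1 + x)" using fl_le_powr[OF x] by linarith
    then have "?K * fl x \<le> ?K * (A * (1 + x))" using K by (intro mult_left_mono) auto
    then show ?thesis using x by (simp add: m_def distrib_right mult.assoc)
  qed
  ultimately show "(Q ^^ n) idp x \<le> ?C * (1 + x)" by linarith
qed

text \<open>The capped parabola loses a constant amount per step below level \<open>h\<close> and is concave, up to an error
  from jumps across \<open>0\<close> that \<^const>\<open>fl\<close> absorbs.\<close>

definition cap :: "real \<Rightarrow> real \<Rightarrow> real" where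
  "cap h z = (if 0 \<le> z then (2 * h)\<^sup>2 - (max (2 * h - z) 0)\<^sup>2 else 0)"

lemma cap_bounds:
  assumes "0 < h" shows "0 \<le> cap h z" "cap h z \<le> (2 * h)\<^sup>2" "0 \<le> z \<Longrightarrow> cap h z \<le> 4 * h * z"
proof -
  have "(max (2 * h - z) 0)\<^sup>2 \<le> (2 * h)\<^sup>2" if "0 \<le> z"
    using that assms by (intro power_mono) auto
  then show "0 \<le> cap h z" unfolding cap_def by simp
  show "cap h z \<le> (2 * h)\<^sup>2" by (simp add: cap_def)
  assume z: "0 \<le> z"
  show "cap h z \<le> 4 * h * z"
  proof (cases "z \<le> 2 * h")
    case True
    then show ?thesis using z by (simp add: cap_def power2_eq_square algebra_simps)
  next
    case False
    then have "h * (4 * h) \<le> h * (4 * z)" using assms by (intro mult_left_mono) auto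
    then show ?thesis using z False by (simp add: cap_def power2_eq_square)
  qed
qed

lemma cap_concave:
  assumes "0 < h" "0 \<le> z" "0 \<le> z + \<xi>"
  shows "cap h (z + \<xi>) \<le> cap h z + 2 * max (2 * h - z) 0 * \<xi>"
proof -
  define s where "s = 2 * h - z"
  have "(max s 0)\<^sup>2 - 2 * max s 0 * \<xi> \<le> (max (s - \<xi>) 0)\<^sup>2"
  proof (cases "0 \<le> s")
    case s: True
    show ?thesis
    proof (cases "\<xi> \<le> s")
      case True
      have "0 \<le> \<xi> * \<xi>" by simp
      then show ?thesis using s True by (simp add: power2_eq_square algebra_simps)
    next
      case False
      then have "s * s \<le> s * (2 * \<xi>)" using s by (intro mult_left_mono) auto
      then show ?thesis using s False by (simp add: power2_eq_square algebra_simps)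
    qed
  qed simp
  moreover have "2 * h - (z + \<xi>) = s - \<xi>" by (simp add: s_def)
  ultimately show ?thesis using assms unfolding cap_def s_def by (simp add: algebra_simps)
qed

text \<open>If z \<le> h and |\<xi>| \<le> z, the parabola is hit below its cap and the expansion is
  exact. Only a jump with |\<xi>| > z can cross 0; the loss of concavity, at most
  \<open>4 * h * \<bar>\<xi>\<bar>\<close>, is then converted into a power of z, and the square into
  the tail moment.\<close>

lemma cap_pointwise:
  assumes h: "0 < h" and z: "A \<le> z"
  shows "cap h (z + \<xi>) \<le> cap h z + 2 * max (2 * h - z) 0 * \<xi>
    - indicator {..h} z * (\<xi>\<^sup>2 - \<bar>\<xi>\<bar> powr (2 + \<delta>) * (A/2) powr (-\<delta>))
    + 4 * h * (z powr (-1 - \<beta>) * \<bar>\<xi>\<bar> powr (2 + \<beta>))"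
proof -
  have z0: "2 \<le> z" using z A_ge by linarith
  let ?s = "max (2 * h - z) 0"
  have n1: "0 \<le> 4 * h * (z powr (-1 - \<beta>) * \<bar>\<xi>\<bar> powr (2 + \<beta>))" using h by simp
  have n2: "0 \<le> \<bar>\<xi>\<bar> powr (2 + \<delta>) * (A/2) powr (-\<delta>)" by simp
  show ?thesis
  proof (cases "\<bar>\<xi>\<bar> \<le> z")
    case True
    show ?thesis
    proof (cases "z \<le> h")
      case zh: True
      have "cap h (z + \<xi>) = cap h z + 2 * ?s * \<xi> - \<xi>\<^sup>2"
      proof -
        have "0 \<le> z + \<xi>" "max (2 * h - (z + \<xi>)) 0 = 2 * h - (z + \<xi>)" "?s = 2 * h - z"
          using True zh z0 h by auto
        then show ?thesis using z0 by (simp add: cap_def power2_eq_square algebra_simps)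
      qed
      then show ?thesis using zh n1 n2 by simp
    next
      case False
      have "0 \<le> z + \<xi>" using True by linarith
      then have "cap h (z + \<xi>) \<le> cap h z + 2 * ?s * \<xi>" using cap_concave[of h z \<xi>] z0 h by simp
      moreover have "(indicator {..h} z :: real) = 0" using False by simp
      ultimately show ?thesis using n1 by (simp only: mult_zero_left)
    qed
  next
    case False
    have b: "4 * h * \<bar>\<xi>\<bar> \<le> 4 * h * (z powr (-1 - \<beta>) * \<bar>\<xi>\<bar> powr (2 + \<beta>))"
    proof (rule mult_left_mono)
      have "\<bar>\<xi>\<bar> = \<bar>\<xi>\<bar> powr (-1 - \<beta>) * \<bar>\<xi>\<bar> powr (2 + \<beta>)"
        using False z0 by (subst powr_add[symmetric]) simp
      also have "\<dots> \<le> z powr (-1 - \<beta>) * \<bar>\<xi>\<bar> powr (2 + \<beta>)"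
        using False z0 beta by (intro mult_right_mono powr_mono2') auto
      finally show "\<bar>\<xi>\<bar> \<le> z powr (-1 - \<beta>) * \<bar>\<xi>\<bar> powr (2 + \<beta>)" .
    qed (use h in auto)
    have c: "\<xi>\<^sup>2 \<le> \<bar>\<xi>\<bar> powr (2 + \<delta>) * (A/2) powr (-\<delta>)"
    proof -
      have a: "A/2 \<le> \<bar>\<xi>\<bar>" "0 < \<bar>\<xi>\<bar>" using False z A_ge by auto
      then have "(A/2) powr \<delta> \<le> \<bar>\<xi>\<bar> powr \<delta>" using A_ge delta by (intro powr_mono2) auto
      then have "1 \<le> \<bar>\<xi>\<bar> powr \<delta> * (A/2) powr (-\<delta>)" using A_ge by (simp add: powr_minus_divide)
      then have "\<xi>\<^sup>2 * 1 \<le> \<xi>\<^sup>2 * (\<bar>\<xi>\<bar> powr \<delta> * (A/2) powr (-\<delta>))" by (intro mult_left_mono) auto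
      moreover have "\<bar>\<xi>\<bar> powr (2 + \<delta>) = \<xi>\<^sup>2 * \<bar>\<xi>\<bar> powr \<delta>" using a by (simp add: powr_add)
      ultimately show ?thesis by (simp add: mult.assoc)
    qed
    have d: "cap h (z + \<xi>) \<le> cap h z + 2 * ?s * \<xi> + 4 * h * \<bar>\<xi>\<bar>"
    proof (cases "0 \<le> z + \<xi>")
      case True
      then show ?thesis using cap_concave[of h z \<xi>] z0 h mult_nonneg_nonneg[of "4 * h" "\<bar>\<xi>\<bar>"] by linarith
    next
      case False
      have "2 * ?s * \<bar>\<xi>\<bar> \<le> 4 * h * \<bar>\<xi>\<bar>" using z0 h by (intro mult_right_mono) auto
      moreover have "2 * ?s * \<xi> = - (2 * ?s * \<bar>\<xi>\<bar>)" using False z0 by simp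
      moreover have "cap h (z + \<xi>) = 0" using False by (simp add: cap_def)
      ultimately show ?thesis using cap_bounds(1)[OF h, of z] by linarith
    qed
    have "0 \<le> - indicator {..h} z * (\<xi>\<^sup>2 - \<bar>\<xi>\<bar> powr (2 + \<delta>) * (A/2) powr (-\<delta>))"
      using c by (simp add: indicator_def)
    then show ?thesis using b d by linarith
  qed
qed

definition Mb :: real where "Mb = (\<integral>\<xi>. \<bar>\<xi>\<bar> powr (2 + \<beta>) \<partial>\<mu>)"

lemma Mb_nonneg: "0 \<le> Mb" unfolding Mb_def by (rule Bochner_Integration.integral_nonneg) auto

lemma Mom_small: "Mom * (A/2) powr (-\<delta>) \<le> \<sigma>\<^sup>2 / 2"
proof -
  have "(c0 + 1) * (Mom * (A/2) powr (-\<delta>)) \<le> c0 * \<sigma>\<^sup>2 / 2" using A_small by (simp add: mult.assoc)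
  also have "\<dots> \<le> (c0 + 1) * (\<sigma>\<^sup>2 / 2)" using c0_pos by (simp add: field_simps)
  finally show ?thesis by (rule mult_left_le_imp_le) (use c0_pos in auto)
qed

lemma lin_growth_cap: assumes "0 < h" shows "lin_growth (\<lambda>y. cap h (A + y))"
proof (rule lin_growth_bounded[of _ "(2 * h)\<^sup>2"])
  show "(\<lambda>y. cap h (A + y)) \<in> borel_measurable borel" unfolding cap_def by measurable
  show "\<bar>cap h (A + y)\<bar> \<le> (2 * h)\<^sup>2" for y using cap_bounds[OF assms, of "A + y"] by simp
qed

lemma int_cap:
  assumes h: "0 < h" and y: "0 \<le> y"
  shows "(\<integral>\<xi>. cap h (A + (y + \<xi>)) \<partial>\<mu>) \<le> cap h (A + y) - \<sigma>\<^sup>2 / 2 * indicator {..h} (A + y) + 4 * h * Mb * rr y"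
proof -
  define z where "z = A + y"
  define s where "s = 2 * max (2 * h - z) 0"
  define i where "i = (indicator {..h} z :: real)"
  let ?e = "(A/2) powr (-\<delta>)" and ?c = "z powr (-1 - \<beta>)"
  have z: "A \<le> z" using y by (simp add: z_def)
  have ib: "integrable \<mu> (\<lambda>\<xi>. \<bar>\<xi>\<bar> powr (2 + \<beta>))" using beta by (intro int_powr) auto
  have "(\<integral>\<xi>. cap h (A + (y + \<xi>)) \<partial>\<mu>) \<le> (\<integral>\<xi>. cap h z + s * \<xi> - i * (\<xi>\<^sup>2 - \<bar>\<xi>\<bar> powr (2 + \<delta>) * ?e) + 4 * h * (?c * \<bar>\<xi>\<bar> powr (2 + \<beta>)) \<partial>\<mu>)"
  proof (rule integral_mono[OF int_lin_growth[OF lin_growth_cap[OF h]]])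
    show "integrable \<mu> (\<lambda>\<xi>. cap h z + s * \<xi> - i * (\<xi>\<^sup>2 - \<bar>\<xi>\<bar> powr (2 + \<delta>) * ?e) + 4 * h * (?c * \<bar>\<xi>\<bar> powr (2 + \<beta>)))"
      using int_id int_sq ib mom by (intro Bochner_Integration.integrable_add Bochner_Integration.integrable_diff integrable_mult_right integrable_mult_left) auto
    show "cap h (A + (y + \<xi>)) \<le> cap h z + s * \<xi> - i * (\<xi>\<^sup>2 - \<bar>\<xi>\<bar> powr (2 + \<delta>) * ?e) + 4 * h * (?c * \<bar>\<xi>\<bar> powr (2 + \<beta>))" for \<xi>
      using cap_pointwise[OF h z, of \<xi>] by (simp add: z_def s_def i_def add.assoc)
  qed
  also have "\<dots> = cap h z + s * 0 - i * (\<sigma>\<^sup>2 - Mom * ?e) + 4 * h * (?c * Mb)"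
    using int_id int_sq ib mom prob_space by (simp add: mean0 var Mom_def Mb_def)
  also have "\<dots> \<le> cap h z - i * (\<sigma>\<^sup>2 / 2) + 4 * h * (?c * Mb)"
  proof -
    have "i * (\<sigma>\<^sup>2 / 2) \<le> i * (\<sigma>\<^sup>2 - Mom * ?e)" using Mom_small by (intro mult_left_mono) (auto simp: i_def)
    then show ?thesis by simp
  qed
  finally show ?thesis using y by (simp add: z_def i_def rr_def mult_ac)
qed

text \<open>The capped parabola starts below \<open>4 * h * (A + x)\<close> and drops by at least
  \<open>\<sigma>\<^sup>2 / 2\<close> on average per step below level h, up to the error that
  \<open>fl\<close> absorbs. Hence the time spent there is linear in h and in 1 + x.\<close>

lemma occupation_near_zero: "\<exists>C>0. \<forall>h n x. 0 < h \<longrightarrow> 0 \<le> x \<longrightarrow> (\<Sum>k<n. (Q ^^ k) (\<lambda>y. indicator {..h} (A + y)) x) \<le> C * h * (1 + x)"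
proof (intro exI conjI allI impI)
  let ?D = "4 * A + 4 * Mb / c1 * A"
  let ?C = "2 / \<sigma>\<^sup>2 * ?D"
  show "0 < ?C" using A_ge c1_pos sigma Mb_nonneg by (intro mult_pos_pos add_pos_nonneg) auto
  fix h x :: real and n :: nat assume h: "0 < h" and x: "0 \<le> x"
  \<comment> \<open>Chosen so that the drift \<open>- K * c1 * rr y\<close> of \<open>K * fl\<close>
    cancels the error \<open>4 * h * Mb * rr y\<close> of \<open>int_cap\<close>.\<close>
  define K where "K = 4 * h * Mb / c1"
  have K: "0 \<le> K" using h Mb_nonneg c1_pos by (simp add: K_def)
  define F where "F y = cap h (A + y) + K * fl y" for y
  define I where "I y = (indicator {..h} (A + y) :: real)" for y
  have lgI: "lin_growth I" unfolding I_def[abs_def] by (rule lin_growth_bounded[of _ 1]) (auto simp: indicator_def)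
  have lgF: "lin_growth F" unfolding F_def[abs_def] by (intro lin_growth_add lin_growth_cmult lin_growth_cap lin_growth_fl h)
  have "(\<Sum>k<n. (Q ^^ k) (\<lambda>y. \<sigma>\<^sup>2 / 2 * I y) x) \<le> F x"
  proof (rule supermartingale_occupation_le[OF lgF lin_growth_cmult[OF lgI] _ _ x])
    show "0 \<le> F y" for y using cap_bounds[OF h] fl_nonneg K by (simp add: F_def)
    fix y :: real assume y: "0 \<le> y"
    have "Q F y = Q (\<lambda>y. cap h (A + y)) y + K * Q fl y"
      unfolding F_def[abs_def] Q_add[OF lin_growth_cap[OF h] lin_growth_cmult[OF lin_growth_fl]] Q_cmult by simp
    also have "\<dots> \<le> (cap h (A + y) - \<sigma>\<^sup>2 / 2 * I y + 4 * h * Mb * rr y) + K * (fl y - c1 * rr y)"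
      using Q_le_int[OF lin_growth_cap[OF h] cap_bounds(1)[OF h], of y] int_cap[OF h y]
        mult_left_mono[OF Q_fl[OF y] K] unfolding I_def by linarith
    also have "\<dots> = F y - \<sigma>\<^sup>2 / 2 * I y" using c1_pos by (simp add: F_def K_def field_simps)
    finally show "Q F y \<le> F y - \<sigma>\<^sup>2 / 2 * I y" .
  qed
  also have "F x \<le> ?D * h * (1 + x)"
  proof -
    have Ax: "A + x \<le> A * (1 + x)" using mult_right_mono[of 1 A x] A_ge x by (simp add: distrib_left)
    have "cap h (A + x) \<le> 4 * h * (A * (1 + x))"
      using cap_bounds(3)[OF h, of "A + x"] A_ge x mult_left_mono[OF Ax, of "4 * h"] h by linarith
    moreover have "K * fl x \<le> K * (A * (1 + x))"
    proof (rule mult_left_mono[OF _ K])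
      have "(1 + x) powr (1 - \<beta>) \<le> (1 + x) powr 1" using beta x by (intro powr_mono) auto
      then have "A * (1 + x) powr (1 - \<beta>) \<le> A * (1 + x)" using A_ge x by (intro mult_left_mono) auto
      then show "fl x \<le> A * (1 + x)" using fl_le_powr[OF x] by linarith
    qed
    ultimately have "F x \<le> 4 * h * (A * (1 + x)) + K * (A * (1 + x))" by (simp add: F_def)
    also have "\<dots> = ?D * h * (1 + x)" by (simp add: K_def algebra_simps)
    finally show ?thesis .
  qed
  finally have "\<sigma>\<^sup>2 / 2 * (\<Sum>k<n. (Q ^^ k) I x) \<le> ?D * h * (1 + x)"
    unfolding Qn_cmult sum_distrib_left .
  then have "2 / \<sigma>\<^sup>2 * (\<sigma>\<^sup>2 / 2 * (\<Sum>k<n. (Q ^^ k) I x)) \<le> 2 / \<sigma>\<^sup>2 * (?D * h * (1 + x))"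
    by (rule mult_left_mono) simp
  then show "(\<Sum>k<n. (Q ^^ k) (\<lambda>y. indicator {..h} (A + y)) x) \<le> ?C * h * (1 + x)"
    using sigma unfolding I_def[abs_def] by (simp only: mult.assoc[symmetric]) simp
qed

lemma surv_decreasing: assumes "0 \<le> x" "k \<le> n" shows "surv n x \<le> surv k x"
  using assms(2)
proof (induction n rule: dec_induct)
  case (step n)
  have "surv (Suc n) x \<le> surv n x" unfolding surv_def Qn_Suc2
    by (rule Qn_mono[OF lin_growth_Q[OF lin_growth_const] lin_growth_const Q_const_le(1) assms(1)])
  then show ?case using step by linarith
qed simp

text \<open>By monotonicity n times \<open>surv n x\<close> is at most the expected lifetime up to
  n. Take h = sqrt n: the time spent with A + y \<le> h is of order h (1 + x) by
  \<open>occupation_near_zero\<close>, and by Markov's inequality with \<open>Qn_idp_bound\<close>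
  being alive above h has probability of order (1 + x) / h at each of the n times.\<close>

lemma surv_bound: "\<exists>C>0. \<forall>n x. 1 \<le> n \<longrightarrow> 0 \<le> x \<longrightarrow> surv n x \<le> C * ((1 + x) / sqrt (real n))"
proof -
  obtain C1 where C1: "C1 > 0" "\<And>h n x. 0 < h \<Longrightarrow> 0 \<le> x \<Longrightarrow> (\<Sum>k<n. (Q ^^ k) (\<lambda>y. indicator {..h} (A + y)) x) \<le> C1 * h * (1 + x)"
    using occupation_near_zero by blast
  obtain C2 where C2: "C2 > 0" "\<And>n x. 0 \<le> x \<Longrightarrow> (Q ^^ n) idp x \<le> C2 * (1 + x)"
    using Qn_idp_bound by blast
  show ?thesis
  proof (intro exI conjI allI impI)
    show "0 < C1 + A + C2" using C1 C2 A_ge by simp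
    fix n :: nat and x :: real assume n: "1 \<le> n" and x: "0 \<le> x"
    define h where "h = sqrt (real n)"
    have h: "0 < h" "h * h = real n" using n by (auto simp: h_def)
    define I where "I y = (indicator {..h} (A + y) :: real)" for y
    have lgI: "lin_growth I" unfolding I_def[abs_def] by (rule lin_growth_bounded[of _ 1]) (auto simp: indicator_def)
    define J where "J y = (1/h) * (A * 1 + idp y)" for y
    have lgJ: "lin_growth J" unfolding J_def[abs_def] by (intro lin_growth_cmult lin_growth_add lin_growth_const lin_growth_idp)
    have QJ: "(Q ^^ k) J x \<le> (A + C2) * (1 + x) / h" for k
    proof -
      have "(Q ^^ k) J x = 1/h * (A * surv k x + (Q ^^ k) idp x)"
        unfolding J_def[abs_def] Qn_cmult Qn_add[OF lin_growth_cmult[OF lin_growth_const] lin_growth_idp] surv_def by simp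
      also have "\<dots> \<le> 1/h * (A * (1 + x) + C2 * (1 + x))"
      proof -
        have "surv k x \<le> 1 + x" using surv_bounds(2)[OF x, of k] x by linarith
        then have "A * surv k x \<le> A * (1 + x)" using A_ge by (intro mult_left_mono) auto
        then have "A * surv k x + (Q ^^ k) idp x \<le> A * (1 + x) + C2 * (1 + x)"
          using C2(2)[OF x, of k] by (rule add_mono)
        then show ?thesis using h by (intro mult_left_mono) auto
      qed
      finally show ?thesis by (simp add: distrib_right)
    qed
    have "surv k x \<le> (Q ^^ k) I x + (A + C2) * (1 + x) / h" for k
    proof -
      have "surv k x \<le> (Q ^^ k) (\<lambda>y. I y + J y) x"
        unfolding surv_def
      proof (rule Qn_mono[OF lin_growth_const lin_growth_add[OF lgI lgJ] _ x])
        fix y :: real assume "0 \<le> y"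
        then show "1 \<le> I y + J y" using h A_ge by (auto simp: I_def J_def indicator_def field_simps)
      qed
      then show ?thesis using QJ[of k] by (simp add: Qn_add lgI lgJ)
    qed
    then have "(\<Sum>k<n. surv k x) \<le> (\<Sum>k<n. (Q ^^ k) I x + (A + C2) * (1 + x) / h)" by (intro sum_mono)
    also have "\<dots> \<le> C1 * h * (1 + x) + real n * ((A + C2) * (1 + x) / h)"
      using C1(2)[OF h(1) x, of n] unfolding I_def[abs_def] by (simp add: sum.distrib)
    also have "real n * ((A + C2) * (1 + x) / h) = (A + C2) * (1 + x) * h" using h by (simp flip: h(2))
    finally have s: "(\<Sum>k<n. surv k x) \<le> (C1 + A + C2) * (1 + x) * h" by (simp add: algebra_simps)
    have "real n * surv n x = (\<Sum>k<n. surv n x)" by simp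
    also have "\<dots> \<le> (\<Sum>k<n. surv k x)" by (intro sum_mono surv_decreasing x) auto
    also note s
    finally have le: "real n * surv n x \<le> h * ((C1 + A + C2) * (1 + x))" by (simp add: mult_ac)
    have "h * (h * surv n x) = real n * surv n x" unfolding h(2)[symmetric] by simp
    from ord_eq_le_trans[OF this le] have "h * (h * surv n x) \<le> h * ((C1 + A + C2) * (1 + x))" .
    then have "h * surv n x \<le> (C1 + A + C2) * (1 + x)" by (rule mult_left_le_imp_le) (rule h)
    then show "surv n x \<le> (C1 + A + C2) * ((1 + x) / sqrt (real n))"
      using h by (simp add: field_simps flip: h_def)
  qed
qed

section \<open>Lindeberg replacement\<close>

text \<open>The order of the survival probability up to time n. Errors for nonnegative starting
  points are stated as \<open>theta n x\<close> times a power of n, and \<open>theta_le_VhL\<close>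
  converts them into the error of the theorem.\<close>

definition theta :: "nat \<Rightarrow> real \<Rightarrow> real" where "theta n x = min 1 ((1 + x) / sqrt (real n))"

lemma theta_pos: "1 \<le> n \<Longrightarrow> 0 \<le> x \<Longrightarrow> 0 < theta n x"
  by (simp add: theta_def)

text \<open>Expresses survival to an earlier time k through the order at the final time n. The
  \<open>k + 1\<close> includes time 0, and sqrt(k+1) \<le> sqrt 2 sqrt k accounts for the factor
  \<open>sqrt 2\<close> in the constant.\<close>

lemma surv_theta: "\<exists>C\<ge>1. \<forall>n k x. k < n \<longrightarrow> 0 \<le> x \<longrightarrow> surv k x \<le> C * theta n x * sqrt (real n / (real k + 1))"
proof -
  obtain C where C: "C > 0" "\<And>n x. 1 \<le> n \<Longrightarrow> 0 \<le> x \<Longrightarrow> surv n x \<le> C * ((1 + x) / sqrt (real n))"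
    using surv_bound by blast
  define D where "D = max 1 (C * sqrt 2)"
  have D: "1 \<le> D" "C * sqrt 2 \<le> D" by (auto simp: D_def)
  have "surv k x \<le> D * theta n x * sqrt (real n / (real k + 1))" if k: "k < n" and x: "0 \<le> x" for n k x
  proof -
    define q where "q = sqrt (real n / (real k + 1))"
    have q: "1 \<le> q" using k by (simp add: q_def)
    have n: "0 < sqrt (real n)" using k by simp
    have a: "surv k x \<le> D * q"
    proof -
      have "1 * 1 \<le> D * q" using D q by (intro mult_mono) auto
      then show ?thesis using surv_bounds(2)[OF x, of k] by linarith
    qed
    have b: "surv k x \<le> D * ((1 + x) / sqrt (real n)) * q"
    proof -
      have qq: "(1 + x) / sqrt (real n) * q = (1 + x) / sqrt (real k + 1)"
        using n by (simp add: q_def real_sqrt_divide)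
      have "surv k x \<le> D * ((1 + x) / sqrt (real k + 1))"
      proof (cases "k = 0")
        case True
        have "1 * 1 \<le> D * (1 + x)" using D x by (intro mult_mono) auto
        then show ?thesis using True by simp
      next
        case False
        have "sqrt (real k + 1) \<le> sqrt (2 * real k)" using False by (intro real_sqrt_le_mono) simp
        then have s: "sqrt (real k + 1) \<le> sqrt 2 * sqrt (real k)" by (simp add: real_sqrt_mult)
        have "surv k x \<le> C * ((1 + x) / sqrt (real k))" using False x by (intro C) auto
        also have "\<dots> = C * sqrt 2 * ((1 + x) / (sqrt 2 * sqrt (real k)))" by simp
        also have "\<dots> \<le> D * ((1 + x) / sqrt (real k + 1))"
          using s False x D C by (intro mult_mono divide_left_mono) auto
        finally show ?thesis .
      qed
      then show ?thesis using qq by (simp only: mult.assoc)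
    qed
    show ?thesis using a b unfolding theta_def q_def[symmetric] by (simp add: min_def)
  qed
  then show ?thesis using D(1) by blast
qed

text \<open>Cut the concave power at level s = sqrt n: above it z^(1-\<beta>) is at most
  s^(-\<beta>) z, controlled by \<open>Qn_idp_bound\<close>; below it is at most s^(1-\<beta>),
  which is multiplied by the survival probability.\<close>

lemma Qn_fl_bound: "\<exists>C>0. \<forall>n x. 1 \<le> n \<longrightarrow> 0 \<le> x \<longrightarrow> (Q ^^ n) fl x \<le> C * (1 + x) * sqrt (real n) powr (-\<beta>)"
proof -
  obtain C1 where C1: "C1 > 0" "\<And>n x. 1 \<le> n \<Longrightarrow> 0 \<le> x \<Longrightarrow> surv n x \<le> C1 * ((1 + x) / sqrt (real n))"
    using surv_bound by blast
  obtain C2 where C2: "C2 > 0" "\<And>n x. 0 \<le> x \<Longrightarrow> (Q ^^ n) idp x \<le> C2 * (1 + x)"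
    using Qn_idp_bound by blast
  show ?thesis
  proof (intro exI conjI allI impI)
    show "0 < A + C2 + C1" using C1 C2 A_ge by simp
    fix n :: nat and x :: real assume n: "1 \<le> n" and x: "0 \<le> x"
    define s where "s = sqrt (real n)"
    have s: "1 \<le> s" using n by (simp add: s_def)
    define F where "F y = s powr (-\<beta>) * (A * 1 + idp y) + s powr (1 - \<beta>) * 1" for y
    have lg: "lin_growth (\<lambda>y. A * 1 + idp y)" by (intro lin_growth_add lin_growth_cmult lin_growth_const lin_growth_idp)
    have lgF: "lin_growth F" unfolding F_def[abs_def] by (intro lin_growth_add lin_growth_cmult lg lin_growth_const)
    have "(Q ^^ n) fl x \<le> (Q ^^ n) F x"
    proof (rule Qn_mono[OF lin_growth_fl lgF _ x])
      fix y :: real assume y: "0 \<le> y"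
      define z where "z = A + y"
      have z: "0 < z" using y A_ge by (simp add: z_def)
      have "z powr (1 - \<beta>) \<le> s powr (-\<beta>) * z + s powr (1 - \<beta>)"
      proof (cases "s \<le> z")
        case True
        have "z powr (1 - \<beta>) = z powr (-\<beta>) * z" using z powr_add[of z "-\<beta>" 1] by simp
        also have "\<dots> \<le> s powr (-\<beta>) * z" using True s z beta by (intro mult_right_mono powr_mono2') auto
        finally show ?thesis by (simp add: add_increasing2)
      next
        case False
        then have "z powr (1 - \<beta>) \<le> s powr (1 - \<beta>)" using z beta by (intro powr_mono2) auto
        then show ?thesis using z by (simp add: add_increasing)
      qed
      then show "fl y \<le> F y" using y z by (simp add: fl_def F_def z_def)
    qed
    also have "(Q ^^ n) F x = s powr (-\<beta>) * (A * surv n x + (Q ^^ n) idp x) + s powr (1 - \<beta>) * surv n x"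
      unfolding F_def[abs_def] Qn_add[OF lin_growth_cmult[OF lg] lin_growth_cmult[OF lin_growth_const]]
        Qn_cmult Qn_add[OF lin_growth_cmult[OF lin_growth_const] lin_growth_idp] surv_def by simp
    also have "\<dots> \<le> s powr (-\<beta>) * (A * (1 + x) + C2 * (1 + x)) + s powr (1 - \<beta>) * (C1 * ((1 + x) / s))"
    proof (rule add_mono)
      have "surv n x \<le> 1 + x" using surv_bounds(2)[OF x, of n] x by linarith
      then have "A * surv n x \<le> A * (1 + x)" using A_ge by (intro mult_left_mono) auto
      then have "A * surv n x + (Q ^^ n) idp x \<le> A * (1 + x) + C2 * (1 + x)"
        using C2(2)[OF x, of n] by (rule add_mono)
      then show "s powr (-\<beta>) * (A * surv n x + (Q ^^ n) idp x) \<le> s powr (-\<beta>) * (A * (1 + x) + C2 * (1 + x))"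
        by (intro mult_left_mono) auto
      show "s powr (1 - \<beta>) * surv n x \<le> s powr (1 - \<beta>) * (C1 * ((1 + x) / s))"
        using C1(2)[OF n x] unfolding s_def by (intro mult_left_mono) auto
    qed
    also have "s powr (1 - \<beta>) = s powr (-\<beta>) * s" using s powr_add[of s "-\<beta>" 1] by simp
    also have "s powr (-\<beta>) * (A * (1 + x) + C2 * (1 + x)) + s powr (-\<beta>) * s * (C1 * ((1 + x) / s))
       = (A + C2 + C1) * (1 + x) * s powr (-\<beta>)" using s by (simp add: field_simps)
    finally show "(Q ^^ n) fl x \<le> (A + C2 + C1) * (1 + x) * sqrt (real n) powr (-\<beta>)" unfolding s_def .
  qed
qed

text \<open>Seen from time j, the remaining occupation is at most \<open>fl / c1\<close> at the
  current position, and \<open>Qn_fl_bound\<close> gives the decay of its killed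
  expectation.\<close>

lemma occ_tail: "\<exists>C>0. \<forall>j n x. 1 \<le> j \<longrightarrow> 0 \<le> x \<longrightarrow> (\<Sum>k<n. (Q ^^ (j + k)) rr x) \<le> C * (1 + x) * sqrt (real j) powr (-\<beta>)"
proof -
  obtain C where C: "C > 0" "\<And>n x. 1 \<le> n \<Longrightarrow> 0 \<le> x \<Longrightarrow> (Q ^^ n) fl x \<le> C * (1 + x) * sqrt (real n) powr (-\<beta>)"
    using Qn_fl_bound by blast
  show ?thesis
  proof (intro exI conjI allI impI)
    show "0 < 1 / c1 * C" using C c1_pos by simp
    fix j n :: nat and x :: real assume j: "1 \<le> j" and x: "0 \<le> x"
    have "(\<Sum>k<n. (Q ^^ (j + k)) rr x) = (Q ^^ j) (occ n) x"
      unfolding occ_def[abs_def] by (subst Qn_sum) (auto simp: Qn_add_comp lin_growth_Qn lin_growth_rr)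
    also have "\<dots> \<le> (Q ^^ j) (\<lambda>y. 1 / c1 * fl y) x"
      by (rule Qn_mono[OF lin_growth_occ lin_growth_cmult[OF lin_growth_fl] _ x]) (use occ_le_fl in simp)
    also have "\<dots> = 1 / c1 * (Q ^^ j) fl x" unfolding Qn_cmult ..
    also have "\<dots> \<le> 1 / c1 * (C * (1 + x) * sqrt (real j) powr (-\<beta>))"
      using C(2)[OF j x] c1_pos by (intro mult_left_mono) auto
    finally show "(\<Sum>k<n. (Q ^^ (j + k)) rr x) \<le> 1 / c1 * C * (1 + x) * sqrt (real j) powr (-\<beta>)"
      by (simp add: mult.assoc)
  qed
qed

section \<open>Replacement of one step, and concentration of the killed walk\<close>

lemma lin_growth_Ph: "lin_growth (Ph t)"
  by (rule lin_growth_bounded[of _ 1]) (use Ph_bounds in auto)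

definition Cl :: real where "Cl = 8 * Mb + 2 * \<sigma>^4 * (\<sigma>\<^sup>2) powr (-1 + \<beta>/2)"

lemma Cl_nonneg: "0 \<le> Cl" using Mb_nonneg by (simp add: Cl_def)

text \<open>Both terms are compared with the mean of the quadratic Taylor polynomial
  \<open>P\<close>, which sees only the variance and by the heat equation is also the first-order
  time expansion of the flow. The space remainder has the stated order; the time remainder is of
  order t^(-2), and t \<ge> \<open>\<sigma>\<^sup>2\<close> reduces it to that order.\<close>

lemma lindeberg_step:
  assumes "\<sigma>\<^sup>2 \<le> t"
  shows "\<bar>(\<integral>\<xi>. Ph t (y + \<xi>) \<partial>\<mu>) - Ph (t + \<sigma>\<^sup>2) y\<bar> \<le> Cl * t powr (-1 - \<beta>/2)"
proof -
  have t: "0 < t" using assms sigma by (smt (verit) zero_less_power)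
  define z where "z = y / sqrt t"
  define P where "P \<xi> = Ncdf z + nd z * (\<xi> / sqrt t) + (- z * nd z) * (\<xi> / sqrt t)\<^sup>2 / 2" for \<xi>
  have ib: "integrable \<mu> (\<lambda>\<xi>. \<bar>\<xi>\<bar> powr (2 + \<beta>))" using beta by (intro int_powr) auto
  have iP: "integrable \<mu> P" unfolding P_def[abs_def]
    using int_id int_sq by (simp add: power_divide)
  have EP: "(\<integral>\<xi>. P \<xi> \<partial>\<mu>) = Ncdf z + (- z * nd z) * (\<sigma>\<^sup>2 / t) / 2"
    unfolding P_def using int_id int_sq prob_space t by (simp add: power_divide mean0 var)
  have iF: "integrable \<mu> (\<lambda>\<xi>. Ph t (y + \<xi>))" by (rule int_lin_growth[OF lin_growth_Ph])
  have pt: "\<bar>Ph t (y + \<xi>) - P \<xi>\<bar> \<le> 8 * t powr (-1 - \<beta>/2) * \<bar>\<xi>\<bar> powr (2 + \<beta>)" for \<xi>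
  proof -
    have "\<bar>Ncdf (z + \<xi> / sqrt t) - Ncdf z - nd z * (\<xi> / sqrt t) - (- z * nd z) * (\<xi> / sqrt t)^2 / 2\<bar> \<le> 8 * \<bar>\<xi> / sqrt t\<bar> powr (2 + \<beta>)"
      using beta by (intro Ncdf_taylor) auto
    moreover have "Ph t (y + \<xi>) = Ncdf (z + \<xi> / sqrt t)" by (simp add: Ph_def z_def add_divide_distrib)
    moreover have "\<bar>\<xi> / sqrt t\<bar> powr (2 + \<beta>) = t powr (-1 - \<beta>/2) * \<bar>\<xi>\<bar> powr (2 + \<beta>)"
    proof -
      have "\<bar>\<xi> / sqrt t\<bar> powr (2 + \<beta>) = \<bar>\<xi>\<bar> powr (2 + \<beta>) / (t powr (1/2)) powr (2 + \<beta>)"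
        using t by (simp add: abs_divide powr_divide powr_half_sqrt)
      also have "(t powr (1/2)) powr (2 + \<beta>) = t powr (1 + \<beta>/2)" by (simp add: powr_powr field_simps)
      also have "\<bar>\<xi>\<bar> powr (2 + \<beta>) / t powr (1 + \<beta>/2) = t powr (- (1 + \<beta>/2)) * \<bar>\<xi>\<bar> powr (2 + \<beta>)"
        by (subst powr_minus_divide) simp
      finally show ?thesis by (simp add: add.commute)
    qed
    ultimately show ?thesis by (simp add: P_def diff_diff_eq mult.assoc)
  qed
  have "\<bar>(\<integral>\<xi>. Ph t (y + \<xi>) \<partial>\<mu>) - (\<integral>\<xi>. P \<xi> \<partial>\<mu>)\<bar> = \<bar>\<integral>\<xi>. Ph t (y + \<xi>) - P \<xi> \<partial>\<mu>\<bar>"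
    using iF iP by simp
  also have "\<dots> \<le> (\<integral>\<xi>. \<bar>Ph t (y + \<xi>) - P \<xi>\<bar> \<partial>\<mu>)" by (rule integral_abs_bound)
  also have "\<dots> \<le> (\<integral>\<xi>. 8 * t powr (-1 - \<beta>/2) * \<bar>\<xi>\<bar> powr (2 + \<beta>) \<partial>\<mu>)"
    using iF iP ib pt by (intro integral_mono) auto
  also have "\<dots> = 8 * Mb * t powr (-1 - \<beta>/2)" using ib by (simp add: Mb_def)
  finally have 1: "\<bar>(\<integral>\<xi>. Ph t (y + \<xi>) \<partial>\<mu>) - (\<integral>\<xi>. P \<xi> \<partial>\<mu>)\<bar> \<le> 8 * Mb * t powr (-1 - \<beta>/2)" .
  have "\<bar>Ph (t + \<sigma>\<^sup>2) y - Ph t y - \<sigma>\<^sup>2 * (- (y / sqrt t) * nd (y / sqrt t) / (2 * t))\<bar> \<le> 2 * (\<sigma>\<^sup>2)\<^sup>2 / t\<^sup>2"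
    using t by (intro Ph_time2) auto
  moreover have "Ph t y + \<sigma>\<^sup>2 * (- (y / sqrt t) * nd (y / sqrt t) / (2 * t)) = (\<integral>\<xi>. P \<xi> \<partial>\<mu>)"
    unfolding EP by (simp add: Ph_def z_def mult_ac)
  ultimately have 2: "\<bar>Ph (t + \<sigma>\<^sup>2) y - (\<integral>\<xi>. P \<xi> \<partial>\<mu>)\<bar> \<le> 2 * (\<sigma>\<^sup>2)\<^sup>2 / t\<^sup>2"
    by (simp add: algebra_simps)
  have "2 * (\<sigma>\<^sup>2)\<^sup>2 / t\<^sup>2 = 2 * \<sigma>^4 * (t powr (-1 - \<beta>/2) * t powr (-1 + \<beta>/2))"
    using t by (subst powr_add[symmetric]) (simp add: powr_minus_divide powr_numeral flip: power_mult)
  also have "\<dots> \<le> 2 * \<sigma>^4 * (t powr (-1 - \<beta>/2) * (\<sigma>\<^sup>2) powr (-1 + \<beta>/2))"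
    using assms sigma beta by (intro mult_left_mono powr_mono2') auto
  finally have "2 * (\<sigma>\<^sup>2)\<^sup>2 / t\<^sup>2 \<le> 2 * \<sigma>^4 * (\<sigma>\<^sup>2) powr (-1 + \<beta>/2) * t powr (-1 - \<beta>/2)" by (simp add: mult_ac)
  moreover have "Cl * t powr (-1 - \<beta>/2) = 8 * Mb * t powr (-1 - \<beta>/2) + 2 * \<sigma>^4 * (\<sigma>\<^sup>2) powr (-1 + \<beta>/2) * t powr (-1 - \<beta>/2)"
    unfolding Cl_def by (rule distrib_right)
  ultimately show ?thesis using 1 2 by linarith
qed

lemma lindeberg_w:
  assumes "\<sigma>\<^sup>2 \<le> t"
  shows "\<bar>(\<integral>\<xi>. w U t (y + \<xi>) \<partial>\<mu>) - w U (t + \<sigma>\<^sup>2) y\<bar> \<le> 4 * (Cl * t powr (-1 - \<beta>/2))"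
proof -
  have i: "integrable \<mu> (\<lambda>\<xi>. Ph t (y + c + \<xi>))" for c by (rule int_lin_growth[OF lin_growth_Ph])
  have "(\<integral>\<xi>. w U t (y + \<xi>) \<partial>\<mu>) = (\<integral>\<xi>. 2 * Ph t (y + 0 + \<xi>) - Ph t (y + (-U) + \<xi>) - Ph t (y + U + \<xi>) \<partial>\<mu>)"
    unfolding w_def by (simp add: algebra_simps)
  also have "\<dots> = 2 * (\<integral>\<xi>. Ph t (y + 0 + \<xi>) \<partial>\<mu>) - (\<integral>\<xi>. Ph t (y + (-U) + \<xi>) \<partial>\<mu>) - (\<integral>\<xi>. Ph t (y + U + \<xi>) \<partial>\<mu>)"
    using i[of 0] i[of "-U"] i[of U] by simp
  finally have e: "(\<integral>\<xi>. w U t (y + \<xi>) \<partial>\<mu>) - w U (t + \<sigma>\<^sup>2) y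
    = 2 * ((\<integral>\<xi>. Ph t (y + 0 + \<xi>) \<partial>\<mu>) - Ph (t + \<sigma>\<^sup>2) (y + 0))
      - ((\<integral>\<xi>. Ph t (y + (-U) + \<xi>) \<partial>\<mu>) - Ph (t + \<sigma>\<^sup>2) (y + (-U)))
      - ((\<integral>\<xi>. Ph t (y + U + \<xi>) \<partial>\<mu>) - Ph (t + \<sigma>\<^sup>2) (y + U))"
    by (simp add: w_def algebra_simps)
  show ?thesis unfolding e by (intro abs_second_diff_le lindeberg_step assms)
qed

lemma lin_growth_bw: "lin_growth (\<lambda>y. bw s t (y - a))"
proof (rule lin_growth_bounded[of _ 1])
  show "\<bar>bw s t (y - a)\<bar> \<le> 1" for y
    using Ph_bounds[of t "y - a + s"] Ph_bounds[of t "y - a - s"] unfolding bw_def by linarith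
qed measurable

lemma Q_bw:
  assumes "\<sigma>\<^sup>2 \<le> t" "0 \<le> s"
  shows "Q (\<lambda>y. bw s t (y - a)) y \<le> bw s (t + \<sigma>\<^sup>2) (y - a) + 2 * Cl * t powr (-1 - \<beta>/2)"
proof -
  have t: "0 < t" using assms sigma by (smt (verit) zero_less_power)
  have i: "integrable \<mu> (\<lambda>\<xi>. Ph t (c + \<xi>))" for c by (rule int_lin_growth[OF lin_growth_Ph])
  have "Q (\<lambda>y. bw s t (y - a)) y \<le> (\<integral>\<xi>. bw s t (y + \<xi> - a) \<partial>\<mu>)"
    using t assms by (intro Q_le_int lin_growth_bw bw_nonneg) auto
  also have "\<dots> = (\<integral>\<xi>. Ph t (y - a + s + \<xi>) - Ph t (y - a - s + \<xi>) \<partial>\<mu>)"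
    unfolding bw_def by (simp add: algebra_simps)
  also have "\<dots> = (\<integral>\<xi>. Ph t (y - a + s + \<xi>) \<partial>\<mu>) - (\<integral>\<xi>. Ph t (y - a - s + \<xi>) \<partial>\<mu>)"
    using i by simp
  also have "\<dots> \<le> bw s (t + \<sigma>\<^sup>2) (y - a) + 2 * (Cl * t powr (-1 - \<beta>/2))"
    using lindeberg_step[OF assms(1), of "y - a + s"] lindeberg_step[OF assms(1), of "y - a - s"]
    unfolding bw_def by linarith
  finally show ?thesis by simp
qed

lemma Qn_bw:
  assumes "\<sigma>\<^sup>2 \<le> t" "0 \<le> s" "0 \<le> x"
  shows "(Q ^^ k) (\<lambda>y. bw s t (y - a)) x \<le> bw s (t + real k * \<sigma>\<^sup>2) (x - a) + (\<Sum>j<k. 2 * Cl * (t + real j * \<sigma>\<^sup>2) powr (-1 - \<beta>/2))"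
  using assms(1)
proof (induction k arbitrary: t)
  case (Suc k)
  let ?e = "2 * Cl * t powr (-1 - \<beta>/2)"
  have e: "0 \<le> ?e" using Cl_nonneg by simp
  have "(Q ^^ Suc k) (\<lambda>y. bw s t (y - a)) x \<le> (Q ^^ k) (\<lambda>y. bw s (t + \<sigma>\<^sup>2) (y - a) + ?e * 1) x"
    unfolding Qn_Suc2
    by (rule Qn_mono[OF lin_growth_Q[OF lin_growth_bw] lin_growth_add[OF lin_growth_bw lin_growth_const] _ assms(3)])
      (use Q_bw[OF Suc.prems assms(2)] in simp)
  also have "\<dots> = (Q ^^ k) (\<lambda>y. bw s (t + \<sigma>\<^sup>2) (y - a)) x + ?e * surv k x"
    unfolding Qn_add[OF lin_growth_bw lin_growth_const] Qn_cmult surv_def by simp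
  also have "\<dots> \<le> (bw s (t + \<sigma>\<^sup>2 + real k * \<sigma>\<^sup>2) (x - a) + (\<Sum>j<k. 2 * Cl * (t + \<sigma>\<^sup>2 + real j * \<sigma>\<^sup>2) powr (-1 - \<beta>/2))) + ?e * 1"
  proof (intro add_mono mult_left_mono)
    have "\<sigma>\<^sup>2 \<le> t + \<sigma>\<^sup>2" using Suc.prems zero_le_power2[of \<sigma>] by linarith
    then show "(Q ^^ k) (\<lambda>y. bw s (t + \<sigma>\<^sup>2) (y - a)) x
      \<le> bw s (t + \<sigma>\<^sup>2 + real k * \<sigma>\<^sup>2) (x - a) + (\<Sum>j<k. 2 * Cl * (t + \<sigma>\<^sup>2 + real j * \<sigma>\<^sup>2) powr (-1 - \<beta>/2))"
      by (rule Suc.IH)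
  qed (use surv_bounds(2)[OF assms(3), of k] e in auto)
  finally show ?case unfolding sum.lessThan_Suc_shift by (simp add: algebra_simps)
qed simp

text \<open>The variance left when \<open>j\<close> steps remain, including the mollification at time scale \<open>sqrt n\<close>.\<close>

definition tm :: "nat \<Rightarrow> nat \<Rightarrow> real" where "tm n j = \<sigma>\<^sup>2 * (real j + sqrt (real n))"

lemma sum_tm: "\<exists>C>0. \<forall>n k. 1 \<le> n \<longrightarrow> (\<Sum>j<k. tm n j powr (-1 - \<beta>/2)) \<le> C * sqrt (real n) powr (-(\<beta>/2))"
proof (intro exI conjI allI impI)
  show "0 < (\<sigma>\<^sup>2) powr (-1 - \<beta>/2) * (4 / (\<beta>/2))" using sigma beta by simp
  fix n k :: nat assume n: "1 \<le> n"
  have "(\<Sum>j<k. tm n j powr (-1 - \<beta>/2)) = (\<sigma>\<^sup>2) powr (-1 - \<beta>/2) * (\<Sum>j<k. (real j + sqrt (real n)) powr (-1 - \<beta>/2))"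
    unfolding tm_def sum_distrib_left by (intro sum.cong refl powr_mult)
  also have "\<dots> \<le> (\<sigma>\<^sup>2) powr (-1 - \<beta>/2) * (4 / (\<beta>/2) * sqrt (real n) powr (-(\<beta>/2)))"
    using beta n by (intro mult_left_mono sum_powr_tail) auto
  finally show "(\<Sum>j<k. tm n j powr (-1 - \<beta>/2)) \<le> (\<sigma>\<^sup>2) powr (-1 - \<beta>/2) * (4 / (\<beta>/2)) * sqrt (real n) powr (-(\<beta>/2))"
    by (simp add: mult.assoc)
qed

lemma tm_ge: "1 \<le> n \<Longrightarrow> \<sigma>\<^sup>2 \<le> tm n j"
  using mult_left_mono[of 1 "real j + sqrt (real n)" "\<sigma>\<^sup>2"] by (simp add: tm_def add_increasing)

text \<open>After a time proportional to n the Gaussian mass of a window of width n^(1/4) is of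
  order n^(-1/4), uniformly in its centre \<open>a\<close>; the accumulated replacement errors are
  of order \<open>sqrt n powr (- (\<beta> / 2))\<close> and dominate. No decay from survival is
  claimed yet.\<close>

lemma concentration: "\<exists>C>0. \<forall>n k a x. 1 \<le> n \<longrightarrow> n \<le> 2 * k \<longrightarrow> 0 \<le> x \<longrightarrow>
   (Q ^^ k) (\<lambda>y. bw (sqrt (tm n 0)) (tm n 0) (y - a)) x \<le> C * sqrt (real n) powr (-(\<beta>/2))"
proof -
  obtain C where C: "C > 0" "\<And>n k. 1 \<le> n \<Longrightarrow> (\<Sum>j<k. tm n j powr (-1 - \<beta>/2)) \<le> C * sqrt (real n) powr (-(\<beta>/2))"
    using sum_tm by blast
  show ?thesis
  proof (intro exI conjI allI impI)
    show "0 < 4 + 2 * Cl * C" using C Cl_nonneg by (simp add: add_pos_nonneg)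
    fix n k :: nat and a x :: real assume n: "1 \<le> n" and k: "n \<le> 2 * k" and x: "0 \<le> x"
    define m where "m = sqrt (real n)"
    have m: "1 \<le> m" "m * m = real n" using n by (auto simp: m_def)
    let ?t = "tm n 0"
    have t: "0 < ?t" using tm_ge[OF n, of 0] sigma by (smt (verit) zero_less_power)
    have tk: "?t + real j * \<sigma>\<^sup>2 = tm n j" for j by (simp add: tm_def algebra_simps)
    have "(Q ^^ k) (\<lambda>y. bw (sqrt ?t) ?t (y - a)) x \<le> bw (sqrt ?t) (tm n k) (x - a) + (\<Sum>j<k. 2 * Cl * tm n j powr (-1 - \<beta>/2))"
      using Qn_bw[OF tm_ge[OF n, of 0] _ x, of "sqrt ?t" k a] t unfolding tk by simp
    also have "bw (sqrt ?t) (tm n k) (x - a) \<le> 2 * sqrt ?t / sqrt (tm n k)"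
      using t tm_ge[OF n, of k] sigma by (intro bw_bound) (auto simp: tm_def intro!: mult_pos_pos add_nonneg_pos m)
    also have "2 * sqrt ?t / sqrt (tm n k) \<le> 4 * m powr (-1/2)"
    proof -
      have "sqrt ?t / sqrt (tm n k) = sqrt (m / (real k + m))"
        using sigma by (simp add: tm_def m_def real_sqrt_mult flip: real_sqrt_divide)
      also have "\<dots> \<le> sqrt (4 / m)"
      proof (rule real_sqrt_le_mono)
        have "real n \<le> real (2 * k)" using k by (simp only: of_nat_le_iff)
        then have "m * m \<le> 4 * (real k + m)" unfolding m(2) using m(1) by simp
        then show "m / (real k + m) \<le> 4 / m" using m by (simp add: divide_le_eq pos_le_divide_eq)
      qed
      also have "\<dots> = 2 * m powr (-1/2)" using m by (simp add: real_sqrt_divide powr_minus_divide powr_half_sqrt)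
      finally show ?thesis by simp
    qed
    also have "4 * m powr (-1/2) \<le> 4 * m powr (-(\<beta>/2))" using m beta by (intro mult_left_mono powr_mono) auto
    also have "(\<Sum>j<k. 2 * Cl * tm n j powr (-1 - \<beta>/2)) \<le> 2 * Cl * (C * m powr (-(\<beta>/2)))"
      unfolding sum_distrib_left[symmetric] m_def using C(2)[OF n] Cl_nonneg by (intro mult_left_mono) auto
    finally show "(Q ^^ k) (\<lambda>y. bw (sqrt ?t) ?t (y - a)) x \<le> (4 + 2 * Cl * C) * sqrt (real n) powr (-(\<beta>/2))"
      by (simp add: m_def algebra_simps)
  qed
qed

text \<open>Splits the time in halves: survival through the first supplies \<open>theta\<close>, and
  \<open>concentration\<close>, being uniform in the position at mid-time, supplies the power of
  n.\<close>

lemma Qn_bell: "\<exists>C>0. \<forall>n a x. 1 \<le> n \<longrightarrow> 0 \<le> x \<longrightarrow>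
   (Q ^^ n) (\<lambda>y. bw (sqrt (tm n 0)) (tm n 0) (y - a)) x \<le> C * theta n x * sqrt (real n) powr (-(\<beta>/2))"
proof -
  obtain C where C: "C > 0" "\<And>n k a x. 1 \<le> n \<Longrightarrow> n \<le> 2 * k \<Longrightarrow> 0 \<le> x \<Longrightarrow>
     (Q ^^ k) (\<lambda>y. bw (sqrt (tm n 0)) (tm n 0) (y - a)) x \<le> C * sqrt (real n) powr (-(\<beta>/2))"
    using concentration by blast
  obtain D where D: "D \<ge> 1" "\<And>n k x. k < n \<Longrightarrow> 0 \<le> x \<Longrightarrow> surv k x \<le> D * theta n x * sqrt (real n / (real k + 1))"
    using surv_theta by blast
  show ?thesis
  proof (intro exI conjI allI impI)
    show "0 < C * (D * sqrt 2)" using C D by simp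
    fix n :: nat and a x :: real assume n: "1 \<le> n" and x: "0 \<le> x"
    define i k where "i = n div 2" and "k = n - n div 2"
    have ik: "n = i + k" "n \<le> 2 * k" "i < n" "n \<le> 2 * (i + 1)" using n by (auto simp: i_def k_def)
    let ?b = "\<lambda>y. bw (sqrt (tm n 0)) (tm n 0) (y - a)"
    let ?m = "sqrt (real n) powr (-(\<beta>/2))"
    have "(Q ^^ n) ?b x = (Q ^^ i) ((Q ^^ k) ?b) x" by (subst ik(1)) (simp only: Qn_add_comp)
    also have "\<dots> \<le> C * ?m * surv i x"
      by (rule Qn_le_surv[OF lin_growth_Qn[OF lin_growth_bw] _ x]) (rule C(2)[OF n ik(2)])
    also have "\<dots> \<le> C * ?m * (D * theta n x * sqrt 2)"
    proof (rule mult_left_mono)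
      have "real n \<le> real (2 * (i + 1))" using ik(4) by (simp only: of_nat_le_iff)
      then have "real n \<le> 2 * (real i + 1)" by simp
      then have "sqrt (real n / (real i + 1)) \<le> sqrt 2" by (intro real_sqrt_le_mono) (simp add: divide_le_eq)
      then have "D * theta n x * sqrt (real n / (real i + 1)) \<le> D * theta n x * sqrt 2"
        using D theta_pos[OF n x] by (intro mult_left_mono) auto
      then show "surv i x \<le> D * theta n x * sqrt 2" using D(2)[OF ik(3) x] by linarith
    qed (use C in auto)
    finally show "(Q ^^ n) ?b x \<le> C * (D * sqrt 2) * theta n x * ?m" by (simp add: mult_ac)
  qed
qed

end

section \<open>Nonnegative starting points\<close>

lemma sum_if_shift:
  fixes f :: "nat \<Rightarrow> real"
  assumes "\<And>k. 0 \<le> f k"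
  shows "(\<Sum>k<N. if j \<le> k then f k else 0) \<le> (\<Sum>k<N. f (j + k))"
proof -
  have "(\<Sum>k<j + N. if j \<le> k then f k else 0) = (\<Sum>k<N. f (j + k))"
  proof (induction N)
    case 0
    show ?case by (auto intro: sum.neutral)
  qed simp
  moreover have "(\<Sum>k<N. if j \<le> k then f k else 0) \<le> (\<Sum>k<j + N. if j \<le> k then f k else 0)"
    using assms by (intro sum_mono2) auto
  ultimately show ?thesis by simp
qed

context centred_law
begin

lemma lin_growth_w: "lin_growth (w U t)"
  by (rule lin_growth_bounded[of _ 2]) (use w_bound in auto)

text \<open>The correction for exits in one step: since \<open>w\<close> is odd, it is what has to
  be added to the free expectation of \<open>w\<close> to obtain the killed one, see
  \<open>Q_w\<close>.\<close>

definition Gt :: "real \<Rightarrow> real \<Rightarrow> real \<Rightarrow> real" where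
  "Gt U t y = (\<integral>\<xi>. w U t (overshoot y \<xi>) \<partial>\<mu>)"

lemma int_w_over: "integrable \<mu> (\<lambda>\<xi>. w U t (overshoot y \<xi>))"
  by (rule Bochner_Integration.integrable_bound[of _ "\<lambda>_. 2::real"]) (use w_bound in auto)

lemma lin_growth_Gt: "lin_growth (Gt U t)"
proof (rule lin_growth_bounded[of _ 2])
  show "Gt U t \<in> borel_measurable borel" unfolding Gt_def[abs_def] overshoot_def by measurable
  fix y
  have "\<bar>Gt U t y\<bar> \<le> (\<integral>\<xi>. \<bar>w U t (overshoot y \<xi>)\<bar> \<partial>\<mu>)" unfolding Gt_def by (rule integral_abs_bound)
  also have "\<dots> \<le> (\<integral>\<xi>. 2 \<partial>\<mu>)" using int_w_over w_bound by (intro integral_mono) auto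
  finally show "\<bar>Gt U t y\<bar> \<le> 2" using prob_space by simp
qed

lemma Q_w: "Q (w U t) y = (\<integral>\<xi>. w U t (y + \<xi>) \<partial>\<mu>) + Gt U t y"
proof -
  have "Q (w U t) y = (\<integral>\<xi>. w U t (y + \<xi>) + w U t (overshoot y \<xi>) \<partial>\<mu>)"
    unfolding Q_def
  proof (intro Bochner_Integration.integral_cong refl)
    fix \<xi>
    show "indicator {0..} (y + \<xi>) * w U t (y + \<xi>) = w U t (y + \<xi>) + w U t (overshoot y \<xi>)"
      using w_odd[of U t "y + \<xi>"] by (auto simp: overshoot_def indicator_def max_def w_0)
  qed
  then show ?thesis unfolding Gt_def
    using int_lin_growth[OF lin_growth_w] int_w_over by simp
qed

lemma tm_Suc: "tm n (Suc j) = tm n j + \<sigma>\<^sup>2" by (simp add: tm_def algebra_simps)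

lemma tm_pos: "1 \<le> n \<Longrightarrow> 0 < tm n j"
  using tm_ge[of n j] sigma by (smt (verit) zero_less_power)

text \<open>The steps are replaced from the last one backwards, each replacement advancing the
  variance of the flow by \<open>\<sigma>\<^sup>2\<close>. The offset \<open>s\<close> in the time
  index is the induction parameter.\<close>

lemma dynkin:
  assumes n: "1 \<le> n" and x: "0 \<le> x"
  shows "\<bar>(Q ^^ k) (w U (tm n s)) x - w U (tm n (s + k)) x - (\<Sum>i<k. (Q ^^ (k - Suc i)) (Gt U (tm n (s + i))) x)\<bar>
    \<le> (\<Sum>i<k. 4 * (Cl * tm n (s + i) powr (-1 - \<beta>/2)) * surv (k - Suc i) x)"
proof (induction k arbitrary: s)
  case (Suc k)
  let ?e = "4 * (Cl * tm n s powr (-1 - \<beta>/2))"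
  have lg: "lin_growth (\<lambda>y. Q (w U (tm n s)) y - w U (tm n (Suc s)) y - Gt U (tm n s) y)"
    by (intro lin_growth_diff lin_growth_Q lin_growth_w lin_growth_Gt)
  have "\<bar>(Q ^^ k) (\<lambda>y. Q (w U (tm n s)) y - w U (tm n (Suc s)) y - Gt U (tm n s) y) x\<bar> \<le> (Q ^^ k) (\<lambda>_. ?e * 1) x"
  proof (rule Qn_abs_le[OF lg lin_growth_const _ x])
    show "\<bar>Q (w U (tm n s)) y - w U (tm n (Suc s)) y - Gt U (tm n s) y\<bar> \<le> ?e * 1" for y
      unfolding Q_w tm_Suc using lindeberg_w[OF tm_ge[OF n], of U s y] by simp
  qed
  then have 1: "\<bar>(Q ^^ Suc k) (w U (tm n s)) x - (Q ^^ k) (w U (tm n (Suc s))) x - (Q ^^ k) (Gt U (tm n s)) x\<bar> \<le> ?e * surv k x"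
    unfolding Qn_Suc2 Qn_diff[OF lin_growth_diff[OF lin_growth_Q[OF lin_growth_w] lin_growth_w] lin_growth_Gt]
      Qn_diff[OF lin_growth_Q[OF lin_growth_w] lin_growth_w] Qn_cmult surv_def .
  show ?case using 1 Suc.IH[of "Suc s"] unfolding sum.lessThan_Suc_shift by simp
qed simp

lemma sqrt_tm: "1 \<le> n \<Longrightarrow> sqrt (tm n i) = \<sigma> * (real i + sqrt (real n)) powr (1/2)"
  using sigma by (simp add: tm_def real_sqrt_mult powr_half_sqrt)

text \<open>Each replacement error is incurred only if the walk is alive just before that step. This
  weight is what produces the factor \<open>theta\<close>; \<open>sum_conv_bound\<close> shows that
  the larger survival probability at early times does no harm.\<close>

lemma lindeberg_error_sum: "\<exists>C>0. \<forall>n x. 1 \<le> n \<longrightarrow> 0 \<le> x \<longrightarrow>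
  (\<Sum>i<n. 4 * (Cl * tm n i powr (-1 - \<beta>/2)) * surv (n - Suc i) x) \<le> C * theta n x * sqrt (real n) powr (-(\<beta>/2))"
proof -
  obtain D where D: "D \<ge> 1" "\<And>n k x. k < n \<Longrightarrow> 0 \<le> x \<Longrightarrow> surv k x \<le> D * theta n x * sqrt (real n / (real k + 1))"
    using surv_theta by blast
  let ?S = "(\<sigma>\<^sup>2) powr (-1 - \<beta>/2)"
  let ?K = "8 / (\<beta>/2) + 8"
  show ?thesis
  proof (intro exI conjI allI impI)
    \<comment> \<open>The summand 1 makes the constant positive although only
      \<open>Cl_nonneg\<close> is at hand.\<close>
    show "0 < 4 * Cl * ?S * D * ?K + 1" using Cl_nonneg D beta by (intro add_nonneg_pos mult_nonneg_nonneg) auto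
    fix n :: nat and x :: real assume n: "1 \<le> n" and x: "0 \<le> x"
    define m where "m = sqrt (real n)"
    have m: "1 \<le> m" using n by (simp add: m_def)
    have "m * 1 \<le> m * m" using m by (intro mult_left_mono) auto
    then have mn: "m \<le> real n" by (simp add: m_def)
    have th: "0 < theta n x" by (rule theta_pos[OF n x])
    define h where "h k = 4 * (Cl * tm n (n - Suc k) powr (-1 - \<beta>/2)) * surv k x" for k
    have "(\<Sum>i<n. 4 * (Cl * tm n i powr (-1 - \<beta>/2)) * surv (n - Suc i) x) = (\<Sum>i<n. h (n - Suc i))"
      by (intro sum.cong) (auto simp: h_def)
    also have "\<dots> = (\<Sum>k<n. h k)" by (rule sum.nat_diff_reindex)
    also have "\<dots> \<le> (\<Sum>k<n. (4 * Cl * ?S * (D * theta n x)) * ((real (n - Suc k) + m) powr (-1 - \<beta>/2) * sqrt (real n / (real k + 1))))"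
    proof (rule sum_mono)
      fix k assume "k \<in> {..<n}"
      then have k: "k < n" by simp
      have t: "tm n (n - Suc k) powr (-1 - \<beta>/2) = ?S * (real (n - Suc k) + m) powr (-1 - \<beta>/2)"
        unfolding tm_def m_def by (rule powr_mult)
      have "h k \<le> 4 * (Cl * tm n (n - Suc k) powr (-1 - \<beta>/2)) * (D * theta n x * sqrt (real n / (real k + 1)))"
        unfolding h_def using Cl_nonneg by (intro mult_left_mono D k x) auto
      then show "h k \<le> (4 * Cl * ?S * (D * theta n x)) * ((real (n - Suc k) + m) powr (-1 - \<beta>/2) * sqrt (real n / (real k + 1)))"
        unfolding t by (simp add: mult_ac)
    qed
    also have "\<dots> \<le> (4 * Cl * ?S * (D * theta n x)) * (?K * m powr (-(\<beta>/2)))"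
      unfolding sum_distrib_left[symmetric] using m mn beta Cl_nonneg D th
      by (intro mult_left_mono sum_conv_bound) auto
    also have "\<dots> = (4 * Cl * ?S * D * ?K) * (theta n x * m powr (-(\<beta>/2)))" by (simp add: mult_ac)
    also have "\<dots> \<le> (4 * Cl * ?S * D * ?K + 1) * (theta n x * m powr (-(\<beta>/2)))"
      using th by (intro mult_right_mono) auto
    finally show "(\<Sum>i<n. 4 * (Cl * tm n i powr (-1 - \<beta>/2)) * surv (n - Suc i) x)
       \<le> (4 * Cl * ?S * D * ?K + 1) * theta n x * sqrt (real n) powr (-(\<beta>/2))" by (simp add: m_def mult.assoc)
  qed
qed

text \<open>Here i is the number of steps left after the exit. Exits with fewer than i steps left
  presuppose survival to time n - i, which costs \<open>theta\<close>, and the occupation collected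
  from then on is at most of order \<open>sqrt i powr (1 - \<beta>)\<close> wherever the walk
  stands. Summation by parts turns these partial sums into the weighted sum.\<close>

lemma late_sum: "\<exists>C>0. \<forall>n x. 1 \<le> n \<longrightarrow> 0 \<le> x \<longrightarrow>
  (\<Sum>i<n - n div 2. (Q ^^ (n - Suc i)) rr x * (real i + sqrt (real n)) powr (-1/2)) \<le> C * theta n x * sqrt (real n) powr (-(\<beta>/2))"
proof -
  obtain D where D: "D \<ge> 1" "\<And>n k x. k < n \<Longrightarrow> 0 \<le> x \<Longrightarrow> surv k x \<le> D * theta n x * sqrt (real n / (real k + 1))"
    using surv_theta by blast
  obtain Ca where Ca: "Ca > 0" "\<And>n x. 0 \<le> x \<Longrightarrow> occ n x \<le> Ca * sqrt n powr (1 - \<beta>)"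
    using occ_bound by blast
  show ?thesis
  proof (intro exI conjI allI impI)
    show "0 < (1 + 8 / \<beta>) * (Ca * (D * sqrt 2))" using beta Ca D by (intro mult_pos_pos add_pos_pos) auto
    fix n :: nat and x :: real assume n: "1 \<le> n" and x: "0 \<le> x"
    define m where "m = sqrt (real n)"
    have m: "1 \<le> m" using n by (simp add: m_def)
    have th: "0 < theta n x" by (rule theta_pos[OF n x])
    let ?K = "Ca * (D * theta n x * sqrt 2)"
    have "(\<Sum>i<n - n div 2. (Q ^^ (n - Suc i)) rr x * (real i + m) powr (-1/2)) \<le> (1 + 8 / \<beta>) * ?K * m powr (- (\<beta> / 2))"
    proof (rule sum_by_parts_bound)
      fix i assume i: "i \<le> n - n div 2"
      show "(\<Sum>l<i. (Q ^^ (n - Suc l)) rr x) \<le> ?K * (real i + m) powr ((1 - \<beta>) / 2)"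
      proof (cases "i = 0")
        case False
        have "(\<Sum>l<i. (Q ^^ (n - Suc l)) rr x) = (\<Sum>l<i. (Q ^^ ((n - i) + (i - Suc l))) rr x)"
          using i by (intro sum.cong) auto
        also have "\<dots> = (\<Sum>l<i. (Q ^^ ((n - i) + l)) rr x)"
          by (rule sum.nat_diff_reindex[where g = "\<lambda>l. (Q ^^ ((n - i) + l)) rr x"])
        also have "\<dots> = (Q ^^ (n - i)) (occ i) x"
          unfolding occ_def[abs_def] by (subst Qn_sum) (auto simp: Qn_add_comp lin_growth_Qn lin_growth_rr)
        also have "\<dots> \<le> (Ca * sqrt i powr (1 - \<beta>)) * surv (n - i) x"
          by (rule Qn_le_surv[OF lin_growth_occ Ca(2) x])
        also have "\<dots> \<le> (Ca * (real i + m) powr ((1 - \<beta>) / 2)) * (D * theta n x * sqrt 2)"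
        proof (intro mult_mono mult_left_mono)
          have "sqrt i powr (1 - \<beta>) = real i powr ((1 - \<beta>) / 2)"
            by (simp add: powr_half_sqrt[symmetric] powr_powr)
          also have "\<dots> \<le> (real i + m) powr ((1 - \<beta>) / 2)" using m beta by (intro powr_mono2) auto
          finally show "sqrt i powr (1 - \<beta>) \<le> (real i + m) powr ((1 - \<beta>) / 2)" .
          have "n \<le> 2 * ((n - i) + 1)" "n - i < n" using i False n by auto
          then have r: "real n \<le> real (2 * ((n - i) + 1))" by (simp only: of_nat_le_iff)
          have "sqrt (real n / (real (n - i) + 1)) \<le> sqrt 2"
            using r by (intro real_sqrt_le_mono) (simp add: divide_le_eq del: of_nat_diff)
          then have "D * theta n x * sqrt (real n / (real (n - i) + 1)) \<le> D * theta n x * sqrt 2"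
            using D th by (intro mult_left_mono) auto
          then show "surv (n - i) x \<le> D * theta n x * sqrt 2"
            using D(2)[OF \<open>n - i < n\<close> x] by linarith
        qed (use Ca D th surv_bounds[OF x] in auto)
        finally show ?thesis by (simp add: mult_ac)
      qed (use Ca D th in simp)
    qed (use beta m Ca D th in auto)
    then show "(\<Sum>i<n - n div 2. (Q ^^ (n - Suc i)) rr x * (real i + sqrt (real n)) powr (-1/2))
      \<le> (1 + 8 / \<beta>) * (Ca * (D * sqrt 2)) * theta n x * sqrt (real n) powr (-(\<beta>/2))"
      by (simp add: m_def mult_ac)
  qed
qed

lemma theta_small: assumes "1 \<le> n" "0 \<le> x" "x \<le> sqrt (real n)" shows "(1 + x) / sqrt (real n) \<le> 2 * theta n x"
proof -
  have m: "1 \<le> sqrt (real n)" using assms by simp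
  have "(1 + x) / sqrt (real n) \<le> (2 * sqrt (real n)) / sqrt (real n)"
  proof (rule divide_right_mono)
    show "1 + x \<le> 2 * sqrt (real n)" using m assms(3) by linarith
  qed simp
  also have "\<dots> = 2" using assms by simp
  finally have "(1 + x) / sqrt (real n) \<le> 2" .
  moreover have "0 \<le> (1 + x) / sqrt (real n)" using assms by simp
  ultimately show ?thesis unfolding theta_def by (simp only: min_def split: if_split) linarith
qed

lemma theta_big: assumes "1 \<le> n" "sqrt (real n) \<le> x" shows "theta n x = 1"
  using assms by (simp add: theta_def)

text \<open>The bracket is the freezing error of \<open>Gt_fine\<close>. Its middle term grows with
  k, so the sum is cut at a time j close to m = sqrt n: before j that term is at most 1/m^2, and
  after j it is at most 1/m, but \<open>occ_tail\<close> then contributes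
  \<open>sqrt j powr (-\<beta>)\<close>, of order \<open>m powr (- (\<beta> / 2))\<close>.\<close>

lemma early_sum: "\<exists>C>0. \<forall>n x. 1 \<le> n \<longrightarrow> 0 \<le> x \<longrightarrow> x \<le> sqrt (real n) \<longrightarrow>
  (\<Sum>k<n div 2. (Q ^^ k) rr x * (sqrt (real n) powr (-1 - \<beta>/2) + (real k + 1) / sqrt (real n) ^ 3 + x / sqrt (real n) ^ 2))
   \<le> C * theta n x * sqrt (real n) powr (-(\<beta>/2))"
proof -
  obtain Ca where Ca: "Ca > 0" "\<And>n x. 0 \<le> x \<Longrightarrow> occ n x \<le> Ca * (1 + x) powr (1 - \<beta>)"
    using occ_bound by blast
  obtain Ct where Ct: "Ct > 0" "\<And>j n x. 1 \<le> j \<Longrightarrow> 0 \<le> x \<Longrightarrow> (\<Sum>k<n. (Q ^^ (j + k)) rr x) \<le> Ct * (1 + x) * sqrt (real j) powr (-\<beta>)"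
    using occ_tail by blast
  show ?thesis
  proof (intro exI conjI allI impI)
    show "0 < 2 * (4 * Ca + 2 * Ct)" using Ca Ct by simp
    fix n :: nat and x :: real assume n: "1 \<le> n" and x: "0 \<le> x" and xm: "x \<le> sqrt (real n)"
    define m where "m = sqrt (real n)"
    have m: "1 \<le> m" "m * m = real n" "x \<le> m" using n xm by (auto simp: m_def)
    define N where "N = n div 2"
    define j where "j = nat \<lfloor>m\<rfloor>"
    have j: "1 \<le> j" "real j \<le> m" "m \<le> 2 * real j"
    proof -
      show "1 \<le> j" using m by (simp add: j_def le_nat_floor)
      show "real j \<le> m" using m by (simp add: j_def)
      have "m < real j + 1" using m by (simp add: j_def)
      then show "m \<le> 2 * real j" using \<open>1 \<le> j\<close> by (smt (verit) of_nat_1 of_nat_mono)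
    qed
    let ?d = "\<lambda>k. (Q ^^ k) rr x"
    let ?e = "m powr (-(\<beta>/2))"
    have d: "0 \<le> ?d k" for k by (rule Qn_rr_nonneg[OF x])
    have w: "(real k + 1) / m ^ 3 \<le> 1 / m^2 + (if j \<le> k then 1 / m else 0)" if "k < N" for k
    proof (cases "j \<le> k")
      case True
      have "2 * k + 2 \<le> n + 1" using that by (auto simp: N_def)
      then have "real k + 1 \<le> real n" using that by (auto simp: N_def)
      then have "(real k + 1) / m ^ 3 \<le> (m * m) / m^3" unfolding m(2) using m(1) by (intro divide_right_mono) auto
      also have "\<dots> = 1 / m" using m(1) by (simp add: power3_eq_cube)
      finally show ?thesis using True by (simp add: add_increasing)
    next
      case False
      then have "real k + 1 \<le> m" using j by linarith
      then have "(real k + 1) / m ^ 3 \<le> m / m^3" using m(1) by (intro divide_right_mono) auto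
      also have "\<dots> = 1 / m^2" using m(1) by (simp add: power3_eq_cube power2_eq_square)
      finally show ?thesis using False by simp
    qed
    have "(\<Sum>k<N. ?d k * (m powr (-1 - \<beta>/2) + (real k + 1) / m ^ 3 + x / m ^ 2))
        \<le> (\<Sum>k<N. ?d k * (m powr (-1 - \<beta>/2) + 1 / m^2 + x / m^2) + (if j \<le> k then ?d k * (1 / m) else 0))"
    proof (rule sum_mono)
      fix k assume "k \<in> {..<N}"
      then have "m powr (-1 - \<beta>/2) + (real k + 1) / m ^ 3 + x / m ^ 2 \<le> (m powr (-1 - \<beta>/2) + 1 / m^2 + x / m^2) + (if j \<le> k then 1 / m else 0)"
        using w[of k] by simp
      then have "?d k * (m powr (-1 - \<beta>/2) + (real k + 1) / m ^ 3 + x / m ^ 2) \<le> ?d k * ((m powr (-1 - \<beta>/2) + 1 / m^2 + x / m^2) + (if j \<le> k then 1 / m else 0))"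
        by (rule mult_left_mono[OF _ d])
      then show "?d k * (m powr (-1 - \<beta>/2) + (real k + 1) / m ^ 3 + x / m ^ 2)
         \<le> ?d k * (m powr (-1 - \<beta>/2) + 1 / m^2 + x / m^2) + (if j \<le> k then ?d k * (1 / m) else 0)"
        by (simp add: distrib_left split: if_splits)
    qed
    also have "\<dots> = occ N x * (m powr (-1 - \<beta>/2) + 1 / m^2 + x / m^2) + (\<Sum>k<N. if j \<le> k then ?d k * (1 / m) else 0)"
      by (simp add: sum.distrib occ_def sum_distrib_right)
    also have "\<dots> \<le> 4 * Ca * ((1 + x) / m * ?e) + 2 * Ct * ((1 + x) / m * ?e)"
    proof (rule add_mono)
      have "(\<Sum>k<N. if j \<le> k then ?d k * (1 / m) else 0) \<le> (\<Sum>k<N. ?d (j + k) * (1 / m))"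
        using d m by (intro sum_if_shift) auto
      also have "\<dots> = (\<Sum>k<N. ?d (j + k)) * (1 / m)" by (rule sum_distrib_right[symmetric])
      also have "\<dots> \<le> (Ct * (1 + x) * (2 * ?e)) * (1 / m)"
      proof (rule mult_right_mono)
        have "sqrt (real j) powr (-\<beta>) = real j powr (-(\<beta>/2))" by (simp add: powr_half_sqrt[symmetric] powr_powr)
        also have "\<dots> \<le> (1/2 * m) powr (-(\<beta>/2))" using j m beta by (intro powr_mono2') auto
        also have "\<dots> = (1/2) powr (-(\<beta>/2)) * ?e" by (rule powr_mult)
        also have "\<dots> \<le> (1/2) powr (-1) * ?e" using beta by (intro mult_right_mono powr_mono') auto
        also have "(1/2::real) powr (-1) = 2" by (simp add: powr_minus_divide)
        finally have "Ct * (1 + x) * sqrt (real j) powr (-\<beta>) \<le> Ct * (1 + x) * (2 * ?e)"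
          using Ct x by (intro mult_left_mono) auto
        then show "(\<Sum>k<N. ?d (j + k)) \<le> Ct * (1 + x) * (2 * ?e)" using Ct(2)[OF j(1) x, of N] by linarith
      qed (use m in auto)
      finally show "(\<Sum>k<N. if j \<le> k then ?d k * (1 / m) else 0) \<le> 2 * Ct * ((1 + x) / m * ?e)" by (simp add: mult_ac)
      have o: "0 \<le> occ N x" "occ N x \<le> Ca * (1 + x) powr (1 - \<beta>)" using occ_nonneg[OF x] Ca(2)[OF x] by auto
      have p1: "(1 + x) powr (1 - \<beta>) \<le> 1 + x"
      proof -
        have "(1 + x) powr (1 - \<beta>) \<le> (1 + x) powr 1" using x beta by (intro powr_mono) auto
        then show ?thesis using x by simp
      qed
      have e1: "1 / m \<le> ?e"
      proof -
        have "m powr (-1) \<le> ?e" using m beta by (intro powr_mono) auto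
        then show ?thesis using m by (simp add: powr_minus_divide)
      qed
      have p2: "(1 + x) powr (1 - \<beta>) / m \<le> 2 * ?e"
      proof -
        have "(1 + x) powr (1 - \<beta>) \<le> (2 * m) powr (1 - \<beta>)" using x m beta by (intro powr_mono2) auto
        also have "\<dots> = 2 powr (1 - \<beta>) * m powr (1 - \<beta>)" by (rule powr_mult)
        also have "\<dots> \<le> 2 powr 1 * m powr (1 - \<beta>)" using beta by (intro mult_right_mono powr_mono) auto
        also have "m powr (1 - \<beta>) = m * m powr (-\<beta>)" using m powr_add[of m 1 "-\<beta>"] by simp
        also have "m powr (-\<beta>) \<le> ?e" using m beta by (intro powr_mono) auto
        finally show ?thesis using m by (simp add: divide_le_eq mult_ac)
      qed
      have "m powr (-1 - \<beta>/2) = 1 / m * ?e" using m powr_add[of m "-1" "-(\<beta>/2)"] by (simp add: powr_minus_divide)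
      then have "occ N x * (m powr (-1 - \<beta>/2) + 1 / m^2 + x / m^2) = occ N x * (1 / m * ?e + 1 / m * (1 / m)) + occ N x * (1/m) * (x / m)"
        by (simp add: power2_eq_square algebra_simps)
      also have "\<dots> \<le> (Ca * (1 + x)) * (1 / m * ?e + 1 / m * ?e) + (Ca * (2 * ?e)) * ((1 + x) / m)"
      proof (rule add_mono)
        have "occ N x \<le> Ca * (1 + x)" using o(2) mult_left_mono[OF p1, of Ca] Ca(1) by linarith
        then show "occ N x * (1 / m * ?e + 1 / m * (1 / m)) \<le> (Ca * (1 + x)) * (1 / m * ?e + 1 / m * ?e)"
          using e1 m Ca x by (intro mult_mono add_mono mult_left_mono) auto
        have "occ N x * (1 / m) \<le> Ca * (1 + x) powr (1 - \<beta>) * (1 / m)" using o m by (intro mult_right_mono) auto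
        also have "\<dots> = Ca * ((1 + x) powr (1 - \<beta>) / m)" by simp
        also have "\<dots> \<le> Ca * (2 * ?e)" using p2 Ca by (intro mult_left_mono) auto
        finally have oo: "occ N x * (1/m) \<le> Ca * (2 * ?e)" .
        show "occ N x * (1/m) * (x / m) \<le> (Ca * (2 * ?e)) * ((1 + x) / m)"
          by (rule mult_mono[OF oo]) (use m x Ca in \<open>auto intro!: divide_right_mono\<close>)
      qed
      also have "\<dots> = 4 * Ca * ((1 + x) / m * ?e)" by (simp add: algebra_simps add_divide_distrib)
      finally show "occ N x * (m powr (-1 - \<beta>/2) + 1 / m^2 + x / m^2) \<le> 4 * Ca * ((1 + x) / m * ?e)" .
    qed
    also have "\<dots> = (4 * Ca + 2 * Ct) * ((1 + x) / m) * ?e" by (simp only: distrib_right mult.assoc)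
    also have "\<dots> \<le> (4 * Ca + 2 * Ct) * (2 * theta n x) * ?e"
      using theta_small[OF n x xm] Ca Ct unfolding m_def by (intro mult_right_mono mult_left_mono) auto
    also have "\<dots> = 2 * (4 * Ca + 2 * Ct) * theta n x * ?e" by simp
    finally show "(\<Sum>k<n div 2. (Q ^^ k) rr x * (sqrt (real n) powr (-1 - \<beta>/2) + (real k + 1) / sqrt (real n) ^ 3 + x / sqrt (real n) ^ 2))
       \<le> 2 * (4 * Ca + 2 * Ct) * theta n x * sqrt (real n) powr (-(\<beta>/2))"
      unfolding m_def N_def .
  qed
qed

section \<open>Cost of freezing the quotient \<open>kq\<close> at the exit\<close>

lemma Gt_diff:
  assumes "0 \<le> y" "\<And>v. 0 \<le> v \<Longrightarrow> v * \<bar>kq U t v - \<kappa>\<bar> \<le> h v"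
    "integrable \<mu> (\<lambda>\<xi>. h (overshoot y \<xi>))"
  shows "\<bar>Gt U t y - \<kappa> * g y\<bar> \<le> (\<integral>\<xi>. h (overshoot y \<xi>) \<partial>\<mu>)"
proof -
  have "Gt U t y - \<kappa> * g y = (\<integral>\<xi>. w U t (overshoot y \<xi>) - \<kappa> * overshoot y \<xi> \<partial>\<mu>)"
    unfolding Gt_def g_def using int_w_over int_over by simp
  also have "\<bar>\<dots>\<bar> \<le> (\<integral>\<xi>. \<bar>w U t (overshoot y \<xi>) - \<kappa> * overshoot y \<xi>\<bar> \<partial>\<mu>)" by (rule integral_abs_bound)
  also have "\<dots> \<le> (\<integral>\<xi>. h (overshoot y \<xi>) \<partial>\<mu>)"
  proof (rule integral_mono)
    fix \<xi>
    have "\<bar>w U t (overshoot y \<xi>) - \<kappa> * overshoot y \<xi>\<bar> = overshoot y \<xi> * \<bar>kq U t (overshoot y \<xi>) - \<kappa>\<bar>"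
    proof -
      have "w U t (overshoot y \<xi>) - \<kappa> * overshoot y \<xi> = overshoot y \<xi> * (kq U t (overshoot y \<xi>) - \<kappa>)"
        unfolding w_eq_kq by (simp add: algebra_simps)
      then show ?thesis using overshoot_nonneg[of y \<xi>] by (simp add: abs_mult)
    qed
    then show "\<bar>w U t (overshoot y \<xi>) - \<kappa> * overshoot y \<xi>\<bar> \<le> h (overshoot y \<xi>)" using assms(2)[OF overshoot_nonneg] by simp
  qed (use int_w_over int_over assms(3) in auto)
  finally show ?thesis .
qed

lemma kq_tm_bound: assumes "1 \<le> n" shows "\<bar>kq U (tm n i) v\<bar> \<le> 4 / \<sigma> * (real i + sqrt (real n)) powr (-1/2)"
proof -
  have "\<bar>kq U (tm n i) v\<bar> \<le> 4 / sqrt (tm n i)" by (rule kq_bound[OF tm_pos[OF assms]])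
  also have "\<dots> = 4 / \<sigma> * (real i + sqrt (real n)) powr (-1/2)"
    unfolding sqrt_tm[OF assms] by (simp add: powr_minus_divide)
  finally show ?thesis .
qed

text \<open>Uses no closeness of the two quotients, only that each is at most of the order of the
  inverse root of the time left. It serves for exits in the last half and for starting points beyond
  sqrt n.\<close>

lemma Gt_crude:
  assumes n: "1 \<le> n" and y: "0 \<le> y" and i: "i \<le> n"
  shows "\<bar>Gt U (tm n i) y - kq U (tm n n) x * g y\<bar> \<le> 8 * Co / \<sigma> * (rr y * (real i + sqrt (real n)) powr (-1/2))"
proof -
  let ?c = "8 / \<sigma> * (real i + sqrt (real n)) powr (-1/2)"
  have c: "0 \<le> ?c" using sigma by simp
  have "\<bar>Gt U (tm n i) y - kq U (tm n n) x * g y\<bar> \<le> (\<integral>\<xi>. ?c * overshoot y \<xi> \<partial>\<mu>)"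
  proof (rule Gt_diff[OF y])
    fix v :: real assume v: "0 \<le> v"
    have "(real n + sqrt (real n)) powr (-1/2) \<le> (real i + sqrt (real n)) powr (-1/2)"
      using i n by (intro powr_mono2') (auto intro!: add_nonneg_pos)
    then have "4 / \<sigma> * (real n + sqrt (real n)) powr (-1/2) \<le> 4 / \<sigma> * (real i + sqrt (real n)) powr (-1/2)"
      using sigma by (intro mult_left_mono) auto
    then have "\<bar>kq U (tm n n) x\<bar> \<le> 4 / \<sigma> * (real i + sqrt (real n)) powr (-1/2)"
      using kq_tm_bound[OF n, of U n x] by linarith
    then have "\<bar>kq U (tm n i) v - kq U (tm n n) x\<bar> \<le> 2 * (4 / \<sigma> * (real i + sqrt (real n)) powr (-1/2))"
      using kq_tm_bound[OF n, of U i v] by linarith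
    then have "\<bar>kq U (tm n i) v - kq U (tm n n) x\<bar> \<le> ?c" by simp
    then show "v * \<bar>kq U (tm n i) v - kq U (tm n n) x\<bar> \<le> ?c * v"
      using mult_left_mono[OF _ v] by (simp only: mult.commute[of ?c v])
  qed (use int_over in \<open>auto intro: integrable_mult_right\<close>)
  also have "\<dots> = ?c * g y" unfolding g_def by simp
  also have "\<dots> \<le> ?c * (Co * rr y)" by (rule mult_left_mono[OF g_le[OF y] c])
  also have "\<dots> = 8 * Co / \<sigma> * (rr y * (real i + sqrt (real n)) powr (-1/2))" by simp
  finally show ?thesis .
qed

text \<open>The quotient is moved in three stages: from the overshoot v to 0 at variance
  \<open>tm n i\<close>, from there to variance \<open>tm n n\<close>, and then from 0 to x. The
  first stage is Lipschitz for v \<le> sqrt n and merely bounded beyond; a power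
  \<open>\<beta>/2\<close> of v covers both, and the overshoot has the moment this requires. That at
  least half of the steps are left keeps \<open>tm n i\<close> of order n.\<close>

lemma Gt_fine: "\<exists>C>0. \<forall>n i U x y. 1 \<le> n \<longrightarrow> n \<le> 2 * i \<longrightarrow> i < n \<longrightarrow> 0 \<le> x \<longrightarrow> 0 \<le> y \<longrightarrow>
  \<bar>Gt U (tm n i) y - kq U (tm n n) x * g y\<bar>
    \<le> C * (rr y * (sqrt (real n) powr (-1 - \<beta>/2) + real (n - i) / sqrt (real n) ^ 3 + x / sqrt (real n) ^ 2))"
proof -
  \<comment> \<open>The entry \<open>32 / \<sigma>\<^sup>2\<close> comes from the Lipschitz regime v
    \<le> m of the first stage, the entry \<open>16 / \<sigma>\<close> from the bounded
    regime.\<close>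
  define K where "K = max (16 / \<sigma>) (32 / \<sigma>\<^sup>2)"
  have K: "16 / \<sigma> \<le> K" "32 / \<sigma>\<^sup>2 \<le> K" "0 < K" using sigma by (auto simp: K_def less_max_iff_disj)
  let ?C = "(K + 64 / \<sigma>) * Co"
  have K64: "0 < K + 64 / \<sigma>" using K sigma by (simp add: add_pos_pos)
  show ?thesis
  proof (intro exI conjI allI impI)
    show "0 < ?C" using K64 Co_pos by simp
    fix n i :: nat and U x y :: real assume n: "1 \<le> n" and i2: "n \<le> 2 * i" and i: "i < n" and x: "0 \<le> x" and y: "0 \<le> y"
    define m where "m = sqrt (real n)"
    have m: "1 \<le> m" "m * m = real n" using n by (auto simp: m_def)
    let ?t = "tm n i"
    have t0: "0 < ?t" "0 < tm n n" by (rule tm_pos[OF n])+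
    have tn: "\<sigma>\<^sup>2 * m\<^sup>2 \<le> tm n n" unfolding tm_def m_def[symmetric] using m sigma by (intro mult_left_mono) (auto simp: power2_eq_square)
    have "real n \<le> real (2 * i)" using i2 by (simp only: of_nat_le_iff)
    then have t: "\<sigma>\<^sup>2 * (m\<^sup>2 / 2) \<le> ?t" unfolding tm_def m_def[symmetric] using m sigma by (intro mult_left_mono) (auto simp: power2_eq_square)
    have st: "\<sigma> * m / 2 \<le> sqrt ?t"
    proof (rule real_le_rsqrt)
      have "(\<sigma> * m / 2)\<^sup>2 = \<sigma>\<^sup>2 * (m\<^sup>2 / 4)" by (simp add: power_mult_distrib power_divide)
      also have "\<dots> \<le> \<sigma>\<^sup>2 * (m\<^sup>2 / 2)" by (intro mult_left_mono) auto
      finally show "(\<sigma> * m / 2)\<^sup>2 \<le> ?t" using t by linarith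
    qed
    have sm: "0 < \<sigma> * m" using sigma m by simp
    have sp: "0 < \<sigma>\<^sup>2 * m\<^sup>2" using sigma m by simp
    define Z where "Z = 64 / \<sigma> * (real (n - i) / m ^ 3) + 16 / \<sigma>\<^sup>2 * (x / m\<^sup>2)"
    let ?h = "\<lambda>v. K * m powr (-1 - \<beta>/2) * v powr (1 + \<beta>/2) + Z * v"
    have Z: "0 \<le> Z" unfolding Z_def using sigma m x by simp
    have kk: "\<bar>kq U ?t v - kq U (tm n n) x\<bar> \<le> K * m powr (-1 - \<beta>/2) * v powr (\<beta>/2) + Z" if v: "0 \<le> v" for v
    proof -
      have a: "\<bar>kq U ?t v - kq U ?t 0\<bar> \<le> K * m powr (-1 - \<beta>/2) * v powr (\<beta>/2)"
      proof (cases "v \<le> m")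
        case True
        have "\<bar>kq U ?t v - kq U ?t 0\<bar> \<le> 16 * v / ?t" using kq_lipschitz_0[OF t0(1), of U v] v by simp
        also have "\<dots> \<le> 16 * v / (\<sigma>\<^sup>2 * (m\<^sup>2 / 2))" using t t0 v sp by (intro divide_left_mono) auto
        also have "\<dots> = 32 / \<sigma>\<^sup>2 * (1 / m * (v / m))" using sigma m by (simp add: power2_eq_square)
        also have "\<dots> \<le> K * (1 / m * (v / m) powr (\<beta>/2))"
        proof (intro mult_mono mult_left_mono K)
          have "(v / m) powr 1 \<le> (v / m) powr (\<beta>/2)" if "0 < v" using True m beta that by (intro powr_mono') auto
          then show "v / m \<le> (v / m) powr (\<beta>/2)" using v m by (cases "v = 0") auto
        qed (use m v K in auto)
        also have "1 / m * (v / m) powr (\<beta>/2) = m powr (-1 - \<beta>/2) * v powr (\<beta>/2)"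
          using m v powr_add[of m "-1" "-(\<beta>/2)"] by (simp add: powr_divide powr_minus_divide)
        finally show ?thesis by (simp add: mult.assoc)
      next
        case False
        have b: "\<bar>kq U ?t r\<bar> \<le> 4 / sqrt ?t" for r by (rule kq_bound[OF t0(1)])
        have "\<bar>kq U ?t v - kq U ?t 0\<bar> \<le> 8 / sqrt ?t" using b[of v] b[of 0] by linarith
        also have "\<dots> \<le> 8 / (\<sigma> * m / 2)" using st sm t0 by (intro divide_left_mono) auto
        also have "\<dots> = 16 / \<sigma> * (1 / m * 1)" by simp
        also have "\<dots> \<le> K * (1 / m * (v / m) powr (\<beta>/2))"
        proof (intro mult_mono mult_left_mono K)
          show "1 \<le> (v / m) powr (\<beta>/2)" using False m beta by (intro ge_one_powr_ge_zero) auto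
        qed (use m v K in auto)
        also have "1 / m * (v / m) powr (\<beta>/2) = m powr (-1 - \<beta>/2) * v powr (\<beta>/2)"
          using m v powr_add[of m "-1" "-(\<beta>/2)"] by (simp add: powr_divide powr_minus_divide)
        finally show ?thesis by (simp add: mult.assoc)
      qed
      have b: "\<bar>kq U (tm n n) 0 - kq U ?t 0\<bar> \<le> 64 / \<sigma> * (real (n - i) / m ^ 3)"
      proof -
        have d: "tm n n - ?t = \<sigma>\<^sup>2 * real (n - i)" using i by (simp add: tm_def of_nat_diff algebra_simps)
        have "\<bar>kq U (tm n n) 0 - kq U ?t 0\<bar> \<le> 16 * (tm n n - ?t) / (?t * sqrt ?t)"
          using i sigma by (intro kq_time t0) (simp add: tm_def)
        also have "\<dots> \<le> 16 * (tm n n - ?t) / ((\<sigma>\<^sup>2 * (m\<^sup>2 / 2)) * (\<sigma> * m / 2))"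
          unfolding d using t st sm sp t0 sigma by (intro divide_left_mono mult_mono mult_pos_pos) auto
        also have "\<dots> = 64 / \<sigma> * (real (n - i) / m ^ 3)"
          unfolding d using sigma m by (simp add: power2_eq_square power3_eq_cube field_simps)
        finally show ?thesis .
      qed
      have c: "\<bar>kq U (tm n n) x - kq U (tm n n) 0\<bar> \<le> 16 / \<sigma>\<^sup>2 * (x / m\<^sup>2)"
      proof -
        have "\<bar>kq U (tm n n) x - kq U (tm n n) 0\<bar> \<le> 16 * x / tm n n" using kq_lipschitz_0[OF t0(2), of U x] x by simp
        also have "\<dots> \<le> 16 * x / (\<sigma>\<^sup>2 * m\<^sup>2)" using tn t0 x sp by (intro divide_left_mono) auto
        finally show ?thesis by simp
      qed
      show ?thesis unfolding Z_def using a b c by linarith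
    qed
    have ig: "integrable \<mu> (\<lambda>\<xi>. overshoot y \<xi> + overshoot y \<xi> powr (1 + \<beta>/2))" by (rule overshoot_bound(1)[OF y])
    have ip: "integrable \<mu> (\<lambda>\<xi>. overshoot y \<xi> powr (1 + \<beta>/2))"
      using Bochner_Integration.integrable_diff[OF ig int_over[of y]] by simp
    have "\<bar>Gt U ?t y - kq U (tm n n) x * g y\<bar> \<le> (\<integral>\<xi>. ?h (overshoot y \<xi>) \<partial>\<mu>)"
    proof (rule Gt_diff[OF y])
      fix v :: real assume v: "0 \<le> v"
      have e: "v * v powr (\<beta>/2) = v powr (1 + \<beta>/2)"
        using v by (cases "v = 0") (auto simp: powr_add)
      have alg: "v * (a * p + z) = a * (v * p) + z * v" for a p z :: real by (simp add: algebra_simps)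
      show "v * \<bar>kq U ?t v - kq U (tm n n) x\<bar> \<le> ?h v"
        using mult_left_mono[OF kk[OF v] v] unfolding alg e .
    next
      show "integrable \<mu> (\<lambda>\<xi>. ?h (overshoot y \<xi>))" using ip int_over[of y] by (intro Bochner_Integration.integrable_add integrable_mult_right)
    qed
    also have "\<dots> = K * m powr (-1 - \<beta>/2) * (\<integral>\<xi>. overshoot y \<xi> powr (1 + \<beta>/2) \<partial>\<mu>) + Z * g y"
      unfolding g_def using ip int_over[of y] by simp
    also have "\<dots> \<le> K * m powr (-1 - \<beta>/2) * (Co * rr y) + Z * (Co * rr y)"
    proof (intro add_mono mult_left_mono)
      have "(\<integral>\<xi>. overshoot y \<xi> powr (1 + \<beta>/2) \<partial>\<mu>) \<le> (\<integral>\<xi>. overshoot y \<xi> + overshoot y \<xi> powr (1 + \<beta>/2) \<partial>\<mu>)"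
        using ip ig overshoot_nonneg by (intro integral_mono) auto
      then show "(\<integral>\<xi>. overshoot y \<xi> powr (1 + \<beta>/2) \<partial>\<mu>) \<le> Co * rr y" using overshoot_bound(2)[OF y] by linarith
    qed (use K Z g_le[OF y] in auto)
    also have "\<dots> = (K * m powr (-1 - \<beta>/2) + Z) * (Co * rr y)" by (simp add: distrib_right)
    also have "\<dots> \<le> ((K + 64 / \<sigma>) * (m powr (-1 - \<beta>/2) + real (n - i) / m ^ 3 + x / m ^ 2)) * (Co * rr y)"
    proof (rule mult_right_mono)
      have p: "0 \<le> m powr (-1 - \<beta>/2)" "0 \<le> real (n - i) / m ^ 3" "0 \<le> x / m^2" using m x by auto
      have "16 / \<sigma>\<^sup>2 \<le> K" using K(2) divide_right_mono[of 16 32 "\<sigma>\<^sup>2"] by simp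
      moreover have "0 < 64 / \<sigma>" using sigma by simp
      ultimately have "16 / \<sigma>\<^sup>2 \<le> K + 64 / \<sigma>" by linarith
      then have "16 / \<sigma>\<^sup>2 * (x / m\<^sup>2) \<le> (K + 64 / \<sigma>) * (x / m\<^sup>2)" using p(3) by (rule mult_right_mono)
      moreover have "64 / \<sigma> * (real (n - i) / m ^ 3) \<le> (K + 64 / \<sigma>) * (real (n - i) / m ^ 3)" using K p by (intro mult_right_mono) auto
      moreover have "K * m powr (-1 - \<beta>/2) \<le> (K + 64 / \<sigma>) * m powr (-1 - \<beta>/2)" using sigma p by (intro mult_right_mono) auto
      ultimately show "K * m powr (-1 - \<beta>/2) + Z \<le> (K + 64 / \<sigma>) * (m powr (-1 - \<beta>/2) + real (n - i) / m ^ 3 + x / m ^ 2)"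
        unfolding Z_def distrib_left by linarith
    qed (use Co_pos rr_nonneg in auto)
    finally show "\<bar>Gt U (tm n i) y - kq U (tm n n) x * g y\<bar>
      \<le> ?C * (rr y * (sqrt (real n) powr (-1 - \<beta>/2) + real (n - i) / sqrt (real n) ^ 3 + x / sqrt (real n) ^ 2))"
      by (simp add: m_def mult_ac)
  qed
qed

text \<open>The term \<open>(Q ^^ k) g x\<close> is the expected overshoot on \<open>\<tau>\<^sub>x = k + 1\<close>, so \<open>Vh\<close> is the function \<open>V\<close>.\<close>

definition Vh :: "real \<Rightarrow> real" where "Vh x = x + (\<Sum>k. (Q ^^ k) g x)"

lemma Qn_g_nonneg: "0 \<le> x \<Longrightarrow> 0 \<le> (Q ^^ k) g x"
  by (rule Qn_nonneg[OF lin_growth_g g_nonneg])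

lemma Qn_g_le: "0 \<le> x \<Longrightarrow> (Q ^^ k) g x \<le> Co * (Q ^^ k) rr x"
  using Qn_mono[OF lin_growth_g lin_growth_cmult[OF lin_growth_rr] g_le, of x k] unfolding Qn_cmult by simp

lemma sum_Qn_g_le: assumes "0 \<le> x" shows "(\<Sum>k<n. (Q ^^ k) g x) \<le> Co * occ n x"
  unfolding occ_def sum_distrib_left by (intro sum_mono Qn_g_le assms)

lemma summable_Qn_g: assumes "0 \<le> x" shows "summable (\<lambda>k. (Q ^^ k) g x)"
proof (rule bounded_imp_summable[where B = "Co * (fl x / c1)"])
  fix n
  have "(\<Sum>k\<le>n. (Q ^^ k) g x) \<le> Co * occ (Suc n) x"
    using sum_Qn_g_le[OF assms, of "Suc n"] by (simp only: lessThan_Suc_atMost)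
  also have "\<dots> \<le> Co * (fl x / c1)" using Co_pos occ_le_fl[OF assms] by (intro mult_left_mono) auto
  finally show "(\<Sum>k\<le>n. (Q ^^ k) g x) \<le> Co * (fl x / c1)" .
qed (rule Qn_g_nonneg[OF assms])

lemma suminf_Qn_g_le: "0 \<le> x \<Longrightarrow> (\<Sum>k. (Q ^^ k) g x) \<le> Co / c1 * A * (1 + x) powr (1 - \<beta>)"
proof -
  assume x: "0 \<le> x"
  have "(\<Sum>k. (Q ^^ k) g x) \<le> Co * (fl x / c1)"
  proof (rule suminf_le_const[OF summable_Qn_g[OF x]])
    fix n
    have "(\<Sum>k<n. (Q ^^ k) g x) \<le> Co * occ n x" by (rule sum_Qn_g_le[OF x])
    also have "\<dots> \<le> Co * (fl x / c1)" using Co_pos occ_le_fl[OF x] by (intro mult_left_mono) auto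
    finally show "(\<Sum>k<n. (Q ^^ k) g x) \<le> Co * (fl x / c1)" .
  qed
  also have "\<dots> = Co / c1 * fl x" by simp
  also have "\<dots> \<le> Co / c1 * (A * (1 + x) powr (1 - \<beta>))"
    using Co_pos c1_pos fl_le_powr[OF x] by (intro mult_left_mono) auto
  finally show ?thesis by (simp add: mult.assoc)
qed

lemma Vh_bound: "\<exists>C\<ge>1. \<forall>x\<ge>0. x \<le> Vh x \<and> Vh x \<le> C * (1 + x)"
proof (intro exI conjI allI impI)
  let ?K = "Co / c1 * A"
  have K: "0 < ?K" using Co_pos c1_pos A_ge by simp
  show "1 \<le> 1 + ?K" using K by simp
  fix x :: real assume x: "0 \<le> x"
  show "x \<le> Vh x" unfolding Vh_def using suminf_nonneg[OF summable_Qn_g[OF x] Qn_g_nonneg[OF x]] by simp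
  have "(1 + x) powr (1 - \<beta>) \<le> (1 + x) powr 1" using x beta by (intro powr_mono) auto
  then have "?K * (1 + x) powr (1 - \<beta>) \<le> ?K * (1 + x)" using x K by (intro mult_left_mono) auto
  then have "Vh x \<le> x + ?K * (1 + x)" unfolding Vh_def using suminf_Qn_g_le[OF x] by linarith
  also have "\<dots> \<le> (1 + ?K) * (1 + x)" by (simp only: distrib_right) simp
  finally show "Vh x \<le> (1 + ?K) * (1 + x)" .
qed

end

lemma sum_split_reverse:
  fixes f :: "nat \<Rightarrow> real"
  assumes "n = M + p"
  shows "(\<Sum>i<n. f i) = (\<Sum>i<M. f i) + (\<Sum>k<p. f (n - Suc k))"
proof -
  have "(\<Sum>i<M + p. f i) = (\<Sum>i<M. f i) + (\<Sum>k<p. f (M + k))" for p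
    by (induction p) simp_all
  moreover have "(\<Sum>k<p. f (M + k)) = (\<Sum>k<p. f (M + (p - Suc k)))"
    by (rule sum.nat_diff_reindex[where g = "\<lambda>k. f (M + k)", symmetric])
  moreover have "(\<Sum>k<p. f (M + (p - Suc k))) = (\<Sum>k<p. f (n - Suc k))"
    using assms by (intro sum.cong) auto
  ultimately show ?thesis using assms by simp
qed

context centred_law
begin

text \<open>\<open>Vh\<close> contains the overshoots at all times, the walk up to n only those of
  the first n steps. For x \<le> sqrt n the rest is small by \<open>occ_tail\<close>. For larger x
  the whole series is at most of order (1 + x)^(1-\<beta>), and \<open>kq_bound2\<close> contributes
  1/x.\<close>

lemma tail_term: "\<exists>C>0. \<forall>n U x. 1 \<le> n \<longrightarrow> 0 \<le> x \<longrightarrow>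
  \<bar>kq U (tm n n) x\<bar> * (\<Sum>k. (Q ^^ (k + n)) g x) \<le> C * theta n x * sqrt (real n) powr (-(\<beta>/2))"
proof -
  obtain Ct where Ct: "Ct > 0" "\<And>j n x. 1 \<le> j \<Longrightarrow> 0 \<le> x \<Longrightarrow> (\<Sum>k<n. (Q ^^ (j + k)) rr x) \<le> Ct * (1 + x) * sqrt (real j) powr (-\<beta>)"
    using occ_tail by blast
  let ?K = "Co / c1 * A"
  have K: "0 < ?K" using Co_pos c1_pos A_ge by simp
  let ?C1 = "8 / \<sigma> * Co * Ct"
  have C1: "0 < ?C1" using sigma Co_pos Ct by simp
  show ?thesis
  proof (intro exI conjI allI impI)
    show "0 < ?C1 + 4 * ?K" using C1 K by simp
    fix n :: nat and U x :: real assume n: "1 \<le> n" and x: "0 \<le> x"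
    define m where "m = sqrt (real n)"
    have m: "1 \<le> m" "m * m = real n" using n by (auto simp: m_def)
    let ?e = "m powr (-(\<beta>/2))"
    let ?S = "(\<Sum>k. (Q ^^ (k + n)) g x)"
    have th: "0 < theta n x" by (rule theta_pos[OF n x])
    have be: "m powr (-\<beta>) \<le> ?e" using m beta by (intro powr_mono) auto
    have sm: "summable (\<lambda>k. (Q ^^ (k + n)) g x)" by (rule summable_ignore_initial_segment[OF summable_Qn_g[OF x]])
    have S0: "0 \<le> ?S" by (rule suminf_nonneg[OF sm]) (rule Qn_g_nonneg[OF x])
    \<comment> \<open>The two ranges of x give different constants; both bounds are nonnegative, so
      the sum of the constants covers either case.\<close>
    have "\<bar>kq U (tm n n) x\<bar> * ?S \<le> ?C1 * theta n x * ?e \<or> \<bar>kq U (tm n n) x\<bar> * ?S \<le> 4 * ?K * theta n x * ?e"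
    proof (cases "x \<le> m")
      case True
      have "?S \<le> Co * (Ct * (1 + x) * m powr (-\<beta>))"
      proof (rule suminf_le_const[OF sm])
        fix N
        have "(\<Sum>k<N. (Q ^^ (k + n)) g x) \<le> (\<Sum>k<N. Co * (Q ^^ (n + k)) rr x)"
          by (intro sum_mono) (use Qn_g_le[OF x] in \<open>simp only: add.commute\<close>)
        also have "\<dots> \<le> Co * (Ct * (1 + x) * m powr (-\<beta>))"
          unfolding sum_distrib_left[symmetric] m_def using Ct(2)[OF n x] Co_pos by (intro mult_left_mono) auto
        finally show "(\<Sum>k<N. (Q ^^ (k + n)) g x) \<le> Co * (Ct * (1 + x) * m powr (-\<beta>))" .
      qed
      also have "\<dots> \<le> Co * (Ct * (1 + x) * ?e)" using be Co_pos Ct x by (intro mult_left_mono) auto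
      finally have s: "?S \<le> Co * (Ct * (1 + x) * ?e)" .
      have "\<bar>kq U (tm n n) x\<bar> \<le> 4 / \<sigma> * (real n + m) powr (-1/2)" unfolding m_def by (rule kq_tm_bound[OF n])
      also have "\<dots> \<le> 4 / \<sigma> * real n powr (-1/2)" using sigma n m by (intro mult_left_mono powr_mono2') auto
      also have "real n powr (-1/2) = 1 / m" using n by (simp add: powr_minus_divide powr_half_sqrt m_def)
      finally have "\<bar>kq U (tm n n) x\<bar> * ?S \<le> 4 / \<sigma> * (1 / m) * (Co * (Ct * (1 + x) * ?e))"
        using s S0 sigma m by (intro mult_mono) auto
      also have "\<dots> = 4 / \<sigma> * Co * Ct * ((1 + x) / m) * ?e" by simp
      also have "\<dots> \<le> 4 / \<sigma> * Co * Ct * (2 * theta n x) * ?e"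
        using theta_small[OF n x] True sigma Co_pos Ct unfolding m_def by (intro mult_right_mono mult_left_mono) auto
      finally show ?thesis by (simp add: mult_ac)
    next
      case False
      have "?S \<le> (\<Sum>k. (Q ^^ k) g x)"
        using suminf_split_initial_segment[OF summable_Qn_g[OF x], of n] sum_nonneg[of "{..<n}" "\<lambda>k. (Q ^^ k) g x"] Qn_g_nonneg[OF x]
        by simp
      also have "\<dots> \<le> ?K * (1 + x) powr (1 - \<beta>)" by (rule suminf_Qn_g_le[OF x])
      also have "\<dots> \<le> ?K * (2 * x * ?e)"
      proof (rule mult_left_mono)
        have "(1 + x) powr (1 - \<beta>) = (1 + x) * (1 + x) powr (-\<beta>)" using x powr_add[of "1 + x" 1 "-\<beta>"] by simp
        also have "\<dots> \<le> (2 * x) * m powr (-\<beta>)"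
          using False m x beta by (intro mult_mono powr_mono2') auto
        also have "\<dots> \<le> 2 * x * ?e" using be x by (intro mult_left_mono) auto
        finally show "(1 + x) powr (1 - \<beta>) \<le> 2 * x * ?e" .
      qed (use K in auto)
      finally have "\<bar>kq U (tm n n) x\<bar> * ?S \<le> \<bar>kq U (tm n n) x\<bar> * (?K * (2 * x * ?e))" by (intro mult_left_mono) auto
      also have "\<dots> = (\<bar>x\<bar> * \<bar>kq U (tm n n) x\<bar>) * (2 * ?K * ?e)" using x by simp
      also have "\<dots> \<le> 2 * (2 * ?K * ?e)" using kq_bound2[of x U "tm n n"] Co_pos c1_pos A_ge by (intro mult_right_mono) auto
      finally show ?thesis using theta_big[OF n, of x] False by (simp add: m_def)
    qed
    moreover have "0 \<le> ?C1 * theta n x * ?e" "0 \<le> 4 * ?K * theta n x * ?e"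
      using sigma Co_pos Ct(1) c1_pos A_ge th by auto
    moreover have "(?C1 + 4 * ?K) * theta n x * ?e = ?C1 * theta n x * ?e + 4 * ?K * theta n x * ?e"
      by (simp only: distrib_right)
    ultimately have "\<bar>kq U (tm n n) x\<bar> * ?S \<le> (?C1 + 4 * ?K) * theta n x * ?e" by linarith
    then show "\<bar>kq U (tm n n) x\<bar> * ?S \<le> (?C1 + 4 * ?K) * theta n x * sqrt (real n) powr (-(\<beta>/2))"
      unfolding m_def .
  qed
qed

text \<open>Freezing error of the exits at step \<open>n - i\<close>: \<open>n - Suc i\<close> steps
  are survived, the next one leaves the half line, and i steps are left.\<close>

definition Defect :: "nat \<Rightarrow> real \<Rightarrow> real \<Rightarrow> nat \<Rightarrow> real" where
  "Defect n U x i = (Q ^^ (n - Suc i)) (\<lambda>y. Gt U (tm n i) y - kq U (tm n n) x * g y) x"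

lemma Defect_crude:
  assumes "1 \<le> n" "i \<le> n" "0 \<le> x"
  shows "\<bar>Defect n U x i\<bar> \<le> 8 * Co / \<sigma> * ((Q ^^ (n - Suc i)) rr x * (real i + sqrt (real n)) powr (-1/2))"
proof -
  let ?c = "8 * Co / \<sigma> * (real i + sqrt (real n)) powr (-1/2)"
  have "\<bar>Defect n U x i\<bar> \<le> (Q ^^ (n - Suc i)) (\<lambda>y. ?c * rr y) x"
    unfolding Defect_def
  proof (rule Qn_abs_le[OF lin_growth_diff[OF lin_growth_Gt lin_growth_cmult[OF lin_growth_g]] lin_growth_cmult[OF lin_growth_rr] _ assms(3)])
    show "\<bar>Gt U (tm n i) y - kq U (tm n n) x * g y\<bar> \<le> ?c * rr y" if "0 \<le> y" for y
      using Gt_crude[OF assms(1) that assms(2), of U x] by (simp add: mult_ac)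
  qed
  then show ?thesis unfolding Qn_cmult by (simp add: mult_ac)
qed

text \<open>For x \<le> sqrt n the fine estimate is summed by \<open>early_sum\<close>. Beyond,
  \<open>theta\<close> is 1 and the crude estimate suffices: the inverse root of the remaining time
  is of order 1/sqrt n, and the occupation bound that is uniform in x leaves sqrt n to the power
  -\<beta>.\<close>

lemma early_Defect: "\<exists>C>0. \<forall>n U x. 1 \<le> n \<longrightarrow> 0 \<le> x \<longrightarrow>
  (\<Sum>k<n div 2. \<bar>Defect n U x (n - Suc k)\<bar>) \<le> C * theta n x * sqrt (real n) powr (-(\<beta>/2))"
proof -
  obtain Ce where Ce: "Ce > 0" "\<And>n x. 1 \<le> n \<Longrightarrow> 0 \<le> x \<Longrightarrow> x \<le> sqrt (real n) \<Longrightarrow>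
    (\<Sum>k<n div 2. (Q ^^ k) rr x * (sqrt (real n) powr (-1 - \<beta>/2) + (real k + 1) / sqrt (real n) ^ 3 + x / sqrt (real n) ^ 2))
     \<le> Ce * theta n x * sqrt (real n) powr (-(\<beta>/2))"
    using early_sum by blast
  obtain Cf where Cf: "Cf > 0" "\<And>n i U x y. 1 \<le> n \<Longrightarrow> n \<le> 2 * i \<Longrightarrow> i < n \<Longrightarrow> 0 \<le> x \<Longrightarrow> 0 \<le> y \<Longrightarrow>
    \<bar>Gt U (tm n i) y - kq U (tm n n) x * g y\<bar>
    \<le> Cf * (rr y * (sqrt (real n) powr (-1 - \<beta>/2) + real (n - i) / sqrt (real n) ^ 3 + x / sqrt (real n) ^ 2))"
    using Gt_fine by blast
  obtain Ca where Ca: "Ca > 0" "\<And>n x. 0 \<le> x \<Longrightarrow> occ n x \<le> Ca * sqrt n powr (1 - \<beta>)"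
    using occ_bound by blast
  let ?C2 = "16 * Co / \<sigma> * Ca"
  have C2: "0 < ?C2" using Co_pos sigma Ca by simp
  show ?thesis
  proof (intro exI conjI allI impI)
    show "0 < Cf * Ce + ?C2" using Cf(1) Ce(1) C2 by (simp add: add_pos_pos)
    fix n :: nat and U x :: real assume n: "1 \<le> n" and x: "0 \<le> x"
    define m where "m = sqrt (real n)"
    have m: "1 \<le> m" "m * m = real n" using n by (auto simp: m_def)
    let ?e = "m powr (-(\<beta>/2))"
    have th: "0 < theta n x" by (rule theta_pos[OF n x])
    have idx: "n \<le> 2 * (n - Suc k)" "n - Suc k < n" "n - Suc (n - Suc k) = k" "n - (n - Suc k) = Suc k" if "k < n div 2" for k
      using that by auto
    have "(\<Sum>k<n div 2. \<bar>Defect n U x (n - Suc k)\<bar>) \<le> Cf * Ce * theta n x * ?e \<or>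
      (\<Sum>k<n div 2. \<bar>Defect n U x (n - Suc k)\<bar>) \<le> ?C2 * theta n x * ?e"
    proof (cases "x \<le> m")
      case True
      let ?h = "\<lambda>k. m powr (-1 - \<beta>/2) + (real k + 1) / m ^ 3 + x / m ^ 2"
      have "(\<Sum>k<n div 2. \<bar>Defect n U x (n - Suc k)\<bar>) \<le> (\<Sum>k<n div 2. Cf * ((Q ^^ k) rr x * ?h k))"
      proof (rule sum_mono)
        fix k assume "k \<in> {..<n div 2}"
        then have k: "k < n div 2" by simp
        have "\<bar>Defect n U x (n - Suc k)\<bar> \<le> (Q ^^ k) (\<lambda>y. (Cf * ?h k) * rr y) x"
          unfolding Defect_def idx(3)[OF k]
        proof (rule Qn_abs_le[OF lin_growth_diff[OF lin_growth_Gt lin_growth_cmult[OF lin_growth_g]] lin_growth_cmult[OF lin_growth_rr] _ x])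
          fix y :: real assume y: "0 \<le> y"
          have "real (n - (n - Suc k)) = real k + 1" unfolding idx(4)[OF k] by simp
          then show "\<bar>Gt U (tm n (n - Suc k)) y - kq U (tm n n) x * g y\<bar> \<le> (Cf * ?h k) * rr y"
            using Cf(2)[OF n idx(1)[OF k] idx(2)[OF k] x y, of U] by (simp only: m_def mult_ac)
        qed
        then show "\<bar>Defect n U x (n - Suc k)\<bar> \<le> Cf * ((Q ^^ k) rr x * ?h k)" unfolding Qn_cmult by (simp only: mult_ac)
      qed
      also have "\<dots> \<le> Cf * (Ce * theta n x * ?e)"
        unfolding sum_distrib_left[symmetric] m_def using Ce(2)[OF n x] True Cf(1) by (intro mult_left_mono) (auto simp: m_def)
      finally show ?thesis by (simp add: mult_ac)
    next
      case False
      have "(\<Sum>k<n div 2. \<bar>Defect n U x (n - Suc k)\<bar>) \<le> (\<Sum>k<n div 2. 8 * Co / \<sigma> * ((Q ^^ k) rr x * (2 / m)))"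
      proof (rule sum_mono)
        fix k assume "k \<in> {..<n div 2}"
        then have k: "k < n div 2" by simp
        let ?i = "n - Suc k"
        have "real n \<le> real (2 * ?i)" using idx(1)[OF k] by (simp only: of_nat_le_iff)
        then have "1/4 * real n \<le> real ?i + m" using m by simp
        then have "(real ?i + m) powr (-1/2) \<le> (1/4 * real n) powr (-1/2)" using n by (intro powr_mono2') auto
        also have "\<dots> = 1 / sqrt (1/4 * real n)" by (simp add: powr_minus_divide powr_half_sqrt)
        also have "sqrt (1/4 * real n) = 1/2 * m" unfolding m_def real_sqrt_mult by (simp add: real_sqrt_divide)
        finally have b: "(real ?i + m) powr (-1/2) \<le> 2 / m" by simp
        have "\<bar>Defect n U x ?i\<bar> \<le> 8 * Co / \<sigma> * ((Q ^^ k) rr x * (real ?i + m) powr (-1/2))"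
          using Defect_crude[OF n _ x, of ?i U] idx(3)[OF k] by (simp add: m_def)
        also have "\<dots> \<le> 8 * Co / \<sigma> * ((Q ^^ k) rr x * (2 / m))"
          using b Co_pos sigma Qn_rr_nonneg[OF x] by (intro mult_left_mono) auto
        finally show "\<bar>Defect n U x ?i\<bar> \<le> 8 * Co / \<sigma> * ((Q ^^ k) rr x * (2 / m))" .
      qed
      also have "\<dots> = 8 * Co / \<sigma> * (occ (n div 2) x * (2 / m))"
        unfolding occ_def sum_distrib_left sum_distrib_right ..
      also have "\<dots> \<le> 8 * Co / \<sigma> * (Ca * m powr (1 - \<beta>) * (2 / m))"
      proof (intro mult_left_mono mult_right_mono)
        have "occ (n div 2) x \<le> Ca * sqrt (n div 2) powr (1 - \<beta>)" by (rule Ca(2)[OF x])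
        also have "\<dots> \<le> Ca * m powr (1 - \<beta>)"
          using Ca(1) beta unfolding m_def by (intro mult_left_mono powr_mono2 real_sqrt_le_mono) auto
        finally show "occ (n div 2) x \<le> Ca * m powr (1 - \<beta>)" .
      qed (use Co_pos sigma m in auto)
      also have "m powr (1 - \<beta>) = m * m powr (-\<beta>)" using m powr_add[of m 1 "-\<beta>"] by simp
      also have "8 * Co / \<sigma> * (Ca * (m * m powr (-\<beta>)) * (2 / m)) = ?C2 * m powr (-\<beta>)" using m by simp
      also have "\<dots> \<le> ?C2 * ?e" using m beta C2 by (intro mult_left_mono powr_mono) auto
      finally show ?thesis using theta_big[OF n, of x] False by (simp add: m_def)
    qed
    moreover have "0 \<le> Cf * Ce * theta n x * ?e" "0 \<le> ?C2 * theta n x * ?e"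
      using Co_pos sigma Ca(1) Cf(1) Ce(1) th by auto
    moreover have "(Cf * Ce + ?C2) * theta n x * ?e = Cf * Ce * theta n x * ?e + ?C2 * theta n x * ?e"
      by (simp only: distrib_right)
    ultimately have "(\<Sum>k<n div 2. \<bar>Defect n U x (n - Suc k)\<bar>) \<le> (Cf * Ce + ?C2) * theta n x * ?e" by linarith
    then show "(\<Sum>k<n div 2. \<bar>Defect n U x (n - Suc k)\<bar>) \<le> (Cf * Ce + ?C2) * theta n x * sqrt (real n) powr (-(\<beta>/2))"
      unfolding m_def .
  qed
qed

lemma smooth_approx: "\<exists>C>0. \<forall>n U x. 1 \<le> n \<longrightarrow> 0 \<le> x \<longrightarrow>
  \<bar>(Q ^^ n) (w U (tm n 0)) x - Vh x * kq U (tm n n) x\<bar> \<le> C * theta n x * sqrt (real n) powr (-(\<beta>/2))"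
proof -
  obtain C1 where C1: "C1 > 0" "\<And>n x. 1 \<le> n \<Longrightarrow> 0 \<le> x \<Longrightarrow>
    (\<Sum>i<n. 4 * (Cl * tm n i powr (-1 - \<beta>/2)) * surv (n - Suc i) x) \<le> C1 * theta n x * sqrt (real n) powr (-(\<beta>/2))"
    using lindeberg_error_sum by blast
  obtain C2 where C2: "C2 > 0" "\<And>n x. 1 \<le> n \<Longrightarrow> 0 \<le> x \<Longrightarrow>
    (\<Sum>i<n - n div 2. (Q ^^ (n - Suc i)) rr x * (real i + sqrt (real n)) powr (-1/2)) \<le> C2 * theta n x * sqrt (real n) powr (-(\<beta>/2))"
    using late_sum by blast
  obtain C3 where C3: "C3 > 0" "\<And>n U x. 1 \<le> n \<Longrightarrow> 0 \<le> x \<Longrightarrow>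
    (\<Sum>k<n div 2. \<bar>Defect n U x (n - Suc k)\<bar>) \<le> C3 * theta n x * sqrt (real n) powr (-(\<beta>/2))"
    using early_Defect by blast
  obtain C4 where C4: "C4 > 0" "\<And>n U x. 1 \<le> n \<Longrightarrow> 0 \<le> x \<Longrightarrow>
    \<bar>kq U (tm n n) x\<bar> * (\<Sum>k. (Q ^^ (k + n)) g x) \<le> C4 * theta n x * sqrt (real n) powr (-(\<beta>/2))"
    using tail_term by blast
  let ?K = "8 * Co / \<sigma>"
  have K: "0 < ?K" using Co_pos sigma by simp
  show ?thesis
  proof (intro exI conjI allI impI)
    show "0 < C1 + ?K * C2 + C3 + C4" by (intro add_pos_pos mult_pos_pos C1(1) C2(1) C3(1) C4(1) K)
    fix n :: nat and U x :: real assume n: "1 \<le> n" and x: "0 \<le> x"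
    define T where "T = theta n x * sqrt (real n) powr (-(\<beta>/2))"
    define \<kappa> where "\<kappa> = kq U (tm n n) x"
    define S where "S = (\<Sum>k. (Q ^^ (k + n)) g x)"
    have sm: "summable (\<lambda>k. (Q ^^ (k + n)) g x)" by (rule summable_ignore_initial_segment[OF summable_Qn_g[OF x]])
    have S0: "0 \<le> S" unfolding S_def by (rule suminf_nonneg[OF sm]) (rule Qn_g_nonneg[OF x])
    have g_rev: "(\<Sum>k<n. (Q ^^ k) g x) = (\<Sum>i<n. (Q ^^ (n - Suc i)) g x)"
      by (rule sum.nat_diff_reindex[symmetric])
    \<comment> \<open>This identity is the reason for freezing the quotient at \<open>x\<close> and
      variance \<open>tm n n\<close>: starting value, overshoots of the first n steps, and the
      remainder of the series.\<close>
    have V: "Vh x * \<kappa> = w U (tm n n) x + \<kappa> * (\<Sum>i<n. (Q ^^ (n - Suc i)) g x) + \<kappa> * S"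
    proof -
      have "Vh x = x + ((\<Sum>i<n. (Q ^^ (n - Suc i)) g x) + S)"
        unfolding Vh_def S_def g_rev[symmetric] using suminf_split_initial_segment[OF summable_Qn_g[OF x], of n] by simp
      then show ?thesis unfolding w_eq_kq \<kappa>_def[symmetric] by (simp add: algebra_simps)
    qed
    have D: "(\<Sum>i<n. (Q ^^ (n - Suc i)) (Gt U (tm n i)) x) - \<kappa> * (\<Sum>i<n. (Q ^^ (n - Suc i)) g x) = (\<Sum>i<n. Defect n U x i)"
      unfolding Defect_def \<kappa>_def[symmetric] Qn_diff[OF lin_growth_Gt lin_growth_cmult[OF lin_growth_g]] Qn_cmult
      by (simp add: sum_subtractf sum_distrib_left)
    have 1: "\<bar>(Q ^^ n) (w U (tm n 0)) x - w U (tm n n) x - (\<Sum>i<n. (Q ^^ (n - Suc i)) (Gt U (tm n i)) x)\<bar> \<le> C1 * T"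
      using dynkin[OF n x, of n U 0] C1(2)[OF n x] unfolding T_def by (simp add: mult.assoc)
    have "\<bar>\<Sum>i<n. Defect n U x i\<bar> \<le> (\<Sum>i<n. \<bar>Defect n U x i\<bar>)" by (rule sum_abs)
    also have "\<dots> = (\<Sum>i<n - n div 2. \<bar>Defect n U x i\<bar>) + (\<Sum>k<n div 2. \<bar>Defect n U x (n - Suc k)\<bar>)"
      by (rule sum_split_reverse) simp
    also have "\<dots> \<le> ?K * (C2 * T) + C3 * T"
    proof (rule add_mono)
      show "(\<Sum>k<n div 2. \<bar>Defect n U x (n - Suc k)\<bar>) \<le> C3 * T" using C3(2)[OF n x, of U] by (simp add: T_def mult.assoc)
      have "(\<Sum>i<n - n div 2. \<bar>Defect n U x i\<bar>) \<le> (\<Sum>i<n - n div 2. ?K * ((Q ^^ (n - Suc i)) rr x * (real i + sqrt (real n)) powr (-1/2)))"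
        by (intro sum_mono Defect_crude n x) auto
      also have "\<dots> \<le> ?K * (C2 * T)" unfolding sum_distrib_left[symmetric]
        using C2(2)[OF n x] K by (intro mult_left_mono) (auto simp: T_def mult.assoc)
      finally show "(\<Sum>i<n - n div 2. \<bar>Defect n U x i\<bar>) \<le> ?K * (C2 * T)" .
    qed
    finally have 2: "\<bar>\<Sum>i<n. Defect n U x i\<bar> \<le> ?K * C2 * T + C3 * T" by (simp only: mult.assoc)
    have 3: "\<bar>\<kappa> * S\<bar> \<le> C4 * T"
      using C4(2)[OF n x, of U] S0 unfolding \<kappa>_def S_def T_def by (simp add: abs_mult mult.assoc)
    have "\<bar>(Q ^^ n) (w U (tm n 0)) x - Vh x * \<kappa>\<bar> \<le> C1 * T + (?K * C2 * T + C3 * T) + C4 * T"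
      using 1 2 3 V D by linarith
    then show "\<bar>(Q ^^ n) (w U (tm n 0)) x - Vh x * kq U (tm n n) x\<bar> \<le> (C1 + ?K * C2 + C3 + C4) * theta n x * sqrt (real n) powr (-(\<beta>/2))"
      unfolding \<kappa>_def by (simp add: T_def distrib_right mult.assoc)
  qed
qed

lemma lin_growth_ind_le: "lin_growth (indicator {..U})"
  by (rule lin_growth_bounded[of _ 1]) (auto simp: indicator_def)

text \<open>Removes the variance \<open>\<sigma>\<^sup>2 * sqrt n\<close> added by the
  mollification, a relative change of order 1/sqrt n. For x beyond sqrt n the growth of
  \<open>Vh\<close> is absorbed by the factor |x| in \<open>kq_time2\<close>.\<close>

lemma time_shift: "\<exists>C>0. \<forall>n U x. 1 \<le> n \<longrightarrow> 0 \<le> x \<longrightarrow>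
  Vh x * \<bar>kq U (tm n n) x - kq U (\<sigma>\<^sup>2 * real n) x\<bar> \<le> C * theta n x * sqrt (real n) powr (-(\<beta>/2))"
proof -
  obtain Cv where Cv: "Cv \<ge> 1" "\<And>x. 0 \<le> x \<Longrightarrow> x \<le> Vh x \<and> Vh x \<le> Cv * (1 + x)" using Vh_bound by blast
  show ?thesis
  proof (intro exI conjI allI impI)
    show "0 < 32 / \<sigma> * Cv + 16 * Cv" using Cv(1) sigma by (simp add: add_pos_pos)
    fix n :: nat and U x :: real assume n: "1 \<le> n" and x: "0 \<le> x"
    define m where "m = sqrt (real n)"
    have m: "1 \<le> m" "m * m = real n" using n by (auto simp: m_def)
    let ?e = "m powr (-(\<beta>/2))"
    let ?s = "\<sigma>\<^sup>2 * real n"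
    have s: "0 < ?s" "?s \<le> tm n n" "tm n n - ?s = \<sigma>\<^sup>2 * m" using sigma n by (auto simp: tm_def m_def algebra_simps)
    have ss: "sqrt ?s = \<sigma> * m" using sigma by (simp add: real_sqrt_mult m_def)
    have th: "0 < theta n x" by (rule theta_pos[OF n x])
    have e1: "1 / m \<le> ?e"
    proof -
      have "m powr (-1) \<le> ?e" using m beta by (intro powr_mono) auto
      then show ?thesis using m by (simp add: powr_minus_divide)
    qed
    let ?d = "\<bar>kq U (tm n n) x - kq U ?s x\<bar>"
    have V: "0 \<le> Vh x" "Vh x \<le> Cv * (1 + x)" using Cv(2)[OF x] x by auto
    have "Vh x * ?d \<le> 32 / \<sigma> * Cv * theta n x * ?e \<or> Vh x * ?d \<le> 16 * Cv * theta n x * ?e"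
    proof (cases "x \<le> m")
      case True
      have "?d \<le> 16 * (tm n n - ?s) / (?s * sqrt ?s)" by (rule kq_time[OF s(1,2)])
      also have "\<dots> = 16 / \<sigma> * (1 / m * (1 / m))" unfolding s(3) ss unfolding m(2)[symmetric] using sigma m(1) by simp
      finally have "Vh x * ?d \<le> Cv * (1 + x) * (16 / \<sigma> * (1 / m * (1 / m)))" using V Cv(1) x by (intro mult_mono) auto
      also have "\<dots> = 16 / \<sigma> * Cv * ((1 + x) / m) * (1 / m)" by (simp add: mult_ac)
      also have "\<dots> \<le> 16 / \<sigma> * Cv * (2 * theta n x) * ?e"
        using theta_small[OF n x] True sigma Cv(1) e1 th m unfolding m_def[symmetric] by (intro mult_mono mult_left_mono) auto
      finally show ?thesis by (simp add: mult_ac)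
    next
      case False
      have "Vh x * ?d \<le> (2 * Cv * x) * ?d"
      proof (rule mult_right_mono)
        have "Cv * (1 + x) \<le> Cv * (2 * x)" using False m Cv(1) by (intro mult_left_mono) auto
        then show "Vh x \<le> 2 * Cv * x" using V by simp
      qed simp
      also have "\<dots> = 2 * Cv * (\<bar>x\<bar> * ?d)" using x by simp
      also have "\<dots> \<le> 2 * Cv * (8 * (tm n n - ?s) / ?s)"
        using kq_time2[OF s(1,2), of x U] Cv(1) by (intro mult_left_mono) auto
      also have "\<dots> = 16 * Cv * (1 / m)" unfolding s(3) unfolding m(2)[symmetric] using sigma m(1) by simp
      also have "\<dots> \<le> 16 * Cv * ?e" using e1 Cv(1) by (intro mult_left_mono) auto
      finally show ?thesis using theta_big[OF n, of x] False by (simp add: m_def)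
    qed
    moreover have "0 \<le> 32 / \<sigma> * Cv * theta n x * ?e" "0 \<le> 16 * Cv * theta n x * ?e" using Cv(1) sigma th by auto
    moreover have "(32 / \<sigma> * Cv + 16 * Cv) * theta n x * ?e = 32 / \<sigma> * Cv * theta n x * ?e + 16 * Cv * theta n x * ?e"
      by (simp only: distrib_right)
    ultimately have "Vh x * ?d \<le> (32 / \<sigma> * Cv + 16 * Cv) * theta n x * ?e" by linarith
    then show "Vh x * ?d \<le> (32 / \<sigma> * Cv + 16 * Cv) * theta n x * sqrt (real n) powr (-(\<beta>/2))" unfolding m_def .
  qed
qed

lemma approx_nonneg: "\<exists>C>0. \<forall>n U x. 1 \<le> n \<longrightarrow> 0 \<le> U \<longrightarrow> 0 \<le> x \<longrightarrow>
  \<bar>(Q ^^ n) (indicator {..U}) x - Vh x * kq U (\<sigma>\<^sup>2 * real n) x\<bar> \<le> C * theta n x * sqrt (real n) powr (-(\<beta>/2))"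
proof -
  obtain C1 where C1: "C1 > 0" "\<And>n U x. 1 \<le> n \<Longrightarrow> 0 \<le> x \<Longrightarrow>
    \<bar>(Q ^^ n) (w U (tm n 0)) x - Vh x * kq U (tm n n) x\<bar> \<le> C1 * theta n x * sqrt (real n) powr (-(\<beta>/2))"
    using smooth_approx by blast
  obtain C2 where C2: "C2 > 0" "\<And>n U x. 1 \<le> n \<Longrightarrow> 0 \<le> x \<Longrightarrow>
    Vh x * \<bar>kq U (tm n n) x - kq U (\<sigma>\<^sup>2 * real n) x\<bar> \<le> C2 * theta n x * sqrt (real n) powr (-(\<beta>/2))"
    using time_shift by blast
  obtain C3 where C3: "C3 > 0" "\<And>n a x. 1 \<le> n \<Longrightarrow> 0 \<le> x \<Longrightarrow>
    (Q ^^ n) (\<lambda>y. bw (sqrt (tm n 0)) (tm n 0) (y - a)) x \<le> C3 * theta n x * sqrt (real n) powr (-(\<beta>/2))"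
    using Qn_bell by blast
  obtain Cv where Cv: "Cv \<ge> 1" "\<And>x. 0 \<le> x \<Longrightarrow> x \<le> Vh x \<and> Vh x \<le> Cv * (1 + x)" using Vh_bound by blast
  show ?thesis
  proof (intro exI conjI allI impI)
    show "0 < C1 + C2 + 12 * C3" using C1(1) C2(1) C3(1) by simp
    fix n :: nat and U x :: real assume n: "1 \<le> n" and U: "0 \<le> U" and x: "0 \<le> x"
    define T where "T = theta n x * sqrt (real n) powr (-(\<beta>/2))"
    let ?b = "\<lambda>a y. bw (sqrt (tm n 0)) (tm n 0) (y - a)"
    have "\<bar>(Q ^^ n) (\<lambda>y. indicator {..U} y - w U (tm n 0) y) x\<bar> \<le> (Q ^^ n) (\<lambda>y. 9 * ?b 0 y + 3 * ?b U y) x"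
    proof (rule Qn_abs_le[OF lin_growth_diff[OF lin_growth_ind_le lin_growth_w]
          lin_growth_add[OF lin_growth_cmult[OF lin_growth_bw] lin_growth_cmult[OF lin_growth_bw]] _ x])
      show "\<bar>indicator {..U} y - w U (tm n 0) y\<bar> \<le> 9 * ?b 0 y + 3 * ?b U y" if "0 \<le> y" for y
        using smoothing[OF tm_pos[OF n] U that, of 0] by simp
    qed
    also have "\<dots> = 9 * (Q ^^ n) (?b 0) x + 3 * (Q ^^ n) (?b U) x"
      unfolding Qn_add[OF lin_growth_cmult[OF lin_growth_bw] lin_growth_cmult[OF lin_growth_bw]] Qn_cmult ..
    also have "\<dots> \<le> 9 * (C3 * T) + 3 * (C3 * T)"
      using C3(2)[OF n x, of 0] C3(2)[OF n x, of U] unfolding T_def by (intro add_mono mult_left_mono) (auto simp: mult.assoc)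
    finally have 1: "\<bar>(Q ^^ n) (indicator {..U}) x - (Q ^^ n) (w U (tm n 0)) x\<bar> \<le> 12 * C3 * T"
      unfolding Qn_diff[OF lin_growth_ind_le lin_growth_w] by simp
    have 2: "\<bar>(Q ^^ n) (w U (tm n 0)) x - Vh x * kq U (tm n n) x\<bar> \<le> C1 * T"
      using C1(2)[OF n x, of U] by (simp add: T_def mult.assoc)
    have "0 \<le> Vh x" using Cv(2)[OF x] x by linarith
    then have "\<bar>Vh x * (kq U (tm n n) x - kq U (\<sigma>\<^sup>2 * real n) x)\<bar> \<le> C2 * T"
      using C2(2)[OF n x, of U] by (simp add: T_def abs_mult mult.assoc)
    then have 3: "\<bar>Vh x * kq U (tm n n) x - Vh x * kq U (\<sigma>\<^sup>2 * real n) x\<bar> \<le> C2 * T" by (simp add: algebra_simps)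
    have "\<bar>(Q ^^ n) (indicator {..U}) x - Vh x * kq U (\<sigma>\<^sup>2 * real n) x\<bar> \<le> 12 * C3 * T + C1 * T + C2 * T"
      using 1 2 3 by linarith
    then show "\<bar>(Q ^^ n) (indicator {..U}) x - Vh x * kq U (\<sigma>\<^sup>2 * real n) x\<bar> \<le> (C1 + C2 + 12 * C3) * theta n x * sqrt (real n) powr (-(\<beta>/2))"
      by (simp add: T_def distrib_right mult.assoc)
  qed
qed

section \<open>Negative starting points\<close>

definition Vp :: "real \<Rightarrow> real" where "Vp y = indicator {0..} y * Vh y"

lemma Vh_borel[measurable]: "Vh \<in> borel_measurable borel"
proof -
  have [measurable]: "(Q ^^ k) g \<in> borel_measurable borel" for k
    by (rule lin_growth_measurable[OF lin_growth_Qn[OF lin_growth_g]])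
  show ?thesis unfolding Vh_def[abs_def] by measurable
qed

lemma lin_growth_Vp: "lin_growth Vp"
proof -
  obtain C where C: "C \<ge> 1" "\<And>x. 0 \<le> x \<Longrightarrow> x \<le> Vh x \<and> Vh x \<le> C * (1 + x)" using Vh_bound by blast
  show ?thesis
  proof (rule lin_growthI[of _ C])
    show "Vp \<in> borel_measurable borel" unfolding Vp_def[abs_def] by measurable
    show "\<bar>Vp y\<bar> \<le> C * (1 + \<bar>y\<bar>)" for y
      using C(1) C(2)[of y] by (auto simp: Vp_def indicator_def)
  qed
qed

lemma Vp_nonneg: "0 \<le> Vp y"
proof -
  have "0 \<le> Vh y" if "0 \<le> y" using Vh_bound that by (meson order_trans)
  then show ?thesis by (simp add: Vp_def indicator_def)
qed

text \<open>Harmonicity for the killed walk, at negative points too. \<open>Q_idp\<close> accounts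
  for \<open>x\<close> and the first term of the series; the other terms are \<open>Q\<close>
  applied to the partial sums, and \<open>Vp\<close> is the majorant for passing to the
  limit.\<close>

lemma Vh_eq_Q: "Vh x = Q Vp x"
proof -
  define S where "S y = (\<Sum>k. (Q ^^ k) g y)" for y
  have S_borel[measurable]: "S \<in> borel_measurable borel"
  proof -
    have [measurable]: "(Q ^^ k) g \<in> borel_measurable borel" for k
      by (rule lin_growth_measurable[OF lin_growth_Qn[OF lin_growth_g]])
    show ?thesis unfolding S_def[abs_def] by measurable
  qed
  define P where "P n y = (\<Sum>k<n. (Q ^^ k) g y)" for n y
  have lgP: "lin_growth (P n)" for n unfolding P_def[abs_def] by (intro lin_growth_sum lin_growth_Qn lin_growth_g)
  have P0: "0 \<le> P n y" "P n y \<le> Vh y" if "0 \<le> y" for n y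
  proof -
    show "0 \<le> P n y" unfolding P_def by (intro sum_nonneg Qn_g_nonneg that)
    have "P n y \<le> S y" unfolding P_def S_def
      by (rule sum_le_suminf[OF summable_Qn_g[OF that]]) (auto intro: Qn_g_nonneg that)
    then show "P n y \<le> Vh y" using that by (simp add: Vh_def S_def)
  qed
  have tend: "(\<lambda>n. Q (P n) x) \<longlonglongrightarrow> (\<integral>\<xi>. indicator {0..} (x + \<xi>) * S (x + \<xi>) \<partial>\<mu>)"
    unfolding Q_def
  proof (rule integral_dominated_convergence[where w = "\<lambda>\<xi>. Vp (x + \<xi>)"])
    show "integrable \<mu> (\<lambda>\<xi>. Vp (x + \<xi>))" by (rule int_lin_growth[OF lin_growth_Vp])
    show "AE \<xi> in \<mu>. (\<lambda>n. indicator {0..} (x + \<xi>) * P n (x + \<xi>)) \<longlonglongrightarrow> indicator {0..} (x + \<xi>) * S (x + \<xi>)"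
    proof (rule AE_I2)
      fix \<xi>
      show "(\<lambda>n. indicator {0..} (x + \<xi>) * P n (x + \<xi>)) \<longlonglongrightarrow> indicator {0..} (x + \<xi>) * S (x + \<xi>)"
      proof (cases "0 \<le> x + \<xi>")
        case True
        have "(\<lambda>n. P n (x + \<xi>)) \<longlonglongrightarrow> S (x + \<xi>)"
          unfolding P_def S_def by (rule summable_LIMSEQ[OF summable_Qn_g[OF True]])
        then show ?thesis by (intro tendsto_mult tendsto_const)
      qed simp
    qed
    show "AE \<xi> in \<mu>. norm (indicator {0..} (x + \<xi>) * P n (x + \<xi>)) \<le> Vp (x + \<xi>)" for n
      using P0[of "x + _" n] by (intro AE_I2) (auto simp: Vp_def indicator_def)
    show "(\<lambda>\<xi>. indicator {0..} (x + \<xi>) * P n (x + \<xi>)) \<in> borel_measurable \<mu>" for n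
      using lin_growth_measurable[OF lgP] by measurable
  qed measurable
  have QP: "Q (P n) x = (\<Sum>k<n. (Q ^^ Suc k) g x)" for n
    unfolding P_def[abs_def] by (subst Q_sum) (auto intro: lin_growth_Qn lin_growth_g)
  have "(\<lambda>k. (Q ^^ Suc k) g x) sums (\<integral>\<xi>. indicator {0..} (x + \<xi>) * S (x + \<xi>) \<partial>\<mu>)"
    using tend unfolding QP sums_def .
  then have "(\<lambda>k. (Q ^^ k) g x) sums ((\<integral>\<xi>. indicator {0..} (x + \<xi>) * S (x + \<xi>) \<partial>\<mu>) + (Q ^^ 0) g x)"
    by (rule sums_Suc_iff[THEN iffD1, of "\<lambda>k. (Q ^^ k) g x"])
  then have "Vh x = (x + g x) + (\<integral>\<xi>. indicator {0..} (x + \<xi>) * S (x + \<xi>) \<partial>\<mu>)"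
    unfolding Vh_def by (simp add: sums_iff)
  also have "x + g x = Q idp x" by (simp add: Q_idp)
  also have "Q idp x + (\<integral>\<xi>. indicator {0..} (x + \<xi>) * S (x + \<xi>) \<partial>\<mu>)
      = (\<integral>\<xi>. indicator {0..} (x + \<xi>) * idp (x + \<xi>) + indicator {0..} (x + \<xi>) * S (x + \<xi>) \<partial>\<mu>)"
    unfolding Q_def
  proof (rule Bochner_Integration.integral_add[symmetric])
    show "integrable \<mu> (\<lambda>\<xi>. indicator {0..} (x + \<xi>) * idp (x + \<xi>))" by (rule int_Q[OF lin_growth_idp])
    have S0: "0 \<le> S y \<and> S y \<le> Vh y" if "0 \<le> y" for y
      using suminf_nonneg[OF summable_Qn_g[OF that] Qn_g_nonneg[OF that]] that by (simp add: S_def Vh_def)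
    show "integrable \<mu> (\<lambda>\<xi>. indicator {0..} (x + \<xi>) * S (x + \<xi>))"
    proof (rule Bochner_Integration.integrable_bound[OF int_lin_growth[OF lin_growth_Vp, of x]])
      have "norm (indicator {0..} (x + \<xi>) * S (x + \<xi>)) \<le> norm (Vp (x + \<xi>))" for \<xi>
      proof (cases "0 \<le> x + \<xi>")
        case True
        then show ?thesis using S0[OF True] by (simp add: Vp_def)
      qed simp
      then show "AE \<xi> in \<mu>. norm (indicator {0..} (x + \<xi>) * S (x + \<xi>)) \<le> norm (Vp (x + \<xi>))"
        by (intro AE_I2)
    qed measurable
  qed
  also have "\<dots> = Q Vp x" unfolding Q_def
  proof (intro Bochner_Integration.integral_cong refl)
    fix \<xi>
    show "indicator {0..} (x + \<xi>) * idp (x + \<xi>) + indicator {0..} (x + \<xi>) * S (x + \<xi>) = indicator {0..} (x + \<xi>) * Vp (x + \<xi>)"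
      by (cases "0 \<le> x + \<xi>") (simp_all add: Vp_def Vh_def S_def)
  qed
  finally show ?thesis .
qed

lemma Vh_nonneg: "0 \<le> Vh x"
  unfolding Vh_eq_Q Q_def by (rule Bochner_Integration.integral_nonneg) (simp add: Vp_nonneg)

text \<open>Keeps \<open>Vh\<close> away from 0 at the origin: for a centred step the mean of
  |\<xi>| is \<open>2 * g 0\<close>, which could vanish only together with the variance.\<close>

lemma pos_mean: "0 < g 0"
proof -
  have a: "(\<integral>\<xi>. \<bar>\<xi>\<bar> \<partial>\<mu>) = 2 * g 0"
  proof -
    have "(\<integral>\<xi>. \<bar>\<xi>\<bar> \<partial>\<mu>) = (\<integral>\<xi>. 2 * overshoot 0 \<xi> + \<xi> \<partial>\<mu>)"
      by (intro Bochner_Integration.integral_cong) (auto simp: overshoot_def)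
    also have "\<dots> = 2 * g 0 + (\<integral>\<xi>. \<xi> \<partial>\<mu>)" unfolding g_def using int_over int_id by simp
    finally show ?thesis by (simp add: mean0)
  qed
  have "(\<integral>\<xi>. \<bar>\<xi>\<bar> \<partial>\<mu>) \<noteq> 0"
  proof
    assume "(\<integral>\<xi>. \<bar>\<xi>\<bar> \<partial>\<mu>) = 0"
    then have "AE \<xi> in \<mu>. \<bar>\<xi>\<bar> = 0"
      using integral_nonneg_eq_0_iff_AE[OF int_abs] by simp
    then have "(\<integral>\<xi>. \<xi>\<^sup>2 \<partial>\<mu>) = (\<integral>\<xi>. 0 \<partial>\<mu>)" by (intro integral_cong_AE) auto
    then show False using var sigma by simp
  qed
  then show ?thesis using a g_nonneg[of 0] by linarith
qed

text \<open>\<open>Vh x\<close> is at least x, and also at least \<open>x + g x\<close>, which is at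
  least \<open>g 0\<close> because lowering the starting point by x raises the overshoot by at most
  x. A weighted sum of the two bounds gives the linear one.\<close>

lemma Vh_lower: "\<exists>c>0. \<forall>x\<ge>0. c * (1 + x) \<le> Vh x"
proof (intro exI conjI allI impI)
  define p where "p = g 0"
  have p: "0 < p" using pos_mean by (simp add: p_def)
  show "0 < g 0 / (1 + g 0)" using p by (simp add: p_def)
  fix x :: real assume x: "0 \<le> x"
  have V: "x + g x \<le> Vh x"
  proof -
    have "(\<Sum>k<1. (Q ^^ k) g x) \<le> (\<Sum>k. (Q ^^ k) g x)"
      by (rule sum_le_suminf[OF summable_Qn_g[OF x]]) (auto intro: Qn_g_nonneg x)
    then show ?thesis by (simp add: Vh_def)
  qed
  have "g 0 \<le> x + g x"
  proof -
    have "g 0 = (\<integral>\<xi>. overshoot 0 \<xi> \<partial>\<mu>)" by (simp add: g_def)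
    also have "\<dots> \<le> (\<integral>\<xi>. x + overshoot x \<xi> \<partial>\<mu>)"
    proof (rule integral_mono[OF int_over])
      show "integrable \<mu> (\<lambda>\<xi>. x + overshoot x \<xi>)" using int_over by simp
      show "overshoot 0 \<xi> \<le> x + overshoot x \<xi>" for \<xi> using x by (auto simp: overshoot_def)
    qed
    also have "\<dots> = x + g x" using int_over prob_space by (simp add: g_def)
    finally show ?thesis .
  qed
  then have "p \<le> Vh x" "x \<le> Vh x" using V g_nonneg[of x] by (auto simp: p_def)
  then have "p * 1 + x * p \<le> Vh x * 1 + Vh x * p" using p by (intro add_mono mult_right_mono) auto
  then have "p * (1 + x) \<le> Vh x * (1 + p)" by (simp add: algebra_simps)
  then show "g 0 / (1 + g 0) * (1 + x) \<le> Vh x" using p by (simp add: p_def divide_le_eq)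
qed

lemma powr_tail:
  assumes "1 \<le> m" "m \<le> \<bar>\<xi>\<bar>" "0 \<le> q" "q \<le> 2 + \<delta>"
  shows "\<bar>\<xi>\<bar> powr q \<le> m powr (q - 2 - \<delta>) * \<bar>\<xi>\<bar> powr (2 + \<delta>)"
proof -
  have "\<bar>\<xi>\<bar> powr q = \<bar>\<xi>\<bar> powr (q - 2 - \<delta>) * \<bar>\<xi>\<bar> powr (2 + \<delta>)" by (subst powr_add[symmetric]) simp
  also have "\<dots> \<le> m powr (q - 2 - \<delta>) * \<bar>\<xi>\<bar> powr (2 + \<delta>)"
    using assms by (intro mult_right_mono powr_mono2') auto
  finally show ?thesis .
qed

lemma kq_n_bound: assumes "1 \<le> n" shows "\<bar>kq U (\<sigma>\<^sup>2 * real n) x\<bar> \<le> 4 / (\<sigma> * sqrt (real n))"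
proof -
  have "sqrt (\<sigma>\<^sup>2 * real n) = \<sigma> * sqrt (real n)" using sigma by (simp add: real_sqrt_mult)
  then show ?thesis using kq_bound[of "\<sigma>\<^sup>2 * real n" U x] assms sigma by simp
qed

lemma Q_ind_bounds: "0 \<le> (Q ^^ Suc k) (indicator {..U}) x" "(Q ^^ Suc k) (indicator {..U}) x \<le> Q (\<lambda>_. 1) x"
proof -
  have b: "0 \<le> (Q ^^ k) (indicator {..U}) y" "(Q ^^ k) (indicator {..U}) y \<le> 1" if "0 \<le> y" for y
  proof -
    show "0 \<le> (Q ^^ k) (indicator {..U}) y" by (rule Qn_nonneg[OF lin_growth_ind_le _ that]) simp
    have "(Q ^^ k) (indicator {..U}) y \<le> 1 * surv k y"
      by (rule Qn_le_surv[OF lin_growth_ind_le _ that]) (simp add: indicator_def)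
    then show "(Q ^^ k) (indicator {..U}) y \<le> 1" using surv_bounds(2)[OF that, of k] by simp
  qed
  have "Q (\<lambda>_. 0 * 1) x \<le> Q ((Q ^^ k) (indicator {..U})) x"
    by (rule Q_mono[OF lin_growth_const lin_growth_Qn[OF lin_growth_ind_le]]) (simp add: b(1))
  then show "0 \<le> (Q ^^ Suc k) (indicator {..U}) x" unfolding Qn_Suc Q_cmult by simp
  show "(Q ^^ Suc k) (indicator {..U}) x \<le> Q (\<lambda>_. 1) x" unfolding Qn_Suc
    by (rule Q_mono[OF lin_growth_Qn[OF lin_growth_ind_le] lin_growth_const b(2)])
qed

text \<open>Both terms are small separately: staying alive requires a first step longer than sqrt n,
  and the moment of order \<open>2 + \<delta>\<close> bounds its probability as well as
  \<open>Vh x\<close>, which is an expectation over the first step.\<close>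

lemma approx_far: "\<exists>C>0. \<forall>n U x. 1 \<le> n \<longrightarrow> x < - sqrt (real n) \<longrightarrow>
  \<bar>(Q ^^ n) (indicator {..U}) x - Vh x * kq U (\<sigma>\<^sup>2 * real n) x\<bar> \<le> C * sqrt (real n) powr (-1 - \<delta>/2)"
proof -
  obtain Cv where Cv: "Cv \<ge> 1" "\<And>x. 0 \<le> x \<Longrightarrow> x \<le> Vh x \<and> Vh x \<le> Cv * (1 + x)" using Vh_bound by blast
  show ?thesis
  proof (intro exI conjI allI impI)
    have "0 \<le> 8 / \<sigma> * Cv * Mom" using Cv(1) sigma Mom_nonneg by simp
    then show "0 < Mom + 8 / \<sigma> * Cv * Mom + 1" using Mom_nonneg by linarith
    fix n :: nat and U x :: real assume n: "1 \<le> n" and x: "x < - sqrt (real n)"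
    define m where "m = sqrt (real n)"
    have m: "1 \<le> m" using n by (simp add: m_def)
    have big: "m \<le> \<bar>\<xi>\<bar>" if "0 \<le> x + \<xi>" for \<xi> using x that by (simp add: m_def)
    let ?e = "m powr (-1 - \<delta>/2)"
    have "Q (\<lambda>_. 1) x \<le> (\<integral>\<xi>. m powr (0 - 2 - \<delta>) * \<bar>\<xi>\<bar> powr (2 + \<delta>) \<partial>\<mu>)"
      unfolding Q_def
    proof (rule integral_mono[OF int_Q[OF lin_growth_const]])
      fix \<xi> show "indicator {0..} (x + \<xi>) * 1 \<le> m powr (0 - 2 - \<delta>) * \<bar>\<xi>\<bar> powr (2 + \<delta>)"
      proof (cases "0 \<le> x + \<xi>")
        case True
        have "\<bar>\<xi>\<bar> powr 0 = 1" using big[OF True] m by auto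
        then show ?thesis using powr_tail[OF m big[OF True], of 0] delta True by (simp del: powr_zero_eq_one)
      qed simp
    qed (use mom in auto)
    also have "\<dots> = m powr (-2 - \<delta>) * Mom" by (simp add: Mom_def)
    also have "\<dots> \<le> ?e * Mom" using m delta Mom_nonneg by (intro mult_right_mono powr_mono) auto
    finally have q1: "Q (\<lambda>_. 1) x \<le> Mom * ?e" by (simp add: mult.commute)
    obtain k where k: "n = Suc k" using n by (cases n) auto
    have a: "0 \<le> (Q ^^ n) (indicator {..U}) x" "(Q ^^ n) (indicator {..U}) x \<le> Mom * ?e"
      using Q_ind_bounds[of k U x] q1 unfolding k by linarith+
    have "Vh x \<le> (\<integral>\<xi>. 2 * Cv * (m powr (1 - 2 - \<delta>) * \<bar>\<xi>\<bar> powr (2 + \<delta>)) \<partial>\<mu>)"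
      unfolding Vh_eq_Q Q_def
    proof (rule integral_mono[OF int_Q[OF lin_growth_Vp]])
      fix \<xi>
      show "indicator {0..} (x + \<xi>) * Vp (x + \<xi>) \<le> 2 * Cv * (m powr (1 - 2 - \<delta>) * \<bar>\<xi>\<bar> powr (2 + \<delta>))"
      proof (cases "0 \<le> x + \<xi>")
        case True
        have "Vp (x + \<xi>) \<le> Cv * (1 + (x + \<xi>))" using Cv(2)[OF True] True by (simp add: Vp_def)
        also have "\<dots> \<le> Cv * (2 * \<bar>\<xi>\<bar>)"
          using x m big[OF True] Cv(1) unfolding m_def[symmetric] by (intro mult_left_mono) auto
        also have "\<bar>\<xi>\<bar> = \<bar>\<xi>\<bar> powr 1" by simp
        also have "\<dots> \<le> m powr (1 - 2 - \<delta>) * \<bar>\<xi>\<bar> powr (2 + \<delta>)"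
          using powr_tail[OF m big[OF True], of 1] delta by simp
        finally show ?thesis using True Cv(1) by (simp add: mult_left_mono)
      next
        case False
        then show ?thesis using Cv(1) by simp
      qed
    qed (use mom in auto)
    also have "\<dots> = 2 * Cv * (m powr (-1 - \<delta>) * Mom)" using mom by (simp add: Mom_def)
    also have "\<dots> \<le> 2 * Cv * (?e * Mom)" using m delta Mom_nonneg Cv(1) by (intro mult_left_mono mult_right_mono powr_mono) auto
    finally have v: "Vh x \<le> 2 * Cv * (?e * Mom)" .
    have "\<bar>kq U (\<sigma>\<^sup>2 * real n) x\<bar> \<le> 4 / (\<sigma> * m)" unfolding m_def by (rule kq_n_bound[OF n])
    also have "\<dots> \<le> 4 / \<sigma>" using m sigma by (intro divide_left_mono) auto
    finally have "\<bar>Vh x * kq U (\<sigma>\<^sup>2 * real n) x\<bar> \<le> 2 * Cv * (?e * Mom) * (4 / \<sigma>)"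
      unfolding abs_mult using v Vh_nonneg[of x] sigma Cv(1) Mom_nonneg by (intro mult_mono) auto
    then have b: "\<bar>Vh x * kq U (\<sigma>\<^sup>2 * real n) x\<bar> \<le> 8 / \<sigma> * Cv * Mom * ?e" by (simp add: mult_ac)
    have "\<bar>(Q ^^ n) (indicator {..U}) x - Vh x * kq U (\<sigma>\<^sup>2 * real n) x\<bar> \<le> Mom * ?e + 8 / \<sigma> * Cv * Mom * ?e + 1 * ?e"
      using a b powr_ge_zero[of m "-1 - \<delta>/2"] by linarith
    then show "\<bar>(Q ^^ n) (indicator {..U}) x - Vh x * kq U (\<sigma>\<^sup>2 * real n) x\<bar> \<le> (Mom + 8 / \<sigma> * Cv * Mom + 1) * sqrt (real n) powr (-1 - \<delta>/2)"
      by (simp only: distrib_right m_def)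
  qed
qed

text \<open>With n = 1 no step remains after the first one, so the reduction in
  \<open>approx_near\<close> does not start; boundedness is enough here.\<close>

lemma approx_one_neg: "\<exists>C>0. \<forall>U x. x < 0 \<longrightarrow>
  \<bar>(Q ^^ 1) (indicator {..U}) x - Vh x * kq U (\<sigma>\<^sup>2 * real 1) x\<bar> \<le> C"
proof -
  obtain Cv where Cv: "Cv \<ge> 1" "\<And>x. 0 \<le> x \<Longrightarrow> x \<le> Vh x \<and> Vh x \<le> Cv * (1 + x)" using Vh_bound by blast
  define B where "B = Cv * (1 + (\<integral>\<xi>. \<bar>\<xi>\<bar> \<partial>\<mu>))"
  have B: "0 \<le> B" using Cv(1) by (simp add: B_def)
  show ?thesis
  proof (intro exI conjI allI impI)
    have "0 \<le> B * (4 / \<sigma>)" using B sigma by simp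
    then show "0 < 1 + B * (4 / \<sigma>)" by linarith
    fix U x :: real assume x: "x < 0"
    have "Vh x \<le> (\<integral>\<xi>. Cv * (1 + \<bar>\<xi>\<bar>) \<partial>\<mu>)"
      unfolding Vh_eq_Q Q_def
    proof (rule integral_mono[OF int_Q[OF lin_growth_Vp]])
      fix \<xi>
      show "indicator {0..} (x + \<xi>) * Vp (x + \<xi>) \<le> Cv * (1 + \<bar>\<xi>\<bar>)"
      proof (cases "0 \<le> x + \<xi>")
        case True
        have "Vp (x + \<xi>) \<le> Cv * (1 + (x + \<xi>))" using Cv(2)[OF True] True by (simp add: Vp_def)
        also have "\<dots> \<le> Cv * (1 + \<bar>\<xi>\<bar>)" using x Cv(1) by (intro mult_left_mono) auto
        finally show ?thesis using True by simp
      qed (use Cv(1) in simp)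
    qed (use int_abs in auto)
    also have "\<dots> = B" using int_abs prob_space by (simp add: B_def)
    finally have v: "Vh x \<le> B" .
    have "\<bar>kq U (\<sigma>\<^sup>2 * real 1) x\<bar> \<le> 4 / \<sigma>" using kq_n_bound[of 1 U x] by simp
    then have b: "\<bar>Vh x * kq U (\<sigma>\<^sup>2 * real 1) x\<bar> \<le> B * (4 / \<sigma>)"
      unfolding abs_mult using v Vh_nonneg[of x] B by (intro mult_mono) auto
    have "0 \<le> (Q ^^ 1) (indicator {..U}) x" "(Q ^^ 1) (indicator {..U}) x \<le> 1"
      using Q_ind_bounds[of 0 U x] Q_const_le(1)[of x] by (simp_all del: funpow.simps add: One_nat_def)
    then show "\<bar>(Q ^^ 1) (indicator {..U}) x - Vh x * kq U (\<sigma>\<^sup>2 * real 1) x\<bar> \<le> 1 + B * (4 / \<sigma>)"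
      using b by linarith
  qed
qed

text \<open>Condition on the first step and use \<open>approx_nonneg\<close> for the other k = n -
  1. Its error is at most a multiple of \<open>Vh y / sqrt n\<close> times the rate, and by
  harmonicity this integrates to the same multiple of \<open>Vh x\<close>. It remains to move the
  quotient from the new position y and time k back to x and time n.\<close>

lemma approx_near: "\<exists>C>0. \<forall>n U x. 2 \<le> n \<longrightarrow> 0 \<le> U \<longrightarrow> x < 0 \<longrightarrow>
  \<bar>(Q ^^ n) (indicator {..U}) x - Vh x * kq U (\<sigma>\<^sup>2 * real n) x\<bar>
    \<le> C * (Vh x * sqrt (real n) powr (-1 - \<beta>/2) + sqrt (real n) powr (-1 - \<delta>/2))"
proof -
  obtain Cv where Cv: "Cv \<ge> 1" "\<And>x. 0 \<le> x \<Longrightarrow> x \<le> Vh x \<and> Vh x \<le> Cv * (1 + x)" using Vh_bound by blast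
  obtain cv where cv: "cv > 0" "\<And>x. 0 \<le> x \<Longrightarrow> cv * (1 + x) \<le> Vh x" using Vh_lower by blast
  obtain C1 where C1: "C1 > 0" "\<And>n U x. 1 \<le> n \<Longrightarrow> 0 \<le> U \<Longrightarrow> 0 \<le> x \<Longrightarrow>
    \<bar>(Q ^^ n) (indicator {..U}) x - Vh x * kq U (\<sigma>\<^sup>2 * real n) x\<bar> \<le> C1 * theta n x * sqrt (real n) powr (-(\<beta>/2))"
    using approx_nonneg by blast
  let ?D1 = "C1 / cv * 4"
  let ?D2 = "64 / \<sigma> + 32 / \<sigma>\<^sup>2"
  let ?D3 = "16 * Cv / \<sigma> * Mom"
  have D: "0 < ?D1" "0 < ?D2" "0 \<le> ?D3" using C1(1) cv(1) sigma Cv(1) Mom_nonneg by (auto intro!: add_pos_pos)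
  show ?thesis
  proof (intro exI conjI allI impI)
    show "0 < ?D1 + ?D2 + ?D3" using D by linarith
    fix n :: nat and U x :: real assume n2: "2 \<le> n" and U: "0 \<le> U" and x: "x < 0"
    obtain k where k: "n = Suc k" "1 \<le> k" using n2 by (cases n) auto
    define m where "m = sqrt (real n)"
    define l where "l = sqrt (real k)"
    have m: "1 \<le> m" "m * m = real n" using n2 by (auto simp: m_def)
    have l: "1 \<le> l" "l * l = real k" using k by (auto simp: l_def)
    have ml: "m \<le> 2 * l"
    proof -
      have "real n \<le> 4 * real k" using k by simp
      then have "sqrt (real n) \<le> sqrt (4 * real k)" by (rule real_sqrt_le_mono)
      then show ?thesis by (simp add: m_def l_def real_sqrt_mult)
    qed
    let ?e = "m powr (-1 - \<beta>/2)"
    have me: "1 / m * m powr (-(\<beta>/2)) = ?e" using m powr_add[of m "-1" "-(\<beta>/2)"] by (simp add: powr_minus_divide)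
    define ek where "ek y = kq U (\<sigma>\<^sup>2 * real k) y" for y
    define en where "en = kq U (\<sigma>\<^sup>2 * real n) x"
    have lgk: "lin_growth (\<lambda>y. Vp y * ek y)"
    proof (rule lin_growth_dominated[OF lin_growth_cmult[OF lin_growth_Vp, of "4 / (\<sigma> * l)"]])
      show "(\<lambda>y. Vp y * ek y) \<in> borel_measurable borel" unfolding ek_def using lin_growth_measurable[OF lin_growth_Vp] by measurable
      show "\<bar>Vp y * ek y\<bar> \<le> \<bar>4 / (\<sigma> * l) * Vp y\<bar>" for y
        using kq_n_bound[OF k(2), of U y] sigma l Vp_nonneg[of y] mult_left_mono[of "\<bar>ek y\<bar>" "4 / (\<sigma> * l)" "Vp y"]
        by (simp add: abs_mult ek_def l_def mult.commute)
    qed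
    have 1: "\<bar>Q (\<lambda>y. (Q ^^ k) (indicator {..U}) y - Vp y * ek y) x\<bar> \<le> ?D1 * (Vh x * ?e)"
    proof -
      have lg: "lin_growth (\<lambda>y. (Q ^^ k) (indicator {..U}) y - Vp y * ek y)"
        by (intro lin_growth_diff lin_growth_Qn lin_growth_ind_le lgk)
      have b: "\<bar>(Q ^^ k) (indicator {..U}) y - Vp y * ek y\<bar> \<le> (?D1 * ?e) * Vp y" if y: "0 \<le> y" for y
      proof -
        have "\<bar>(Q ^^ k) (indicator {..U}) y - Vp y * ek y\<bar> \<le> C1 * theta k y * l powr (-(\<beta>/2))"
          using C1(2)[OF k(2) U y] y by (simp add: Vp_def ek_def l_def)
        also have "\<dots> \<le> C1 * (1 / cv * Vh y * (2 / m)) * (2 * m powr (-(\<beta>/2)))"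
        proof (intro mult_mono mult_left_mono)
          have "theta k y \<le> (1 + y) / l" by (simp add: theta_def l_def)
          also have "\<dots> \<le> (1 + y) * (2 / m)"
          proof -
            have "1 / l \<le> 2 / m" using ml m l by (simp add: field_simps)
            from mult_left_mono[OF this, of "1 + y"] show ?thesis using y by simp
          qed
          also have "\<dots> \<le> (1 / cv * Vh y) * (2 / m)"
            using cv(2)[OF y] cv(1) m by (intro mult_right_mono) (auto simp: field_simps)
          finally show "theta k y \<le> 1 / cv * Vh y * (2 / m)" .
          have "l powr (-(\<beta>/2)) \<le> (1/2 * m) powr (-(\<beta>/2))" using ml m beta by (intro powr_mono2') auto
          also have "\<dots> = (1/2) powr (-(\<beta>/2)) * m powr (-(\<beta>/2))" by (rule powr_mult)
          also have "\<dots> \<le> (1/2) powr (-1) * m powr (-(\<beta>/2))" using beta by (intro mult_right_mono powr_mono') auto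
          also have "(1/2::real) powr (-1) = 2" by (simp add: powr_minus_divide)
          finally show "l powr (-(\<beta>/2)) \<le> 2 * m powr (-(\<beta>/2))" .
        qed (use C1(1) cv(1) m Vh_nonneg[of y] theta_pos[OF k(2) y] in auto)
        also have "\<dots> = ?D1 * (1 / m * m powr (-(\<beta>/2))) * Vh y" by simp
        finally show ?thesis using y unfolding me by (simp add: Vp_def)
      qed
      have "\<bar>Q (\<lambda>y. (Q ^^ k) (indicator {..U}) y - Vp y * ek y) x\<bar> \<le> Q (\<lambda>y. (?D1 * ?e) * Vp y) x"
      proof (rule abs_leI)
        show "Q (\<lambda>y. (Q ^^ k) (indicator {..U}) y - Vp y * ek y) x \<le> Q (\<lambda>y. (?D1 * ?e) * Vp y) x"
          by (rule Q_mono[OF lg lin_growth_cmult[OF lin_growth_Vp]]) (use b in \<open>meson abs_le_D1\<close>)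
        have "Q (\<lambda>y. -1 * ((Q ^^ k) (indicator {..U}) y - Vp y * ek y)) x \<le> Q (\<lambda>y. (?D1 * ?e) * Vp y) x"
          by (rule Q_mono[OF lin_growth_cmult[OF lg] lin_growth_cmult[OF lin_growth_Vp]]) (use b in \<open>simp add: abs_le_iff\<close>)
        then show "- Q (\<lambda>y. (Q ^^ k) (indicator {..U}) y - Vp y * ek y) x \<le> Q (\<lambda>y. (?D1 * ?e) * Vp y) x"
          unfolding Q_cmult by simp
      qed
      also have "\<dots> = ?D1 * (Vh x * ?e)" unfolding Q_cmult Vh_eq_Q by simp
      finally show ?thesis .
    qed
    have 2: "\<bar>Q (\<lambda>y. Vp y * ek y) x - Vh x * en\<bar> \<le> ?D2 * (Vh x * ?e) + ?D3 * m powr (-1 - \<delta>/2)"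
    proof -
      have i1: "integrable \<mu> (\<lambda>\<xi>. indicator {0..} (x + \<xi>) * (Vp (x + \<xi>) * ek (x + \<xi>)))" by (rule int_Q[OF lgk])
      have i2: "integrable \<mu> (\<lambda>\<xi>. indicator {0..} (x + \<xi>) * Vp (x + \<xi>))" by (rule int_Q[OF lin_growth_Vp])
      let ?q = "m powr (-1 - \<delta>/2)"
      let ?F = "\<lambda>\<xi>. ?D2 * ?e * (indicator {0..} (x + \<xi>) * Vp (x + \<xi>)) + 16 * Cv / \<sigma> * ?q * \<bar>\<xi>\<bar> powr (2 + \<delta>)"
      have eq: "Q (\<lambda>y. Vp y * ek y) x - Vh x * en = (\<integral>\<xi>. indicator {0..} (x + \<xi>) * (Vp (x + \<xi>) * ek (x + \<xi>)) - (indicator {0..} (x + \<xi>) * Vp (x + \<xi>)) * en \<partial>\<mu>)"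
        unfolding Vh_eq_Q Q_def using i1 i2 by simp
      have "\<bar>Q (\<lambda>y. Vp y * ek y) x - Vh x * en\<bar> \<le> (\<integral>\<xi>. \<bar>indicator {0..} (x + \<xi>) * (Vp (x + \<xi>) * ek (x + \<xi>)) - (indicator {0..} (x + \<xi>) * Vp (x + \<xi>)) * en\<bar> \<partial>\<mu>)"
        unfolding eq by (rule integral_abs_bound)
      also have "\<dots> \<le> (\<integral>\<xi>. ?F \<xi> \<partial>\<mu>)"
      proof (rule integral_mono)
        show "integrable \<mu> ?F"
          by (rule Bochner_Integration.integrable_add[OF integrable_mult_right[OF i2] integrable_mult_right[OF mom]])
        show "integrable \<mu> (\<lambda>\<xi>. \<bar>indicator {0..} (x + \<xi>) * (Vp (x + \<xi>) * ek (x + \<xi>)) - (indicator {0..} (x + \<xi>) * Vp (x + \<xi>)) * en\<bar>)"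
          by (rule integrable_abs[OF Bochner_Integration.integrable_diff[OF i1 integrable_mult_left[OF i2]]])
        fix \<xi>
        show "\<bar>indicator {0..} (x + \<xi>) * (Vp (x + \<xi>) * ek (x + \<xi>)) - (indicator {0..} (x + \<xi>) * Vp (x + \<xi>)) * en\<bar> \<le> ?F \<xi>"
        proof (cases "0 \<le> x + \<xi>")
          case False
          then show ?thesis using Cv(1) sigma by simp
        next
          case True
          define y where "y = x + \<xi>"
          have y: "0 \<le> y" "\<bar>y\<bar> \<le> \<bar>\<xi>\<bar>" "\<bar>x\<bar> \<le> \<bar>\<xi>\<bar>" using True x by (auto simp: y_def)
          have V0: "0 \<le> Vp y" by (rule Vp_nonneg)
          have tn: "0 < \<sigma>\<^sup>2 * real n" "0 < \<sigma>\<^sup>2 * real k" using sigma n2 k by auto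
          have a: "\<bar>ek y - kq U (\<sigma>\<^sup>2 * real n) y\<bar> \<le> 64 / \<sigma> * ?e"
          proof -
            have sk: "sqrt (\<sigma>\<^sup>2 * real k) = \<sigma> * l" using sigma by (simp add: real_sqrt_mult l_def)
            have "\<bar>kq U (\<sigma>\<^sup>2 * real n) y - ek y\<bar> \<le> 16 * (\<sigma>\<^sup>2 * real n - \<sigma>\<^sup>2 * real k) / ((\<sigma>\<^sup>2 * real k) * sqrt (\<sigma>\<^sup>2 * real k))"
              unfolding ek_def using k by (intro kq_time tn) (auto intro!: mult_left_mono)
            also have "\<dots> = 16 / \<sigma> * (1 / l * (1 / real k))"
              unfolding sk using k sigma by (simp add: field_simps)
            also have "\<dots> \<le> 16 / \<sigma> * (2 / m * (2 / m))"
            proof (intro mult_mono mult_left_mono)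
              show "1 / l \<le> 2 / m" using ml m l by (simp add: field_simps)
              have "m * 1 \<le> m * m" using m by (intro mult_left_mono) auto
              then have "m \<le> 2 * real k" using m(2) k by simp
              then show "1 / real k \<le> 2 / m" using m k by (simp add: field_simps)
            qed (use sigma m l in auto)
            also have "\<dots> = 64 / \<sigma> * (1 / m * (1 / m))" by simp
            also have "\<dots> \<le> 64 / \<sigma> * (1 / m * m powr (-(\<beta>/2)))"
            proof (intro mult_left_mono)
              have "m powr (-1) \<le> m powr (-(\<beta>/2))" using m beta by (intro powr_mono) auto
              then show "1 / m \<le> m powr (-(\<beta>/2))" using m by (simp add: powr_minus_divide)
            qed (use m sigma in auto)
            finally show ?thesis unfolding me by (simp add: abs_minus_commute)
          qed
          \<comment> \<open>Jumps up to \<open>m powr (1 - \<beta>/2)\<close> move the quotient by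
            the Lipschitz bound, an error of order m^(1-\<beta>/2) / n, which is \<open>?e\<close>.
            Longer jumps are charged to the moment of order \<open>2 + \<delta>\<close>.\<close>
          have b: "Vp y * \<bar>kq U (\<sigma>\<^sup>2 * real n) y - en\<bar> \<le> 32 / \<sigma>\<^sup>2 * ?e * Vp y + 16 * Cv / \<sigma> * ?q * \<bar>\<xi>\<bar> powr (2 + \<delta>)"
          proof (cases "\<bar>\<xi>\<bar> \<le> m powr (1 - \<beta>/2)")
            case small: True
            have "\<bar>kq U (\<sigma>\<^sup>2 * real n) y - en\<bar> \<le> 16 * \<bar>y\<bar> / (\<sigma>\<^sup>2 * real n) + 16 * \<bar>x\<bar> / (\<sigma>\<^sup>2 * real n)"
              using kq_lipschitz_0[OF tn(1), of U y] kq_lipschitz_0[OF tn(1), of U x] unfolding en_def by linarith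
            also have "\<dots> \<le> 16 * \<bar>\<xi>\<bar> / (\<sigma>\<^sup>2 * real n) + 16 * \<bar>\<xi>\<bar> / (\<sigma>\<^sup>2 * real n)"
              using y tn by (intro add_mono divide_right_mono mult_left_mono) auto
            also have "\<dots> = 32 / \<sigma>\<^sup>2 * (\<bar>\<xi>\<bar> / real n)" by simp
            also have "\<dots> \<le> 32 / \<sigma>\<^sup>2 * (m powr (1 - \<beta>/2) / real n)"
              using small by (intro mult_left_mono divide_right_mono) auto
            also have "m powr (1 - \<beta>/2) / real n = m powr (1 - \<beta>/2) * m powr (-2)"
              using m by (simp add: powr_minus_divide power2_eq_square)
            also have "\<dots> = ?e" by (subst powr_add[symmetric]) simp
            finally have "Vp y * \<bar>kq U (\<sigma>\<^sup>2 * real n) y - en\<bar> \<le> Vp y * (32 / \<sigma>\<^sup>2 * ?e)" by (rule mult_left_mono[OF _ V0])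
            moreover have "0 \<le> 16 * Cv / \<sigma> * ?q * \<bar>\<xi>\<bar> powr (2 + \<delta>)" using Cv(1) sigma by simp
            ultimately show ?thesis by (simp add: mult_ac)
          next
            case False
            define r where "r = m powr (1 - \<beta>/2)"
            have r: "1 \<le> r" unfolding r_def using m beta by (intro ge_one_powr_ge_zero) auto
            have xi: "r \<le> \<bar>\<xi>\<bar>" using False by (simp add: r_def)
            have "Vp y \<le> Cv * (1 + y)" using Cv(2)[OF y(1)] y by (simp add: Vp_def)
            also have "\<dots> \<le> Cv * (2 * \<bar>\<xi>\<bar>)" using y xi r Cv(1) by (intro mult_left_mono) auto
            also have "\<bar>\<xi>\<bar> = \<bar>\<xi>\<bar> powr 1" by simp
            also have "\<dots> \<le> r powr (1 - 2 - \<delta>) * \<bar>\<xi>\<bar> powr (2 + \<delta>)" using powr_tail[OF r xi, of 1] delta by simp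
            also have "r powr (1 - 2 - \<delta>) \<le> m powr (-(\<delta>/2))"
            proof -
              \<comment> \<open>Since \<beta> < 1, the exponent 1 - \<beta>/2 of the threshold is at
                least 1/2, so the tail exponent is at least (1 + \<delta>)/2, more than the required
                \<delta>/2.\<close>
              have "(1 + \<delta>) * (1/2) \<le> (1 + \<delta>) * (1 - \<beta>/2)" using beta delta by (intro mult_left_mono) auto
              moreover have "(1 - \<beta>/2) * (1 - 2 - \<delta>) = - ((1 + \<delta>) * (1 - \<beta>/2))"
              proof -
                have "c * (1 - 2 - d) = - ((1 + d) * c)" for c d :: real by (simp add: algebra_simps)
                then show ?thesis .
              qed
              moreover have "(1 + d) * (1/2) \<le> P \<Longrightarrow> - P \<le> -(d/2)" for d P :: real by simp
              ultimately have "(1 - \<beta>/2) * (1 - 2 - \<delta>) \<le> -(\<delta>/2)" by metis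
              then show ?thesis unfolding r_def powr_powr using m by (intro powr_mono) auto
            qed
            finally have v: "Vp y \<le> Cv * (2 * (m powr (-(\<delta>/2)) * \<bar>\<xi>\<bar> powr (2 + \<delta>)))"
              using Cv(1) by (simp add: mult_left_mono mult_right_mono)
            have "\<bar>kq U (\<sigma>\<^sup>2 * real n) y - en\<bar> \<le> 4 / (\<sigma> * m) + 4 / (\<sigma> * m)"
              using kq_n_bound[of n U y] kq_n_bound[of n U x] n2 unfolding en_def m_def by linarith
            also have "\<dots> = 8 / \<sigma> * (1 / m)" by simp
            finally have "Vp y * \<bar>kq U (\<sigma>\<^sup>2 * real n) y - en\<bar> \<le> (Cv * (2 * (m powr (-(\<delta>/2)) * \<bar>\<xi>\<bar> powr (2 + \<delta>)))) * (8 / \<sigma> * (1 / m))"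
              using v V0 Cv(1) by (intro mult_mono) auto
            also have "\<dots> = 16 * Cv / \<sigma> * (1 / m * m powr (-(\<delta>/2))) * \<bar>\<xi>\<bar> powr (2 + \<delta>)" by simp
            also have "1 / m * m powr (-(\<delta>/2)) = ?q" using m powr_add[of m "-1" "-(\<delta>/2)"] by (simp add: powr_minus_divide)
            finally have "Vp y * \<bar>kq U (\<sigma>\<^sup>2 * real n) y - en\<bar> \<le> 16 * Cv / \<sigma> * ?q * \<bar>\<xi>\<bar> powr (2 + \<delta>)" .
            moreover have "0 \<le> 32 / \<sigma>\<^sup>2 * ?e * Vp y" using V0 by simp
            ultimately show ?thesis by linarith
          qed
          have "\<bar>Vp y * ek y - Vp y * en\<bar> = Vp y * \<bar>ek y - en\<bar>" using V0 by (simp add: abs_mult flip: right_diff_distrib)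
          also have "\<dots> \<le> Vp y * (\<bar>ek y - kq U (\<sigma>\<^sup>2 * real n) y\<bar> + \<bar>kq U (\<sigma>\<^sup>2 * real n) y - en\<bar>)"
            using V0 by (intro mult_left_mono) auto
          also have "\<dots> \<le> Vp y * (64 / \<sigma> * ?e) + (32 / \<sigma>\<^sup>2 * ?e * Vp y + 16 * Cv / \<sigma> * ?q * \<bar>\<xi>\<bar> powr (2 + \<delta>))"
            using mult_left_mono[OF a V0] b by (simp only: distrib_left)
          also have "\<dots> = ?D2 * ?e * Vp y + 16 * Cv / \<sigma> * ?q * \<bar>\<xi>\<bar> powr (2 + \<delta>)"
          proof -
            have "v * (a * e) + (b * e * v + r) = (a + b) * e * v + r" for v a e b r :: real by (simp add: algebra_simps)
            then show ?thesis .
          qed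
          finally show ?thesis using True by (simp add: y_def)
        qed
      qed
      also have "\<dots> = ?D2 * ?e * Vh x + 16 * Cv / \<sigma> * ?q * Mom"
        unfolding Vh_eq_Q Q_def Mom_def using i2 mom by simp
      finally show ?thesis by (simp add: mult_ac)
    qed
    have "(Q ^^ n) (indicator {..U}) x = Q ((Q ^^ k) (indicator {..U})) x" unfolding k(1) by simp
    moreover have "Q (\<lambda>y. (Q ^^ k) (indicator {..U}) y - Vp y * ek y) x = Q ((Q ^^ k) (indicator {..U})) x - Q (\<lambda>y. Vp y * ek y) x"
      using Qn_diff[OF lin_growth_Qn[OF lin_growth_ind_le] lgk, where n = 1, of k U] by simp
    ultimately have "\<bar>(Q ^^ n) (indicator {..U}) x - Vh x * en\<bar> \<le> ?D1 * (Vh x * ?e) + (?D2 * (Vh x * ?e) + ?D3 * m powr (-1 - \<delta>/2))"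
      using 1 2 by linarith
    also have "\<dots> \<le> (?D1 + ?D2 + ?D3) * (Vh x * ?e + m powr (-1 - \<delta>/2))"
    proof -
      have "0 \<le> ?D3 * (Vh x * ?e)" using Cv(1) sigma Mom_nonneg Vh_nonneg[of x] by simp
      moreover have "0 \<le> (?D1 + ?D2) * m powr (-1 - \<delta>/2)"
        by (rule mult_nonneg_nonneg) (use D in linarith, simp)
      ultimately show ?thesis unfolding distrib_left distrib_right by linarith
    qed
    finally show "\<bar>(Q ^^ n) (indicator {..U}) x - Vh x * kq U (\<sigma>\<^sup>2 * real n) x\<bar>
      \<le> (?D1 + ?D2 + ?D3) * (Vh x * sqrt (real n) powr (-1 - \<beta>/2) + sqrt (real n) powr (-1 - \<delta>/2))"
      unfolding en_def m_def .
  qed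
qed

end

section \<open>Errors expressed through V and L\<close>

lemma L_lower_radius:
  assumes "0 < a" "\<bar>z\<bar> \<le> a"
  shows "2 * nd 1 * min 1 (1 / a) \<le> L z"
proof (cases "z = 0")
  case True
  have "nd 1 \<le> nd 0" by (auto simp: std_normal_density_def divide_right_mono)
  then have "2 * nd 1 * 1 \<le> L z" using True by (simp add: L_def std_normal_density_def)
  moreover have "2 * nd 1 * min 1 (1 / a) \<le> 2 * nd 1 * 1" using nd_pos[of 1] by (intro mult_left_mono) auto
  ultimately show ?thesis by linarith
next
  case False
  have "1 / a \<le> 1 / \<bar>z\<bar>" using assms False by (intro divide_left_mono) auto
  then have "2 * nd 1 * min 1 (1 / a) \<le> 2 * nd 1 * min 1 (1 / \<bar>z\<bar>)"
    using nd_pos[of 1] by (intro mult_left_mono min.mono) auto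
  then show ?thesis using L_lower[of z] by linarith
qed

lemma L_nonneg: "0 \<le> L z"
proof (rule order_trans[OF _ L_lower_radius[of "1 + \<bar>z\<bar>" z]])
  show "0 \<le> 2 * nd 1 * min 1 (1 / (1 + \<bar>z\<bar>))" using nd_pos[of 1] by simp
qed auto

context centred_law
begin

text \<open>For x \<le> \<sigma> sqrt n the function L is bounded below and V is at least of order 1
  + x. Beyond, L is at least of order sqrt n / x, so the right side stays above a constant while
  \<open>theta\<close> is at most 1.\<close>

lemma theta_le_VhL: "\<exists>c>0. \<forall>n x. 1 \<le> n \<longrightarrow> 0 \<le> x \<longrightarrow> c * theta n x \<le> Vh x * L (x / (\<sigma> * sqrt (real n))) / sqrt (real n)"
proof -
  obtain cv where cv: "cv > 0" "\<And>x. 0 \<le> x \<Longrightarrow> cv * (1 + x) \<le> Vh x" using Vh_lower by blast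
  show ?thesis
  proof (intro exI conjI allI impI)
    let ?c = "cv * (2 * nd 1) * min 1 \<sigma>"
    show "0 < ?c" using cv(1) nd_pos[of 1] sigma by simp
    fix n :: nat and x :: real assume n: "1 \<le> n" and x: "0 \<le> x"
    define m where "m = sqrt (real n)"
    have m: "1 \<le> m" using n by (simp add: m_def)
    have p: "0 < nd 1" by (rule nd_pos)
    have th: "0 \<le> theta n x" using theta_pos[OF n x] by simp
    have sm: "0 < \<sigma> * m" using sigma m by simp
    have "?c * theta n x \<le> (cv * (1 + x)) * L (x / (\<sigma> * m)) / m"
    proof (cases "x \<le> \<sigma> * m")
      case True
      have l: "2 * nd 1 \<le> L (x / (\<sigma> * m))"
        using L_lower_radius[of 1 "x / (\<sigma> * m)"] True sm x by simp
      have "?c * theta n x \<le> (cv * (2 * nd 1) * 1) * ((1 + x) / m)"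
        using cv(1) p th sigma by (intro mult_mono) (auto simp: theta_def m_def)
      also have "\<dots> = (cv * (1 + x)) * (2 * nd 1) / m" by simp
      also have "\<dots> \<le> (cv * (1 + x)) * L (x / (\<sigma> * m)) / m"
        using l cv(1) x m by (intro divide_right_mono mult_left_mono) auto
      finally show ?thesis .
    next
      case False
      then have x0: "0 < x" using sm by linarith
      have "2 * nd 1 * min 1 (1 / (x / (\<sigma> * m))) \<le> L (x / (\<sigma> * m))"
        by (rule L_lower_radius) (use x0 sm in auto)
      moreover have "min 1 (1 / (x / (\<sigma> * m))) = \<sigma> * m / x" using False x0 by (simp add: min_def)
      ultimately have l: "2 * nd 1 * (\<sigma> * m / x) \<le> L (x / (\<sigma> * m))" by simp
      have "?c * theta n x \<le> (cv * (2 * nd 1) * \<sigma>) * 1"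
        using cv(1) p th sigma by (intro mult_mono) (auto simp: theta_def)
      also have "\<dots> \<le> (cv * (2 * nd 1) * \<sigma>) * ((1 + x) / x)"
        using cv(1) p sigma x0 by (intro mult_left_mono) auto
      also have "\<dots> = (cv * (1 + x)) * (2 * nd 1 * (\<sigma> * m / x)) / m" using m x0 by simp
      also have "\<dots> \<le> (cv * (1 + x)) * L (x / (\<sigma> * m)) / m"
        using l cv(1) x m by (intro divide_right_mono mult_left_mono) auto
      finally show ?thesis .
    qed
    also have "\<dots> \<le> Vh x * L (x / (\<sigma> * m)) / m"
      using cv(2)[OF x] L_nonneg m by (intro divide_right_mono mult_right_mono) auto
    finally show "?c * theta n x \<le> Vh x * L (x / (\<sigma> * sqrt (real n))) / sqrt (real n)" unfolding m_def .
  qed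
qed

lemma approx_all: "\<exists>C>0. \<forall>n U x. 1 \<le> n \<longrightarrow> 0 \<le> U \<longrightarrow>
  \<bar>(Q ^^ n) (indicator {..U}) x - Vh x * kq U (\<sigma>\<^sup>2 * real n) x\<bar>
    \<le> C * ((1 / real n powr (\<delta> / 4)
        + Vh x * L (x / (\<sigma> * sqrt (real n))) / real n powr (\<delta> / (4 * (3 + \<delta>))) * ln (real n)) / sqrt (real n))"
proof -
  obtain C1 where C1: "C1 > 0" "\<And>n U x. 1 \<le> n \<Longrightarrow> 0 \<le> U \<Longrightarrow> 0 \<le> x \<Longrightarrow>
    \<bar>(Q ^^ n) (indicator {..U}) x - Vh x * kq U (\<sigma>\<^sup>2 * real n) x\<bar> \<le> C1 * theta n x * sqrt (real n) powr (-(\<beta>/2))"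
    using approx_nonneg by blast
  obtain C2 where C2: "C2 > 0" "\<And>n U x. 1 \<le> n \<Longrightarrow> x < - sqrt (real n) \<Longrightarrow>
    \<bar>(Q ^^ n) (indicator {..U}) x - Vh x * kq U (\<sigma>\<^sup>2 * real n) x\<bar> \<le> C2 * sqrt (real n) powr (-1 - \<delta>/2)"
    using approx_far by blast
  obtain C3 where C3: "C3 > 0" "\<And>U x. x < 0 \<Longrightarrow>
    \<bar>(Q ^^ 1) (indicator {..U}) x - Vh x * kq U (\<sigma>\<^sup>2 * real 1) x\<bar> \<le> C3"
    using approx_one_neg by blast
  obtain C4 where C4: "C4 > 0" "\<And>n U x. 2 \<le> n \<Longrightarrow> 0 \<le> U \<Longrightarrow> x < 0 \<Longrightarrow>
    \<bar>(Q ^^ n) (indicator {..U}) x - Vh x * kq U (\<sigma>\<^sup>2 * real n) x\<bar>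
    \<le> C4 * (Vh x * sqrt (real n) powr (-1 - \<beta>/2) + sqrt (real n) powr (-1 - \<delta>/2))"
    using approx_near by blast
  obtain c where c: "c > 0" "\<And>n x. 1 \<le> n \<Longrightarrow> 0 \<le> x \<Longrightarrow> c * theta n x \<le> Vh x * L (x / (\<sigma> * sqrt (real n))) / sqrt (real n)"
    using theta_le_VhL by blast
  define q where "q = 2 * nd 1 * min 1 \<sigma>"
  have q: "0 < q" using nd_pos[of 1] sigma by (simp add: q_def)
  define K1 where "K1 = 2 * C1 / c"
  define K4 where "K4 = 2 * C4 / q"
  have K: "0 < K1" "0 < K4" using C1(1) C4(1) c(1) q by (auto simp: K1_def K4_def)
  show ?thesis
  proof (intro exI conjI allI impI)
    let ?C = "C1 + C2 + C3 + C4 + K1 + K4"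
    show "0 < ?C" using C1(1) C2(1) C3(1) C4(1) K by simp
    fix n :: nat and U x :: real assume n: "1 \<le> n" and U: "0 \<le> U"
    define m where "m = sqrt (real n)"
    have m: "1 \<le> m" "m * m = real n" using n by (auto simp: m_def)
    have nm: "real n powr a = m powr (2 * a)" for a
    proof -
      have "real n = m powr 2" using m by (simp add: power2_eq_square)
      then show ?thesis by (simp only: powr_powr)
    qed
    define l where "l = L (x / (\<sigma> * m))"
    have l: "0 \<le> l" by (simp add: l_def L_nonneg)
    define E1 where "E1 = m powr (-1 - \<delta>/2)"
    define E2 where "E2 = Vh x * l * m powr (-1 - \<beta>/2) * ln (real n)"
    have E: "0 \<le> E1" "0 \<le> E2" using l Vh_nonneg n by (auto simp: E1_def E2_def)
    have R: "(1 / real n powr (\<delta> / 4) + Vh x * L (x / (\<sigma> * sqrt (real n))) / real n powr (\<delta> / (4 * (3 + \<delta>))) * ln (real n)) / sqrt (real n) = E1 + E2"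
    proof -
      have b4: "2 * (\<delta> / (4 * (3 + \<delta>))) = \<beta> / 2" using delta by (simp add: \<beta>_def field_simps)
      have d4: "2 * (\<delta> / 4) = \<delta> / 2" by simp
      have e: "m powr (-1 - a) = 1 / m powr a / m" for a
        using m powr_add[of m "-a" "-1"] by (simp add: powr_minus_divide algebra_simps)
      show ?thesis unfolding nm b4 d4 E1_def E2_def e l_def m_def[symmetric] by (simp add: add_divide_distrib)
    qed
    let ?X = "\<bar>(Q ^^ n) (indicator {..U}) x - Vh x * kq U (\<sigma>\<^sup>2 * real n) x\<bar>"
    have main: "?X \<le> C1 * E1 \<or> ?X \<le> C2 * E1 \<or> ?X \<le> C3 * E1 \<or> ?X \<le> K1 * E2 \<or> ?X \<le> K4 * E2 + C4 * E1"
    proof (cases "n = 1")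
      case True
      \<comment> \<open>At n = 1 the logarithm vanishes, so the term \<open>E1\<close>, equal to 1,
        has to carry every bound.\<close>
      then have E11: "E1 = 1" by (simp add: E1_def m_def)
      show ?thesis
      proof (cases "0 \<le> x")
        case x: True
        have "?X \<le> C1 * theta n x * m powr (-(\<beta>/2))" unfolding m_def by (rule C1(2)[OF n U x])
        also have "\<dots> \<le> C1 * 1 * 1" using C1(1) True x by (intro mult_mono) (auto simp: theta_def m_def)
        finally show ?thesis unfolding E11 by simp
      next
        case False
        then have "?X \<le> C3" using C3(2)[of x U] True by simp
        then show ?thesis unfolding E11 by simp
      qed
    next
      case False
      then have n2: "2 \<le> n" using n by simp
      \<comment> \<open>From n = 2 on the logarithm is at least 1/2, so a bound by
        \<open>Vh x * l\<close> times the rate is at most \<open>2 * E2\<close>.\<close>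
      have ln: "1 \<le> 2 * ln (real n)"
      proof -
        have "1/2 \<le> ln (2::real)" using ln_le_minus_one[of "1/2"] by (simp add: ln_div)
        also have "\<dots> \<le> ln (real n)" using n2 by (subst ln_le_cancel_iff) auto
        finally show ?thesis by simp
      qed
      have l2: "Vh x * l * m powr (-1 - \<beta>/2) \<le> 2 * E2"
      proof -
        have "Vh x * l * m powr (-1 - \<beta>/2) * 1 \<le> Vh x * l * m powr (-1 - \<beta>/2) * (2 * ln (real n))"
          using ln l Vh_nonneg by (intro mult_left_mono) auto
        then show ?thesis by (simp add: E2_def mult_ac)
      qed
      have me: "1 / m * m powr (-(\<beta>/2)) = m powr (-1 - \<beta>/2)" using m powr_add[of m "-1" "-(\<beta>/2)"] by (simp add: powr_minus_divide)
      show ?thesis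
      proof (cases "0 \<le> x")
        case x: True
        have th: "theta n x \<le> Vh x * l / m / c"
          unfolding l_def m_def pos_le_divide_eq[OF c(1)] using c(2)[OF n x] by (simp only: mult.commute[of _ c])
        have "?X \<le> C1 * theta n x * m powr (-(\<beta>/2))" unfolding m_def by (rule C1(2)[OF n U x])
        also have "\<dots> \<le> C1 * (Vh x * l / m / c) * m powr (-(\<beta>/2))"
          using th C1(1) by (intro mult_right_mono mult_left_mono) auto
        also have "\<dots> = C1 / c * (Vh x * l * (1 / m * m powr (-(\<beta>/2))))" by (simp add: mult_ac)
        also have "\<dots> \<le> C1 / c * (2 * E2)" unfolding me using l2 C1(1) c(1) by (intro mult_left_mono) auto
        finally show ?thesis by (simp add: K1_def mult_ac)
      next
        case neg: False
        show ?thesis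
        proof (cases "x < - m")
          case True
          then have "?X \<le> C2 * E1" using C2(2)[OF n, of x U] by (simp add: m_def E1_def)
          then show ?thesis by simp
        next
          case False
          \<comment> \<open>For - sqrt n \<le> x < 0 the argument of \<open>L\<close> has modulus at
            most 1/\<sigma>, which allows the factor \<open>l\<close> to be inserted next to
            \<open>Vh x\<close>.\<close>
          have ql: "q \<le> l"
          proof -
            have "\<bar>x / (\<sigma> * m)\<bar> = \<bar>x\<bar> / (\<sigma> * m)" using sigma m by (simp add: abs_divide abs_mult)
            also have "\<dots> \<le> m / (\<sigma> * m)" using False neg sigma m by (intro divide_right_mono) auto
            also have "\<dots> = 1 / \<sigma>" using m by simp
            finally have "2 * nd 1 * min 1 (1 / (1 / \<sigma>)) \<le> l" unfolding l_def using sigma by (intro L_lower_radius) auto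
            then show ?thesis by (simp add: q_def)
          qed
          have "?X \<le> C4 * (Vh x * m powr (-1 - \<beta>/2) + E1)" unfolding m_def E1_def by (rule C4(2)[OF n2 U]) (use neg in simp)
          also have "Vh x * m powr (-1 - \<beta>/2) \<le> 2 / q * E2"
          proof -
            have "q * (Vh x * m powr (-1 - \<beta>/2)) \<le> l * (Vh x * m powr (-1 - \<beta>/2))"
              using ql Vh_nonneg by (intro mult_right_mono) auto
            then have "q * (Vh x * m powr (-1 - \<beta>/2)) \<le> 2 * E2" using l2 by (simp add: mult_ac)
            then show ?thesis using q by (simp add: field_simps)
          qed
          finally have "?X \<le> C4 * (2 / q * E2 + E1)" using C4(1) by simp
          then show ?thesis by (simp add: K4_def algebra_simps)
        qed
      qed
    qed
    have pos: "0 \<le> C1 * E1" "0 \<le> C2 * E1" "0 \<le> C3 * E1" "0 \<le> C4 * E1" "0 \<le> K1 * E1" "0 \<le> K4 * E1"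
      "0 \<le> C1 * E2" "0 \<le> C2 * E2" "0 \<le> C3 * E2" "0 \<le> C4 * E2" "0 \<le> K1 * E2" "0 \<le> K4 * E2"
      using E C1(1) C2(1) C3(1) C4(1) K by auto
    have "?C * (E1 + E2) = C1 * E1 + C2 * E1 + C3 * E1 + C4 * E1 + K1 * E1 + K4 * E1 + C1 * E2 + C2 * E2 + C3 * E2 + C4 * E2 + K1 * E2 + K4 * E2"
      by (simp add: algebra_simps)
    then have "?X \<le> ?C * (E1 + E2)" using main pos by linarith
    then show "?X \<le> ?C * ((1 / real n powr (\<delta> / 4) + Vh x * L (x / (\<sigma> * sqrt (real n))) / real n powr (\<delta> / (4 * (3 + \<delta>))) * ln (real n)) / sqrt (real n))"
      unfolding R .
  qed
qed

text \<open>From a negative start one step is taken first; from then on the partial sums are below a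
  multiple of \<open>fl\<close>, uniformly in their length.\<close>

lemma summable_Qn_g_all: "summable (\<lambda>k. (Q ^^ k) g x)"
proof -
  define D where "D = Co * (1 / c1)"
  have D: "0 < D" using Co_pos c1_pos by (simp add: D_def)
  have "summable (\<lambda>k. (Q ^^ Suc k) g x)"
  proof (rule bounded_imp_summable)
    fix n
    show "0 \<le> (Q ^^ Suc n) g x"
    proof -
      have "Q (\<lambda>_. 0 * 1) x \<le> Q ((Q ^^ n) g) x"
        by (rule Q_mono[OF lin_growth_const lin_growth_Qn[OF lin_growth_g]]) (simp add: Qn_g_nonneg)
      then show ?thesis unfolding Q_cmult by simp
    qed
    have "(\<Sum>k\<le>n. (Q ^^ Suc k) g x) = Q (\<lambda>y. \<Sum>k\<le>n. (Q ^^ k) g y) x"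
      by (subst Q_sum) (auto intro: lin_growth_Qn lin_growth_g)
    also have "\<dots> \<le> Q (\<lambda>y. D * fl y) x"
    proof (rule Q_mono[OF _ lin_growth_cmult[OF lin_growth_fl]])
      show "lin_growth (\<lambda>y. \<Sum>k\<le>n. (Q ^^ k) g y)" by (intro lin_growth_sum lin_growth_Qn lin_growth_g)
      fix y :: real assume y: "0 \<le> y"
      have "(\<Sum>k\<le>n. (Q ^^ k) g y) \<le> Co * occ (Suc n) y"
        using sum_Qn_g_le[OF y, of "Suc n"] by (simp only: lessThan_Suc_atMost)
      also have "\<dots> \<le> Co * (fl y / c1)" using Co_pos occ_le_fl[OF y] by (intro mult_left_mono) auto
      finally show "(\<Sum>k\<le>n. (Q ^^ k) g y) \<le> D * fl y" by (simp add: D_def)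
    qed
    finally show "(\<Sum>k\<le>n. (Q ^^ Suc k) g x) \<le> Q (\<lambda>y. D * fl y) x" .
  qed
  then show ?thesis by (rule summable_Suc_iff[THEN iffD1, of "\<lambda>k. (Q ^^ k) g x"])
qed

text \<open>The first step replaces an arbitrary x by a nonnegative position. \<open>Suc n\<close>
  steps are left, at least one as \<open>surv_bound\<close> demands, and its factor 1 + y is
  integrated over the first step into a constant that depends on x.\<close>

lemma surv_decay: "\<exists>K. \<forall>n. surv (Suc (Suc n)) x \<le> K / sqrt (real (Suc n))"
proof -
  obtain C where C: "C > 0" "\<And>n x. 1 \<le> n \<Longrightarrow> 0 \<le> x \<Longrightarrow> surv n x \<le> C * ((1 + x) / sqrt (real n))"
    using surv_bound by blast
  have "surv (Suc (Suc n)) x \<le> C * (Q (\<lambda>_. 1) x + Q idp x) / sqrt (real (Suc n))" for n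
  proof -
    have "surv (Suc (Suc n)) x = Q (surv (Suc n)) x" by (simp add: surv_def)
    also have "\<dots> \<le> Q (\<lambda>y. C / sqrt (real (Suc n)) * (1 + idp y)) x"
    proof (rule Q_mono[OF lin_growth_surv])
      show "lin_growth (\<lambda>y. C / sqrt (real (Suc n)) * (1 + idp y))"
        by (intro lin_growth_cmult lin_growth_add lin_growth_const lin_growth_idp)
      show "surv (Suc n) y \<le> C / sqrt (real (Suc n)) * (1 + idp y)" if "0 \<le> y" for y
        using C(2)[OF _ that, of "Suc n"] that by (simp del: of_nat_Suc)
    qed
    also have "\<dots> = C * (Q (\<lambda>_. 1) x + Q idp x) / sqrt (real (Suc n))"
      unfolding Q_cmult Q_add[OF lin_growth_const lin_growth_idp] by simp
    finally show ?thesis .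
  qed
  then show ?thesis by blast
qed

end

section \<open>From the operator to the random walk\<close>

lemma Inf_enat_mem: "A \<noteq> {} \<Longrightarrow> Inf A \<in> A" for A :: "enat set"
  unfolding Inf_enat_def by (auto intro: LeastI)

locale iid_walk = prob_space M for M :: "'a measure" +
  fixes X :: "nat \<Rightarrow> 'a \<Rightarrow> real" and \<sigma> \<delta> :: real
  assumes indep: "indep_vars (\<lambda>_. borel) X {1..}"
    and ident: "\<And>i. i \<ge> 1 \<Longrightarrow> distr M borel (X i) = distr M borel (X 1)"
    and mean: "(\<integral>\<omega>. X 1 \<omega> \<partial>M) = 0"
    and sigma_pos: "\<sigma> > 0"
    and variance: "(\<integral>\<omega>. (X 1 \<omega>)\<^sup>2 \<partial>M) = \<sigma>\<^sup>2"
    and delta_pos: "\<delta> > 0"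
    and moment: "integrable M (\<lambda>\<omega>. \<bar>X 1 \<omega>\<bar> powr (2 + \<delta>))"
begin

lemma X_meas: "i \<ge> 1 \<Longrightarrow> X i \<in> borel_measurable M"
  using indep unfolding indep_vars_def by auto

abbreviation \<mu> :: "real measure" where "\<mu> \<equiv> distr M borel (X 1)"

lemma centred_law: "centred_law \<mu> \<sigma> \<delta>"
proof -
  have [measurable]: "X 1 \<in> borel_measurable M" by (rule X_meas) simp
  interpret law: prob_space \<mu> by (rule prob_space_distr) measurable
  have 1: "(\<integral>\<xi>. \<xi> \<partial>\<mu>) = (\<integral>\<omega>. X 1 \<omega> \<partial>M)" by (rule integral_distr) measurable
  have 2: "(\<integral>\<xi>. \<xi>\<^sup>2 \<partial>\<mu>) = (\<integral>\<omega>. (X 1 \<omega>)\<^sup>2 \<partial>M)" by (rule integral_distr) measurable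
  have 3: "integrable \<mu> (\<lambda>\<xi>. \<bar>\<xi>\<bar> powr (2 + \<delta>)) \<longleftrightarrow> integrable M (\<lambda>\<omega>. \<bar>X 1 \<omega>\<bar> powr (2 + \<delta>))"
    by (rule integrable_distr_eq) measurable
  show ?thesis
  proof
    show "sets \<mu> = sets borel" by simp
    show "(\<integral>\<xi>. \<xi> \<partial>\<mu>) = 0" unfolding 1 by (rule mean)
    show "(\<integral>\<xi>. \<xi>\<^sup>2 \<partial>\<mu>) = \<sigma>\<^sup>2" unfolding 2 by (rule variance)
    show "integrable \<mu> (\<lambda>\<xi>. \<bar>\<xi>\<bar> powr (2 + \<delta>))" unfolding 3 by (rule moment)
  qed (rule sigma_pos delta_pos)+
qed

sublocale law: centred_law \<mu> \<sigma> \<delta> by (rule centred_law)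

lemma walk_borel[measurable]: "walk X n \<in> borel_measurable M"
proof -
  have [measurable]: "X i \<in> borel_measurable M" if "i \<in> {1..n}" for i using that by (intro X_meas) auto
  show ?thesis unfolding walk_def[abs_def] by measurable
qed

lemma int_X: assumes "i \<ge> 1" shows "integrable M (\<lambda>\<omega>. \<bar>X i \<omega>\<bar>)"
proof -
  have [measurable]: "X i \<in> borel_measurable M" by (rule X_meas[OF assms])
  have "integrable (distr M borel (X i)) (\<lambda>\<xi>. \<bar>\<xi>\<bar>)" unfolding ident[OF assms] by (rule law.int_abs)
  then show ?thesis by (subst (asm) integrable_distr_eq) auto
qed

lemma int_walk: assumes "lin_growth \<phi>" shows "integrable M (\<lambda>\<omega>. \<phi> (x + walk X n \<omega>))"
proof -
  obtain C where C: "0 \<le> C" "\<And>y. \<bar>\<phi> y\<bar> \<le> C * (1 + \<bar>y\<bar>)" using lin_growthE[OF assms] by blast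
  show ?thesis
  proof (rule Bochner_Integration.integrable_bound[of _ "\<lambda>\<omega>. C * (1 + \<bar>x\<bar> + (\<Sum>i=1..n. \<bar>X i \<omega>\<bar>))"])
    show "integrable M (\<lambda>\<omega>. C * (1 + \<bar>x\<bar> + (\<Sum>i=1..n. \<bar>X i \<omega>\<bar>)))"
      using int_X by (intro integrable_mult_right Bochner_Integration.integrable_add Bochner_Integration.integrable_sum) auto
    show "(\<lambda>\<omega>. \<phi> (x + walk X n \<omega>)) \<in> borel_measurable M"
      using lin_growth_measurable[OF assms] by measurable
    show "AE \<omega> in M. norm (\<phi> (x + walk X n \<omega>)) \<le> norm (C * (1 + \<bar>x\<bar> + (\<Sum>i=1..n. \<bar>X i \<omega>\<bar>)))"
    proof (rule AE_I2)
      fix \<omega>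
      have "\<bar>walk X n \<omega>\<bar> \<le> (\<Sum>i=1..n. \<bar>X i \<omega>\<bar>)" unfolding walk_def by (rule sum_abs)
      then have "C * (1 + \<bar>x + walk X n \<omega>\<bar>) \<le> C * (1 + \<bar>x\<bar> + (\<Sum>i=1..n. \<bar>X i \<omega>\<bar>))"
        using C(1) by (intro mult_left_mono) auto
      then have "\<bar>\<phi> (x + walk X n \<omega>)\<bar> \<le> C * (1 + \<bar>x\<bar> + (\<Sum>i=1..n. \<bar>X i \<omega>\<bar>))" using C(2)[of "x + walk X n \<omega>"] by linarith
      then show "norm (\<phi> (x + walk X n \<omega>)) \<le> norm (C * (1 + \<bar>x\<bar> + (\<Sum>i=1..n. \<bar>X i \<omega>\<bar>)))"
        unfolding real_norm_def by (rule order_trans[OF _ abs_ge_self])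
    qed
  qed
qed

text \<open>Survival as a product of indicators: its measurability is immediate, and it depends on
  the first n steps only, as the independence argument requires. \<open>alive_eq\<close> links it to
  \<open>exit_time\<close>.\<close>

definition alive :: "real \<Rightarrow> nat \<Rightarrow> 'a \<Rightarrow> real" where
  "alive x n \<omega> = (\<Prod>k=1..n. indicator {0..} (x + walk X k \<omega>))"

lemma alive_borel[measurable]: "alive x n \<in> borel_measurable M"
  unfolding alive_def[abs_def] by measurable

lemma alive_bounds: "0 \<le> alive x n \<omega>" "alive x n \<omega> \<le> 1"
  unfolding alive_def by (auto intro!: prod_nonneg prod_le_1 simp: indicator_def)

lemma alive_Suc: "alive x (Suc n) \<omega> = alive x n \<omega> * indicator {0..} (x + walk X (Suc n) \<omega>)"
  by (simp add: alive_def)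

lemma walk_Suc: "walk X (Suc n) \<omega> = walk X n \<omega> + X (Suc n) \<omega>"
  by (simp add: walk_def)

lemma int_alive: "integrable M f \<Longrightarrow> integrable M (\<lambda>\<omega>. alive x n \<omega> * f \<omega>)" for f :: "'a \<Rightarrow> real"
  by (rule Bochner_Integration.integrable_bound[of M f])
    (auto simp: abs_mult alive_bounds intro!: mult_left_le_one_le)

lemma indep_past: "indep_var (PiM {1..n} (\<lambda>_. borel)) (\<lambda>\<omega>. restrict (\<lambda>i. X i \<omega>) {1..n})
    (PiM {Suc n} (\<lambda>_. borel)) (\<lambda>\<omega>. restrict (\<lambda>i. X i \<omega>) {Suc n})"
  by (rule indep_var_restrict[OF indep]) auto

text \<open>The joint law of the block of the first n steps and the next step is a product, so by
  Fubini's theorem the next step can be integrated out first.\<close>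

lemma markov_step:
  assumes "lin_growth \<psi>"
  shows "(\<integral>\<omega>. alive x n \<omega> * \<psi> (x + walk X (Suc n) \<omega>) \<partial>M) = (\<integral>\<omega>. alive x n \<omega> * (\<integral>\<xi>. \<psi> (x + walk X n \<omega> + \<xi>) \<partial>\<mu>) \<partial>M)"
proof -
  note [measurable] = lin_growth_measurable[OF assms]
  let ?P = "PiM {1..n} (\<lambda>_. borel) :: (nat \<Rightarrow> real) measure"
  define Y where "Y \<omega> = restrict (\<lambda>i. X i \<omega>) {1..n}" for \<omega>
  let ?P1 = "PiM {Suc n} (\<lambda>_. borel) :: (nat \<Rightarrow> real) measure"
  define Z where "Z \<omega> = restrict (\<lambda>i. X i \<omega>) {Suc n}" for \<omega>
  have iv: "indep_var ?P Y ?P1 Z" unfolding Y_def[abs_def] Z_def[abs_def] by (rule indep_past)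
  have [measurable]: "Y \<in> measurable M ?P" "Z \<in> measurable M ?P1"
    using indep_var_rv1[OF iv] indep_var_rv2[OF iv] by auto
  have XZ: "Z \<omega> (Suc n) = X (Suc n) \<omega>" for \<omega> by (simp add: Z_def)
  have [measurable]: "X (Suc n) \<in> borel_measurable M" by (rule X_meas) simp
  have [measurable]: "(\<lambda>q. q (Suc n)) \<in> borel_measurable ?P1" by (rule measurable_component_singleton) simp
  have d: "distr M (?P \<Otimes>\<^sub>M ?P1) (\<lambda>\<omega>. (Y \<omega>, Z \<omega>)) = distr M ?P Y \<Otimes>\<^sub>M distr M ?P1 Z"
    using iv unfolding indep_var_distribution_eq by simp
  have inner: "(\<integral>q. \<psi> (c + q (Suc n)) \<partial>distr M ?P1 Z) = (\<integral>\<xi>. \<psi> (c + \<xi>) \<partial>\<mu>)" for c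
  proof -
    have "(\<integral>q. \<psi> (c + q (Suc n)) \<partial>distr M ?P1 Z) = (\<integral>\<omega>. \<psi> (c + Z \<omega> (Suc n)) \<partial>M)"
      by (rule integral_distr) measurable
    also have "\<dots> = (\<integral>\<xi>. \<psi> (c + \<xi>) \<partial>distr M borel (X (Suc n)))"
      unfolding XZ by (rule integral_distr[symmetric]) measurable
    finally show ?thesis using ident[of "Suc n"] by simp
  qed
  \<comment> \<open>From here the walk and the survival indicator are rewritten as functions on the
    space of the first n steps; only then does the product law apply.\<close>
  define s where "s k p = (\<Sum>i=1..k. p i)" for k and p :: "nat \<Rightarrow> real"
  have s_meas[measurable]: "s k \<in> borel_measurable ?P" if "k \<le> n" for k
    unfolding s_def[abs_def] using that by (intro borel_measurable_sum measurable_component_singleton) auto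
  have sY: "s k (Y \<omega>) = walk X k \<omega>" if "k \<le> n" for k \<omega>
    using that by (auto simp: s_def Y_def walk_def intro!: sum.cong)
  define a where "a p = (\<Prod>k=1..n. indicator {0..} (x + s k p) :: real)" for p
  have a_meas[measurable]: "a \<in> borel_measurable ?P"
    unfolding a_def[abs_def]
  proof (rule borel_measurable_prod)
    fix k assume "k \<in> {1..n}"
    then have [measurable]: "s k \<in> borel_measurable ?P" by (intro s_meas) auto
    show "(\<lambda>p. indicator {0..} (x + s k p) :: real) \<in> borel_measurable ?P" by measurable
  qed
  have aY: "a (Y \<omega>) = alive x n \<omega>" for \<omega> by (auto simp: a_def alive_def sY intro!: prod.cong)
  have [measurable]: "s n \<in> borel_measurable ?P" by (rule s_meas) simp
  let ?h = "\<lambda>(p, q). a p * \<psi> (x + s n p + q (Suc n))"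
  have h_meas[measurable]: "?h \<in> borel_measurable (?P \<Otimes>\<^sub>M ?P1)" by measurable
  have hY: "?h (Y \<omega>, Z \<omega>) = alive x n \<omega> * \<psi> (x + walk X (Suc n) \<omega>)" for \<omega>
    by (simp add: aY sY walk_Suc XZ add.assoc)
  have pair: "(\<lambda>\<omega>. (Y \<omega>, Z \<omega>)) \<in> measurable M (?P \<Otimes>\<^sub>M ?P1)" by measurable
  have "integrable M (\<lambda>\<omega>. ?h (Y \<omega>, Z \<omega>))"
    unfolding hY by (intro int_alive int_walk assms)
  then have ih: "integrable (distr M ?P Y \<Otimes>\<^sub>M distr M ?P1 Z) ?h"
    unfolding d[symmetric] integrable_distr_eq[OF pair h_meas] .
  interpret PY: prob_space "distr M ?P Y" by (rule prob_space_distr) measurable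
  interpret PZ: prob_space "distr M ?P1 Z" by (rule prob_space_distr) measurable
  interpret pair_sigma_finite "distr M ?P Y" "distr M ?P1 Z" ..
  have "(\<integral>\<omega>. alive x n \<omega> * \<psi> (x + walk X (Suc n) \<omega>) \<partial>M) = (\<integral>\<omega>. ?h (Y \<omega>, Z \<omega>) \<partial>M)" unfolding hY ..
  also have "\<dots> = (\<integral>q. ?h q \<partial>(distr M (?P \<Otimes>\<^sub>M ?P1) (\<lambda>\<omega>. (Y \<omega>, Z \<omega>))))"
    by (rule integral_distr[symmetric]) measurable
  also have "\<dots> = (\<integral>q. ?h q \<partial>(distr M ?P Y \<Otimes>\<^sub>M distr M ?P1 Z))" unfolding d ..
  also have "\<dots> = (\<integral>p. (\<integral>q. ?h (p, q) \<partial>distr M ?P1 Z) \<partial>distr M ?P Y)"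
    by (rule integral_fst'[OF ih, symmetric])
  also have "\<dots> = (\<integral>p. a p * (\<integral>\<xi>. \<psi> (x + s n p + \<xi>) \<partial>\<mu>) \<partial>distr M ?P Y)" by (simp add: inner)
  also have "\<dots> = (\<integral>\<omega>. a (Y \<omega>) * (\<integral>\<xi>. \<psi> (x + s n (Y \<omega>) + \<xi>) \<partial>\<mu>) \<partial>M)"
    by (rule integral_distr) measurable
  finally show ?thesis by (simp add: aY sY)
qed

text \<open>The last step is peeled off and moved into the test function, which is why the induction
  runs over all \<phi> at once.\<close>

lemma killed_expectation:
  assumes "lin_growth \<phi>"
  shows "(\<integral>\<omega>. alive x n \<omega> * \<phi> (x + walk X n \<omega>) \<partial>M) = (law.Q ^^ n) \<phi> x"
  using assms
proof (induction n arbitrary: \<phi>)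
  case 0
  then show ?case by (simp add: alive_def walk_def prob_space)
next
  case (Suc n)
  have "(\<integral>\<omega>. alive x (Suc n) \<omega> * \<phi> (x + walk X (Suc n) \<omega>) \<partial>M)
    = (\<integral>\<omega>. alive x n \<omega> * (indicator {0..} (x + walk X (Suc n) \<omega>) * \<phi> (x + walk X (Suc n) \<omega>)) \<partial>M)"
    by (simp add: alive_Suc mult.assoc)
  also have "\<dots> = (\<integral>\<omega>. alive x n \<omega> * law.Q \<phi> (x + walk X n \<omega>) \<partial>M)"
    using markov_step[OF law.lin_growth_ind[OF Suc.prems], of x n] by (simp only: law.Q_def)
  also have "\<dots> = (law.Q ^^ n) (law.Q \<phi>) x" by (rule Suc.IH[OF law.lin_growth_Q[OF Suc.prems]])
  finally show ?case unfolding law.Qn_Suc2 .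
qed

lemma exit_time_gt: "exit_time X x \<omega> > enat n \<longleftrightarrow> (\<forall>k\<in>{1..n}. 0 \<le> x + walk X k \<omega>)"
proof -
  let ?K = "{k. 1 \<le> k \<and> x + walk X k \<omega> < 0}"
  have "enat n < (INF k\<in>?K. enat k) \<longleftrightarrow> (\<forall>k\<in>?K. n < k)"
  proof (cases "?K = {}")
    case True
    then show ?thesis by (simp only: ball_simps) (simp add: top_enat_def)
  next
    case False
    then have "(INF k\<in>?K. enat k) \<in> enat ` ?K" by (intro Inf_enat_mem) auto
    then obtain k where k: "k \<in> ?K" "(INF k\<in>?K. enat k) = enat k" by blast
    have le: "enat k \<le> enat j" if "j \<in> ?K" for j unfolding k(2)[symmetric] using that by (rule INF_lower)
    show ?thesis unfolding k(2) using k(1) le by (auto intro: less_le_trans)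
  qed
  also have "\<dots> \<longleftrightarrow> (\<forall>k\<in>{1..n}. 0 \<le> x + walk X k \<omega>)"
  proof (intro iffI ballI)
    fix k assume "\<forall>k\<in>?K. n < k" "k \<in> {1..n}"
    then show "0 \<le> x + walk X k \<omega>" by (metis (mono_tags, lifting) atLeastAtMost_iff mem_Collect_eq not_le)
  next
    fix k assume "\<forall>k\<in>{1..n}. 0 \<le> x + walk X k \<omega>" "k \<in> ?K"
    then show "n < k" by (metis (mono_tags, lifting) atLeastAtMost_iff mem_Collect_eq not_le)
  qed
  finally show ?thesis unfolding exit_time_def .
qed

lemma alive_eq: "alive x n \<omega> = (if exit_time X x \<omega> > enat n then 1 else 0)"
proof (cases "\<forall>k\<in>{1..n}. 0 \<le> x + walk X k \<omega>")
  case True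
  then have "alive x n \<omega> = 1" unfolding alive_def by (intro prod.neutral) auto
  then show ?thesis using True by (simp add: exit_time_gt)
next
  case False
  then obtain k where "k \<in> {1..n}" "\<not> 0 \<le> x + walk X k \<omega>" by blast
  then have "alive x n \<omega> = 0" unfolding alive_def by (intro prod_zero) (auto intro!: bexI[of _ k])
  then show ?thesis using False by (simp add: exit_time_gt)
qed

lemma prob_survive_eq_Qn:
  assumes "1 \<le> n"
  shows "measure M {\<omega> \<in> space M. (x + walk X n \<omega>) / (\<sigma> * sqrt (real n)) \<le> u \<and> exit_time X x \<omega> > enat n}
    = (law.Q ^^ n) (indicator {..u * (\<sigma> * sqrt (real n))}) x"
proof -
  let ?s = "\<sigma> * sqrt (real n)"
  let ?E = "{\<omega> \<in> space M. (x + walk X n \<omega>) / ?s \<le> u \<and> exit_time X x \<omega> > enat n}"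
  have s: "0 < ?s" using assms sigma_pos by simp
  have ind: "indicator ?E \<omega> = alive x n \<omega> * indicator {..u * ?s} (x + walk X n \<omega>)" if "\<omega> \<in> space M" for \<omega>
    using that s by (auto simp: alive_eq indicator_def divide_le_eq)
  have meas: "?E \<in> sets M"
  proof -
    have "?E = {\<omega> \<in> space M. alive x n \<omega> * indicator {..u * ?s} (x + walk X n \<omega>) = (1::real)}"
      using s by (auto simp: alive_eq indicator_def divide_le_eq split: if_splits)
    also have "\<dots> \<in> sets M" by measurable
    finally show ?thesis .
  qed
  have "measure M ?E = (\<integral>\<omega>. indicator ?E \<omega> \<partial>M)" using meas by simp
  also have "\<dots> = (\<integral>\<omega>. alive x n \<omega> * indicator {..u * ?s} (x + walk X n \<omega>) \<partial>M)"
    by (intro Bochner_Integration.integral_cong ind refl)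
  also have "\<dots> = (law.Q ^^ n) (indicator {..u * ?s}) x" by (rule killed_expectation[OF law.lin_growth_ind_le])
  finally show ?thesis .
qed

text \<open>Never leaving has probability at most \<open>surv\<close> at every time, and this tends
  to 0 by \<open>surv_decay\<close>.\<close>

lemma exit_finite: "AE \<omega> in M. exit_time X x \<omega> \<noteq> \<infinity>"
proof -
  obtain K where K: "\<And>n. law.surv (Suc (Suc n)) x \<le> K / sqrt (real (Suc n))" using law.surv_decay by blast
  let ?N = "{\<omega> \<in> space M. \<forall>n. alive x n \<omega> = 1}"
  have meas: "?N \<in> sets M" by measurable
  have "measure M ?N \<le> K / sqrt (real (Suc n))" for n
  proof -
    have "measure M ?N = (\<integral>\<omega>. indicator ?N \<omega> \<partial>M)" using meas by simp
    also have "\<dots> \<le> (\<integral>\<omega>. alive x (Suc (Suc n)) \<omega> * 1 \<partial>M)"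
    proof (rule integral_mono)
      show "integrable M (indicator ?N :: _ \<Rightarrow> real)" using meas by (intro integrable_real_indicator) (simp_all add: emeasure_eq_measure)
      show "integrable M (\<lambda>\<omega>. alive x (Suc (Suc n)) \<omega> * 1)" by (rule int_alive) simp
      show "indicator ?N \<omega> \<le> alive x (Suc (Suc n)) \<omega> * 1" for \<omega>
        using alive_bounds(1)[of x "Suc (Suc n)" \<omega>] by (auto simp: indicator_def)
    qed
    also have "\<dots> = law.surv (Suc (Suc n)) x"
      using killed_expectation[OF lin_growth_const[of 1], of x "Suc (Suc n)"] unfolding law.surv_def by simp
    finally show ?thesis using K[of n] by linarith
  qed
  moreover have "(\<lambda>n. K / sqrt (real (Suc n))) \<longlonglongrightarrow> 0" by real_asymp
  ultimately have "measure M ?N \<le> 0" by (intro LIMSEQ_le_const) auto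
  then have "measure M ?N = 0" using measure_nonneg[of M ?N] by linarith
  then have "?N \<in> null_sets M" using meas by (simp add: emeasure_eq_measure null_sets_def)
  then have "AE \<omega> in M. \<omega> \<notin> ?N" by (rule AE_not_in)
  then show ?thesis
  proof (rule AE_mp[OF _ AE_I2], intro impI notI)
    fix \<omega> assume "\<omega> \<in> space M" "\<omega> \<notin> ?N" "exit_time X x \<omega> = \<infinity>"
    then show False by (simp add: alive_eq)
  qed
qed

text \<open>Only the term of the step that performs the exit is nonzero: earlier steps have no
  overshoot, and later ones are annihilated by \<open>alive\<close>.\<close>

lemma exit_overshoot_sums:
  assumes "exit_time X x \<omega> \<noteq> \<infinity>"
  shows "(\<lambda>k. alive x k \<omega> * max (- (x + walk X (Suc k) \<omega>)) 0) sums (- (x + exit_walk X x \<omega>))"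
proof -
  obtain k where k: "exit_time X x \<omega> = enat k" using assms by auto
  have gt: "enat n < enat k \<longleftrightarrow> (\<forall>j\<in>{1..n}. 0 \<le> x + walk X j \<omega>)" for n
    using exit_time_gt[of n x \<omega>] unfolding k .
  have k1: "1 \<le> k" using gt[of 0] by simp
  then obtain l where l: "k = Suc l" by (cases k) auto
  have neg: "x + walk X k \<omega> < 0"
  proof (rule ccontr)
    assume "\<not> x + walk X k \<omega> < 0"
    then have "\<forall>j\<in>{1..k}. 0 \<le> x + walk X j \<omega>" using gt[of l] l by (auto simp: le_Suc_eq)
    then show False using gt[of k] by simp
  qed
  have z: "alive x j \<omega> * max (- (x + walk X (Suc j) \<omega>)) 0 = 0" if "j \<noteq> l" for j
  proof (cases "j < l")
    case True
    have "0 \<le> x + walk X (Suc j) \<omega>" using gt[of l] l True by auto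
    then show ?thesis by simp
  next
    case False
    then show ?thesis using that l by (simp add: alive_eq k)
  qed
  have "(\<lambda>k. alive x k \<omega> * max (- (x + walk X (Suc k) \<omega>)) 0) sums (alive x l \<omega> * max (- (x + walk X (Suc l) \<omega>)) 0)"
    using sums_finite[of "{l}" "\<lambda>k. alive x k \<omega> * max (- (x + walk X (Suc k) \<omega>)) 0"] z by simp
  moreover have "alive x l \<omega> = 1" using l by (simp add: alive_eq k)
  moreover have "exit_walk X x \<omega> = walk X k \<omega>" by (simp add: exit_walk_def k)
  ultimately show ?thesis using neg l by simp
qed

text \<open>Almost surely minus the exit value is x plus the overshoot. Splitting the overshoot over
  the possible exit times and exchanging sum and expectation yields the series of \<open>Vh\<close>;
  its summability at every real x makes the exchange legitimate.\<close>

lemma V_eq: "V M X x = law.Vh x"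
proof -
  define Y where "Y k \<omega> = alive x k \<omega> * max (- (x + walk X (Suc k) \<omega>)) 0" for k \<omega>
  have iY: "integrable M (Y k)" for k
    unfolding Y_def by (intro int_alive int_walk law.lin_growth_neg)
  have Y0: "0 \<le> Y k \<omega>" for k \<omega> by (simp add: Y_def alive_bounds)
  have EY: "(\<integral>\<omega>. Y k \<omega> \<partial>M) = (law.Q ^^ k) law.g x" for k
  proof -
    have "(\<integral>\<omega>. Y k \<omega> \<partial>M) = (\<integral>\<omega>. alive x k \<omega> * law.g (x + walk X k \<omega>) \<partial>M)"
      unfolding Y_def using markov_step[OF law.lin_growth_neg, of x k] by (simp only: law.g_def law.overshoot_def)
    also have "\<dots> = (law.Q ^^ k) law.g x" by (rule killed_expectation[OF law.lin_growth_g])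
    finally show ?thesis .
  qed
  have AEs: "AE \<omega> in M. (\<lambda>k. Y k \<omega>) sums (- (x + exit_walk X x \<omega>))"
    using exit_finite[of x]
  proof (rule AE_mp, intro AE_I2 impI)
    show "(\<lambda>k. Y k \<omega>) sums (- (x + exit_walk X x \<omega>))" if "exit_time X x \<omega> \<noteq> \<infinity>" for \<omega>
      unfolding Y_def by (rule exit_overshoot_sums[OF that])
  qed
  have sm: "AE \<omega> in M. summable (\<lambda>k. norm (Y k \<omega>))"
    using AEs by (rule AE_mp) (auto intro!: AE_I2 simp: Y0 sums_iff)
  have sE: "summable (\<lambda>k. \<integral>\<omega>. norm (Y k \<omega>) \<partial>M)"
    using law.summable_Qn_g_all[of x] by (simp add: Y0 EY)
  have tot: "(\<integral>\<omega>. (\<Sum>k. Y k \<omega>) \<partial>M) = (\<Sum>k. (law.Q ^^ k) law.g x)"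
    unfolding integral_suminf[OF iY sm sE] EY ..
  have iS: "integrable M (\<lambda>\<omega>. \<Sum>k. Y k \<omega>)" by (rule integrable_suminf[OF iY sm sE])
  have "- (\<integral>\<omega>. exit_walk X x \<omega> \<partial>M) = (\<integral>\<omega>. - exit_walk X x \<omega> \<partial>M)" by simp
  also have "\<dots> = (\<integral>\<omega>. x + (\<Sum>k. Y k \<omega>) \<partial>M)"
  proof -
    have [measurable]: "Y k \<in> borel_measurable M" for k using iY[of k] by auto
    have inf: "exit_time X x \<omega> = \<infinity> \<longleftrightarrow> (\<forall>n. alive x n \<omega> = 1)" for \<omega>
      by (cases "exit_time X x \<omega>") (auto simp: alive_eq)
    \<comment> \<open>An explicit formula valid everywhere, including the default value 0 when there
      is no exit; it is what makes \<open>exit_walk\<close> measurable.\<close>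
    have ex: "exit_walk X x \<omega> = (if \<forall>n. alive x n \<omega> = 1 then 0 else - (x + (\<Sum>k. Y k \<omega>)))" for \<omega>
    proof (cases "exit_time X x \<omega> = \<infinity>")
      case True
      then show ?thesis using inf[of \<omega>] by (simp add: exit_walk_def)
    next
      case False
      have "(\<lambda>k. Y k \<omega>) sums (- (x + exit_walk X x \<omega>))" unfolding Y_def by (rule exit_overshoot_sums[OF False])
      then have e: "exit_walk X x \<omega> = - (x + (\<Sum>k. Y k \<omega>))" by (simp add: sums_iff)
      have "\<not> (\<forall>n. alive x n \<omega> = 1)" using inf[of \<omega>] False by blast
      then show ?thesis unfolding e by (simp only: if_False)
    qed
    have [measurable]: "exit_walk X x \<in> borel_measurable M" unfolding ex[abs_def] by measurable
    show ?thesis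
    proof (rule integral_cong_AE)
      show "AE \<omega> in M. - exit_walk X x \<omega> = x + (\<Sum>k. Y k \<omega>)"
        using AEs
      proof (rule AE_mp, intro AE_I2 impI)
        fix \<omega> assume "(\<lambda>k. Y k \<omega>) sums (- (x + exit_walk X x \<omega>))"
        then show "- exit_walk X x \<omega> = x + (\<Sum>k. Y k \<omega>)" by (simp add: sums_iff)
      qed
    qed measurable
  qed
  also have "\<dots> = x + (\<integral>\<omega>. (\<Sum>k. Y k \<omega>) \<partial>M)" using iS prob_space by simp
  also have "\<dots> = law.Vh x" unfolding tot law.Vh_def ..
  finally show ?thesis unfolding V_def .
qed

end

theorem theorem1p4:
  fixes M :: "'a measure" and X :: "nat \<Rightarrow> 'a \<Rightarrow> real" and \<sigma> \<delta> :: real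
  assumes "prob_space M"
    and indep: "prob_space.indep_vars M (\<lambda>_. borel) X {1..}"
    and ident: "\<And>i. i \<ge> 1 \<Longrightarrow> distr M borel (X i) = distr M borel (X 1)"
    and mean: "(\<integral>\<omega>. X 1 \<omega> \<partial>M) = 0"
    and sigma_pos: "\<sigma> > 0"
    and variance: "(\<integral>\<omega>. (X 1 \<omega>)\<^sup>2 \<partial>M) = \<sigma>\<^sup>2"
    and delta_pos: "\<delta> > 0"
    and moment: "integrable M (\<lambda>\<omega>. \<bar>X 1 \<omega>\<bar> powr (2 + \<delta>))"
  shows "\<exists>c>0. \<forall>n::nat. \<forall>u x :: real. n \<ge> 1 \<longrightarrow> u \<ge> 0 \<longrightarrow>
    \<bar>measure M {\<omega> \<in> space M.
        (x + walk X n \<omega>) / (\<sigma> * sqrt (real n)) \<le> u \<and> exit_time X x \<omega> > enat n}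
      - V M X x * L (x / (\<sigma> * sqrt (real n))) / (\<sigma> * sqrt (real n))
        * (LBINT y=ereal 0..ereal u. ell_H (x / (\<sigma> * sqrt (real n))) y)\<bar>
    \<le> c * (R M X \<sigma> n \<delta> x / sqrt (real n))"
proof -
  interpret iid_walk M X \<sigma> \<delta>
    by (intro iid_walk.intro iid_walk_axioms.intro assms)
  obtain C where C: "C > 0" "\<And>n U x. 1 \<le> n \<Longrightarrow> 0 \<le> U \<Longrightarrow>
    \<bar>(law.Q ^^ n) (indicator {..U}) x - law.Vh x * kq U (\<sigma>\<^sup>2 * real n) x\<bar>
    \<le> C * ((1 / real n powr (\<delta> / 4)
        + law.Vh x * L (x / (\<sigma> * sqrt (real n))) / real n powr (\<delta> / (4 * (3 + \<delta>))) * ln (real n)) / sqrt (real n))"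
    using law.approx_all by blast
  show ?thesis
  proof (intro exI conjI allI impI)
    show "0 < C" by (rule C(1))
    fix n :: nat and u x :: real assume n: "1 \<le> n" and u: "0 \<le> u"
    let ?s = "\<sigma> * sqrt (real n)"
    have s: "0 < ?s" using n sigma_pos by simp
    have s2: "?s\<^sup>2 = \<sigma>\<^sup>2 * real n" by (simp add: power_mult_distrib)
    have main: "law.Vh x * L (x / ?s) / ?s * (LBINT y=ereal 0..ereal u. ell_H (x / ?s) y) = law.Vh x * kq (u * ?s) (\<sigma>\<^sup>2 * real n) x"
    proof -
      have "law.Vh x * L (x / ?s) / ?s * (LBINT y=ereal 0..ereal u. ell_H (x / ?s) y)
          = law.Vh x * (L (x / ?s) / ?s * (LBINT y=ereal 0..ereal u. ell_H (x / ?s) y))" by simp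
      also have "\<dots> = law.Vh x * kq (u * ?s) (?s\<^sup>2) x" unfolding main_term[OF u s] ..
      finally show ?thesis unfolding s2 .
    qed
    show "\<bar>measure M {\<omega> \<in> space M. (x + walk X n \<omega>) / ?s \<le> u \<and> exit_time X x \<omega> > enat n}
      - V M X x * L (x / ?s) / ?s * (LBINT y=ereal 0..ereal u. ell_H (x / ?s) y)\<bar> \<le> C * (R M X \<sigma> n \<delta> x / sqrt (real n))"
      unfolding prob_survive_eq_Qn[OF n] R_def V_eq main by (rule C(2)[OF n]) (use u s in simp)
  qed
qed

end
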